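(* Let $\Gamma$ be a locally finite, connected, accessible graph. Let a finitely generated group $G$ act on $\Gamma$ such that the quotient graph $G\backslash\Gamma$ is finite and each vertex stabilizer $G_v$, $v\in V(\Gamma)$, is finite. Then $G$ acts on the tree $T(\mathcal{C}_{\mathrm{opt}})$ (the structure tree of the optimal cuts of $\Gamma$, with the action induced from that on $\Gamma$) with finitely many orbits, finite edge stabilizers, and no vertex stabilizer has more than one end.
   Context: Graphs are undirected, without loops and multiple edges. A group acts on a graph by graph automorphisms; it acts with finitely many orbits if the quotient graph is finite. Ends. A graph has more than one end if there is a finite set $S$ of vertices such that removing $S$ leaves at least two infinite connected components; otherwise it has at most one end. A finitely generated group has more than one end if its Cayley graph with respect to some (equivalently, any) finite generating set has more than one end. (The vertex stabilizers in the claim are finitely generated.) Cuts. For $C\subseteq V(\Gamma)$ write $\overline{C}=V(\Gamma)\setminus C$ and $\delta C=\{uv\in E(\Gamma): u\in C, v\in\overline{C}\}$. A cut is a subset $C\subseteq V(\Gamma)$ such that $C$ and $\overline{C}$ are non-empty and induce connected subgraphs, and $\delta C$ is finite. A $k$-cut is a cut with $|\delta C|\le k$. Cuts $C,D$ are nested if one of $C\subseteq D$, $C\subseteq\overline{D}$, $\overline{C}\subseteq D$, $\overline{C}\subseteq\overline{D}$ holds. A bi-infinite simple path $\alpha$ is a sequence $(v_i)_{i\in\mathbb{Z}}$ of pairwise distinct vertices with $v_iv_{i+1}\in E(\Gamma)$; $\alpha\cap C$ denotes the set of its vertices in $C$. Put $\mathcal{C}(\alpha)=\{C : C \text{ is a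 cut and } |\alpha\cap C|=\infty=|\alpha\cap\overline{C}|\}$ and $\mathcal{C}_{\min}(\alpha)=\{C\in\mathcal{C}(\alpha): |\delta C| \text{ is minimal in } \mathcal{C}(\alpha)\}$. $\Gamma$ is accessible if there is $k\in\mathbb{N}$ such that for every bi-infinite simple path $\alpha$ either $\mathcal{C}(\alpha)=\emptyset$ or $\mathcal{C}(\alpha)$ contains a $k$-cut. Optimal cuts. Fix such a $k$. For a cut $C$ let $m(C)$ be the (finite) number of $k$-cuts $D$ that are not nested with $C$. For a bi-infinite simple path $\alpha$ with $\mathcal{C}(\alpha)\neq\emptyset$ let $m_\alpha=\min\{m(C): C\in\mathcal{C}_{\min}(\alpha)\}$ and $\mathcal{C}_{\mathrm{opt}}(\alpha)=\{C\in\mathcal{C}_{\min}(\alpha): m(C)=m_\alpha\}$ (and $\mathcal{C}_{\mathrm{opt}}(\alpha)=\emptyset$ if $\mathcal{C}(\alpha)=\emptyset$). Then $\mathcal{C}_{\mathrm{opt}}=\bigcup_\alpha \mathcal{C}_{\mathrm{opt}}(\alpha)$ over all bi-infinite simple paths $\alpha$; its elements are called optimal cuts. Structure tree. For $C,D\in\mathcal{C}_{\mathrm{opt}}$ let $C\sim D$ if either $C=D$, or both $\overline{C}\subsetneq D$ and for all $E\in\mathcal{C}_{\mathrm{opt}}$: $\overline{C}\subsetneq E\subseteq D$ implies $D=E$. This is an equivalence relation with classes $[C]$. $T(\mathcal{C}_{\mathrm{opt}})$ is the undirected graph with vertex set $\{[C]: C\in\mathcal{C}_{\mathrm{opt}}\}$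 and edges $(C,\overline{C})$, $C\in\mathcal{C}_{\mathrm{opt}}$, where $(C,\overline{C})$ goes from $[C]$ to $[\overline{C}]$ and its inverse edge is $(\overline{C},C)$. It is a tree. (A graph is connected if any two of its vertices have finite distance, and a tree is a connected graph without cycles; the empty graph is allowed, which occurs when $\mathcal{C}_{\mathrm{opt}}=\emptyset$.) An action on $\Gamma$ induces an action on $\mathcal{C}_{\mathrm{opt}}$ by $C\mapsto gC$ and on $T(\mathcal{C}_{\mathrm{opt}})$ by $[C]\mapsto[gC]$. *)

theory Defs
  imports "HOL-Algebra.Algebra" "Graph_Theory.Bidirected_Digraph" "Graph_Theory.Arc_Walk"
begin

section \<open>Graphs and ends\<close>

text \<open>The graph \<open>\<Gamma>\<close> is a vertex set \<open>V\<close> together with a set \<open>E\<close> of two-element subsets of \<open>V\<close>.\<close>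

definition simple_graph :: "'v set \<Rightarrow> 'v set set \<Rightarrow> bool" where
  "simple_graph V E \<longleftrightarrow> (\<forall>e\<in>E. \<exists>u\<in>V. \<exists>v\<in>V. u \<noteq> v \<and> e = {u, v})"

definition locally_finite :: "'v set \<Rightarrow> 'v set set \<Rightarrow> bool" where
  "locally_finite V E \<longleftrightarrow> (\<forall>v\<in>V. finite {u. {u, v} \<in> E})"

text \<open>Being joined by a path of the subgraph induced on \<open>W\<close>.\<close>

definition joined :: "'v set set \<Rightarrow> 'v set \<Rightarrow> ('v \<times> 'v) set" where
  "joined E W =
     {(u, v). u \<in> W \<and> v \<in> W \<and> (u, v) \<in> {(x, y). x \<in> W \<and> y \<in> W \<and> {x, y} \<in> E}\<^sup>*}"

definition induces_connected :: "'v set set \<Rightarrow> 'v set \<Rightarrow> bool" where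
  "induces_connected E W \<longleftrightarrow> (\<forall>u\<in>W. \<forall>v\<in>W. (u, v) \<in> joined E W)"

definition components :: "'v set set \<Rightarrow> 'v set \<Rightarrow> 'v set set" where
  "components E W = W // joined E W"

definition more_than_one_end :: "'v set \<Rightarrow> 'v set set \<Rightarrow> bool" where
  "more_than_one_end V E \<longleftrightarrow>
     (\<exists>S \<subseteq> V. finite S \<and>
        (\<exists>A \<in> components E (V - S). \<exists>B \<in> components E (V - S). A \<noteq> B \<and> infinite A \<and> infinite B))"

definition generating_set :: "('g, 'm) monoid_scheme \<Rightarrow> 'g set \<Rightarrow> bool" where
  "generating_set G S \<longleftrightarrow> S \<subseteq> carrier G \<and> generate G S = carrier G"

definition finitely_generated :: "('g, 'm) monoid_scheme \<Rightarrow> bool" where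
  "finitely_generated G \<longleftrightarrow> (\<exists>S. finite S \<and> generating_set G S)"

definition cayley_edges :: "('g, 'm) monoid_scheme \<Rightarrow> 'g set \<Rightarrow> 'g set set" where
  "cayley_edges G S =
     {{g, g \<otimes>\<^bsub>G\<^esub> s} | g s. g \<in> carrier G \<and> s \<in> S \<and> g \<otimes>\<^bsub>G\<^esub> s \<noteq> g}"

definition group_more_than_one_end :: "('g, 'm) monoid_scheme \<Rightarrow> bool" where
  "group_more_than_one_end G \<longleftrightarrow>
     (\<exists>S. finite S \<and> generating_set G S \<and> more_than_one_end (carrier G) (cayley_edges G S))"

section \<open>Cuts\<close>

definition boundary :: "'v set \<Rightarrow> 'v set set \<Rightarrow> 'v set \<Rightarrow> 'v set set" where
  "boundary V E C = {e \<in> E. \<exists>u\<in>C. \<exists>v\<in>V - C. e = {u, v}}"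

definition cut :: "'v set \<Rightarrow> 'v set set \<Rightarrow> 'v set \<Rightarrow> bool" where
  "cut V E C \<longleftrightarrow> C \<subseteq> V \<and> C \<noteq> {} \<and> V - C \<noteq> {} \<and>
     induces_connected E C \<and> induces_connected E (V - C) \<and> finite (boundary V E C)"

definition k_cut :: "'v set \<Rightarrow> 'v set set \<Rightarrow> nat \<Rightarrow> 'v set \<Rightarrow> bool" where
  "k_cut V E k C \<longleftrightarrow> cut V E C \<and> card (boundary V E C) \<le> k"

definition nested :: "'v set \<Rightarrow> 'v set \<Rightarrow> 'v set \<Rightarrow> bool" where
  "nested V C D \<longleftrightarrow> C \<subseteq> D \<or> C \<subseteq> V - D \<or> V - C \<subseteq> D \<or> V - C \<subseteq> V - D"

definition biinfinite_path :: "'v set \<Rightarrow> 'v set set \<Rightarrow> (int \<Rightarrow> 'v) \<Rightarrow> bool" where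
  "biinfinite_path V E \<alpha> \<longleftrightarrow> inj \<alpha> \<and> range \<alpha> \<subseteq> V \<and> (\<forall>i. {\<alpha> i, \<alpha> (i + 1)} \<in> E)"

definition cuts_of :: "'v set \<Rightarrow> 'v set set \<Rightarrow> (int \<Rightarrow> 'v) \<Rightarrow> 'v set set" where
  "cuts_of V E \<alpha> =
     {C. cut V E C \<and> infinite (range \<alpha> \<inter> C) \<and> infinite (range \<alpha> \<inter> (V - C))}"

definition min_cuts_of :: "'v set \<Rightarrow> 'v set set \<Rightarrow> (int \<Rightarrow> 'v) \<Rightarrow> 'v set set" where
  "min_cuts_of V E \<alpha> =
     {C. is_arg_min (\<lambda>D. card (boundary V E D)) (\<lambda>D. D \<in> cuts_of V E \<alpha>) C}"

text \<open>\<open>\<Gamma>\<close> is accessible if and only if some \<open>k\<close> satisfies the following property.  As the optimal cuts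
  depend on \<open>k\<close>, it is kept as a parameter.\<close>

definition accessible_with :: "'v set \<Rightarrow> 'v set set \<Rightarrow> nat \<Rightarrow> bool" where
  "accessible_with V E k \<longleftrightarrow>
     (\<forall>\<alpha>. biinfinite_path V E \<alpha> \<longrightarrow> cuts_of V E \<alpha> = {} \<or> (\<exists>C \<in> cuts_of V E \<alpha>. k_cut V E k C))"

text \<open>In a connected graph the set counted here is finite for every cut \<open>C\<close>.\<close>

definition crossing_number :: "'v set \<Rightarrow> 'v set set \<Rightarrow> nat \<Rightarrow> 'v set \<Rightarrow> nat" where
  "crossing_number V E k C = card {D. k_cut V E k D \<and> \<not> nested V C D}"

definition opt_cuts_of :: "'v set \<Rightarrow> 'v set set \<Rightarrow> nat \<Rightarrow> (int \<Rightarrow> 'v) \<Rightarrow> 'v set set" where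
  "opt_cuts_of V E k \<alpha> =
     {C. is_arg_min (crossing_number V E k) (\<lambda>D. D \<in> min_cuts_of V E \<alpha>) C}"

definition opt_cuts :: "'v set \<Rightarrow> 'v set set \<Rightarrow> nat \<Rightarrow> 'v set set" where
  "opt_cuts V E k = (\<Union>\<alpha> \<in> {\<alpha>. biinfinite_path V E \<alpha>}. opt_cuts_of V E k \<alpha>)"

section \<open>The structure tree\<close>

definition opt_equiv :: "'v set \<Rightarrow> 'v set set \<Rightarrow> nat \<Rightarrow> ('v set \<times> 'v set) set" where
  "opt_equiv V E k =
     {(C, D). C \<in> opt_cuts V E k \<and> D \<in> opt_cuts V E k \<and>
        (C = D \<or> (V - C \<subset> D \<and> (\<forall>F \<in> opt_cuts V E k. V - C \<subset> F \<and> F \<subseteq> D \<longrightarrow> D = F)))}"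

text \<open>The undirected graph \<open>T(C_opt)\<close> is rendered as a bidirected digraph: each undirected edge
  consists of two mutually inverse arcs \<open>(C, V - C)\<close> and \<open>(V - C, C)\<close>.\<close>

definition structure_tree ::
    "'v set \<Rightarrow> 'v set set \<Rightarrow> nat \<Rightarrow> ('v set set, 'v set \<times> 'v set) pre_digraph" where
  "structure_tree V E k =
     \<lparr> verts = opt_cuts V E k // opt_equiv V E k,
       arcs = {(C, V - C) | C. C \<in> opt_cuts V E k},
       tail = (\<lambda>(C, D). opt_equiv V E k `` {C}),
       head = (\<lambda>(C, D). opt_equiv V E k `` {D}) \<rparr>"

text \<open>Outside the arc set, \<open>bidirected_digraph\<close> requires the inversion to be the identity.\<close>

definition structure_tree_rev ::
    "'v set \<Rightarrow> 'v set set \<Rightarrow> nat \<Rightarrow> 'v set \<times> 'v set \<Rightarrow> 'v set \<times> 'v set" where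
  "structure_tree_rev V E k =
     (\<lambda>(C, D). if (C, D) \<in> arcs (structure_tree V E k) then (D, C) else (C, D))"

text \<open>Trees among bidirected graphs; the empty graph is allowed.  The library's \<open>tree\<close> does not fit:
  it excludes the empty graph and regards an arc followed by its inverse as a cycle.\<close>

definition bidirected_tree :: "('a, 'b) pre_digraph \<Rightarrow> ('b \<Rightarrow> 'b) \<Rightarrow> bool" where
  "bidirected_tree T arev \<longleftrightarrow>
     bidirected_digraph T arev \<and>
     (\<forall>u \<in> verts T. \<forall>v \<in> verts T. u \<rightarrow>\<^sup>*\<^bsub>T\<^esub> v) \<and>
     \<not> (\<exists>p. pre_digraph.cycle T p \<and> (\<forall>e \<in> set p. arev e \<notin> set p))"

section \<open>Actions on graphs\<close>

definition acts_on_graph ::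
    "('g, 'm) monoid_scheme \<Rightarrow> 'v set \<Rightarrow> 'v set set \<Rightarrow> ('g \<Rightarrow> 'v \<Rightarrow> 'v) \<Rightarrow> bool" where
  "acts_on_graph G V E \<phi> \<longleftrightarrow>
     group_action G V \<phi> \<and>
     (\<forall>g \<in> carrier G. \<forall>u \<in> V. \<forall>v \<in> V. {\<phi> g u, \<phi> g v} \<in> E \<longleftrightarrow> {u, v} \<in> E)"

definition acts_on_bidirected ::
    "('g, 'm) monoid_scheme \<Rightarrow> ('a, 'b) pre_digraph \<Rightarrow> ('b \<Rightarrow> 'b) \<Rightarrow>
     ('g \<Rightarrow> 'a \<Rightarrow> 'a) \<Rightarrow> ('g \<Rightarrow> 'b \<Rightarrow> 'b) \<Rightarrow> bool" where
  "acts_on_bidirected G T arev \<psi> \<eta> \<longleftrightarrow>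
     group_action G (verts T) \<psi> \<and> group_action G (arcs T) \<eta> \<and>
     (\<forall>g \<in> carrier G. \<forall>e \<in> arcs T.
        tail T (\<eta> g e) = \<psi> g (tail T e) \<and>
        head T (\<eta> g e) = \<psi> g (head T e) \<and>
        \<eta> g (arev e) = arev (\<eta> g e))"

text \<open>The induced action on the structure tree.  On a vertex \<open>x = [C]\<close> it is the elementwise image
  \<open>{gD | D \<in> x}\<close>; when \<open>acts_on_bidirected\<close> holds, compatibility with \<open>tail\<close> says that this is
  \<open>[gC]\<close>.  The restrictions are there because \<open>group_action\<close> demands extensional functions.\<close>

definition tree_vertex_action ::
    "'v set \<Rightarrow> 'v set set \<Rightarrow> nat \<Rightarrow> ('g \<Rightarrow> 'v \<Rightarrow> 'v) \<Rightarrow> 'g \<Rightarrow> 'v set set \<Rightarrow> 'v set set" where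
  "tree_vertex_action V E k \<phi> g =
     restrict (image (image (\<phi> g))) (verts (structure_tree V E k))"

definition tree_arc_action ::
    "'v set \<Rightarrow> 'v set set \<Rightarrow> nat \<Rightarrow> ('g \<Rightarrow> 'v \<Rightarrow> 'v) \<Rightarrow> 'g \<Rightarrow>
     'v set \<times> 'v set \<Rightarrow> 'v set \<times> 'v set" where
  "tree_arc_action V E k \<phi> g =
     restrict (map_prod (image (\<phi> g)) (image (\<phi> g))) (arcs (structure_tree V E k))"

end

theory Submission
  imports Defs
begin

text \<open>Two opposite corners \<open>C \<inter> D\<close> and \<open>(V - C) \<inter> (V - D)\<close> of two cuts have together at most as many boundary
  edges as \<open>C\<close> and \<open>D\<close>, and if they are cuts and \<open>C\<close>, \<open>D\<close> are not nested, then strictly smaller total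
  crossing number.  If \<open>C\<close> is optimal for \<open>\<alpha>\<close> and \<open>D\<close> for \<open>\<beta>\<close>, then suitable corners still separate
  \<open>\<alpha>\<close> and \<open>\<beta>\<close>, so optimal cuts are nested.  Only finitely many \<open>k\<close>-cuts contain a given edge; this
  yields finitely many optimal cuts between any two, hence a tree, and finitely many orbits.

  For the stabilizer \<open>H\<close> of a tree vertex \<open>x\<close>, contract the pairwise disjoint sets \<open>V - D\<close>, \<open>D \<in> x\<close>, to points.
  On the resulting locally finite graph \<open>H\<close> acts with finitely many orbits and finite stabilizers, so \<open>H\<close> is
  finitely generated.  If it had more than one end, an almost invariant subset of \<open>H\<close> would give a
  bi-infinite path that meets every \<open>V - D\<close> only finitely often and is separated by a cut, hence by an
  optimal one.  But for every optimal cut, it or its complement lies in some \<open>V - D\<close>.\<close>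

section \<open>Connectedness and boundaries\<close>

text \<open>The two successive minimisations in the definition of optimal cuts do different work.
  Minimal boundary size turns the submodular inequality into an equality, so corners that still
  separate the paths are minimal cuts themselves; crossing pairs survive this, and the strict drop
  of the crossing number excludes them. The difficulty is that \<open>C\<close> and \<open>D\<close>
  may belong to different paths with different minimal sizes, so each corner has to be charged to a
  path that it separates. Distributing the infinite parts of both paths over the four corners leaves
  two patterns: opposite corners carry one path each, or each path occupies a diagonal of its own.
  Accessibility bounds all minimal sizes by one \<open>k\<close>, so optimal cuts inherit the
  finiteness results for \<open>k\<close>-cuts. For the stabilizers, an arbitrary separated path
  would not do: it could escape to infinity inside one \<open>V - D\<close>, where no contradiction
  arises. It is therefore built in a connected subgraph with only finitely many vertices in every
  block.\<close>

lemma joined_refl: "u \<in> W \<Longrightarrow> (u, u) \<in> joined E W"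
  by (auto simp: joined_def)

lemma joined_step: "u \<in> W \<Longrightarrow> v \<in> W \<Longrightarrow> {u, v} \<in> E \<Longrightarrow> (u, v) \<in> joined E W"
  by (auto simp: joined_def intro!: r_into_rtrancl)

lemma joined_trans: "(u, v) \<in> joined E W \<Longrightarrow> (v, w) \<in> joined E W \<Longrightarrow> (u, w) \<in> joined E W"
  by (auto simp: joined_def)

lemma joined_sym:
  assumes "(u, v) \<in> joined E W" shows "(v, u) \<in> joined E W"
proof -
  have "sym {(x, y). x \<in> W \<and> y \<in> W \<and> {x, y} \<in> E}"
    by (auto intro!: symI simp: insert_commute)
  then show ?thesis
    using assms sym_rtrancl[THEN symD] by (fastforce simp: joined_def)
qed

lemma joined_in:
  assumes "(u, v) \<in> joined E W" shows "u \<in> W" "v \<in> W"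
  using assms by (auto simp: joined_def)

lemma joined_mono:
  assumes "(u, v) \<in> joined E W" "E \<subseteq> E'" "W \<subseteq> W'" shows "(u, v) \<in> joined E' W'"
proof -
  have "{(x, y). x \<in> W \<and> y \<in> W \<and> {x, y} \<in> E} \<subseteq> {(x, y). x \<in> W' \<and> y \<in> W' \<and> {x, y} \<in> E'}"
    using assms by auto
  from rtrancl_mono[OF this] show ?thesis
    using assms by (auto simp: joined_def)
qed

text \<open>Reachability as an invariant argument: most connectivity proofs below take for
  \<open>A\<close> the solution set of the desired property, which then only has to survive a single
  edge.\<close>

lemma joined_closed:
  assumes "(u, v) \<in> joined E W" "u \<in> A"
    and step: "\<And>x y. x \<in> A \<Longrightarrow> x \<in> W \<Longrightarrow> y \<in> W \<Longrightarrow> {x, y} \<in> E \<Longrightarrow> y \<in> A"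
  shows "v \<in> A"
proof -
  have "(u, v) \<in> {(x, y). x \<in> W \<and> y \<in> W \<and> {x, y} \<in> E}\<^sup>*"
    using assms(1) by (auto simp: joined_def)
  then show ?thesis
  proof (induction rule: rtrancl_induct)
    case base
    show ?case by (rule assms)
  next
    case (step y z)
    then show ?case by (auto intro: assms(3)[of y z])
  qed
qed

lemma joined_path:
  assumes "(u, v) \<in> joined E W"
  obtains f and n :: nat where "f 0 = u" "f n = v" "\<And>i. i \<le> n \<Longrightarrow> f i \<in> W"
    "\<And>i. i < n \<Longrightarrow> {f i, f (Suc i)} \<in> E"
proof -
  have "(u, v) \<in> {(x, y). x \<in> W \<and> y \<in> W \<and> {x, y} \<in> E}\<^sup>*"
    using assms by (auto simp: joined_def)
  then obtain n where "(u, v) \<in> {(x, y). x \<in> W \<and> y \<in> W \<and> {x, y} \<in> E} ^^ n"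
    using rtrancl_imp_relpow by blast
  then obtain f where f: "f 0 = u" "f n = v"
      "\<forall>i<n. (f i, f (Suc i)) \<in> {(x, y). x \<in> W \<and> y \<in> W \<and> {x, y} \<in> E}"
    by (auto simp: relpow_fun_conv)
  have "f i \<in> W" if "i \<le> n" for i
    using f that joined_in(2)[OF assms] by (cases "i = n") auto
  with f show thesis by (intro that[of f n]) auto
qed

lemma path_joined:
  assumes "\<And>i. m \<le> i \<Longrightarrow> i \<le> n \<Longrightarrow> f i \<in> W"
    "\<And>i. m \<le> i \<Longrightarrow> i < n \<Longrightarrow> {f i, f (Suc i)} \<in> E" "m \<le> n"
  shows "(f m, f n) \<in> joined E W"
  using assms(3,1,2)
proof (induction n rule: dec_induct)
  case base
  then show ?case by (simp add: joined_refl)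
next
  case (step n)
  then have "(f n, f (Suc n)) \<in> joined E W" by (intro joined_step) auto
  with step show ?case by (auto intro: joined_trans)
qed

lemma equiv_joined: "equiv W (joined E W)"
  by (intro equivI refl_onI symI transI)
    (auto intro: joined_refl joined_sym joined_trans dest: joined_in)

text \<open>A path inside \<open>W\<close> starting at \<open>u\<close> never leaves the component
  of \<open>u\<close>, so it can be read inside that component.\<close>

lemma joined_component: "(u, v) \<in> joined E W \<Longrightarrow> (u, v) \<in> joined E (joined E W `` {u})"
proof -
  assume uv: "(u, v) \<in> joined E W"
  then have u: "u \<in> W" by (rule joined_in)
  have "v \<in> {v. (u, v) \<in> joined E (joined E W `` {u})}"
    using uv
  proof (rule joined_closed, goal_cases)
    case 1
    then show ?case using u by (auto intro!: joined_refl)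
  next
    case (2 x y)
    then have "(u, x) \<in> joined E W" by (auto dest: joined_in)
    moreover from this 2 have "(u, y) \<in> joined E W" by (meson joined_step joined_trans)
    ultimately show ?case
      using 2 by (auto intro: joined_trans joined_step)
  qed
  then show ?thesis by simp
qed

lemma component_connected: "induces_connected E (joined E W `` {u})"
  unfolding induces_connected_def
  by (auto intro: joined_trans joined_sym dest: joined_component)

lemma component_closed:
  "x \<in> joined E W `` {u} \<Longrightarrow> y \<in> W \<Longrightarrow> {x, y} \<in> E \<Longrightarrow> y \<in> joined E W `` {u}"
  by (auto intro: joined_trans joined_step dest: joined_in)

lemma induces_connectedD: "induces_connected E W \<Longrightarrow> u \<in> W \<Longrightarrow> v \<in> W \<Longrightarrow> (u, v) \<in> joined E W"
  by (auto simp: induces_connected_def)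

lemma induces_connectedI_root:
  assumes "\<And>v. v \<in> W \<Longrightarrow> (r, v) \<in> joined E W" shows "induces_connected E W"
  unfolding induces_connected_def using assms by (meson joined_sym joined_trans)

lemma boundary_iff: "e \<in> boundary V E C \<longleftrightarrow> (\<exists>u v. e = {u, v} \<and> e \<in> E \<and> u \<in> C \<and> v \<in> V \<and> v \<notin> C)"
  by (auto simp: boundary_def)

lemma boundaryI: "{u, v} \<in> E \<Longrightarrow> u \<in> C \<Longrightarrow> v \<in> V \<Longrightarrow> v \<notin> C \<Longrightarrow> {u, v} \<in> boundary V E C"
  by (auto simp: boundary_iff)

lemma boundary_ends:
  assumes "e \<in> boundary V E C" "C \<subseteq> V"
  obtains u v where "e = {u, v}" "{u, v} \<in> E" "u \<in> C" "u \<in> V" "v \<in> V" "v \<notin> C"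
proof -
  obtain u v where "e = {u, v}" "e \<in> E" "u \<in> C" "v \<in> V" "v \<notin> C"
    using assms(1) unfolding boundary_iff by auto
  with assms(2) show thesis by (intro that[of u v]) auto
qed

lemma boundary_compl: "C \<subseteq> V \<Longrightarrow> boundary V E (V - C) = boundary V E C"
  by (auto simp: boundary_def insert_commute)

lemma boundary_subset: "boundary V E C \<subseteq> E"
  by (auto simp: boundary_def)

text \<open>A path from \<open>u\<close> to \<open>v\<close> must change sides of any set separating
  them. As \<open>Z\<close> consists of the edges of one fixed path and is chosen before
  \<open>C\<close>, a question about all such sets becomes one about finitely many edges.\<close>

lemma path_edges:
  assumes "(u, v) \<in> joined E V"
  obtains Z where "Z \<subseteq> E" "finite Z" "\<And>C. u \<in> C \<Longrightarrow> v \<notin> C \<Longrightarrow> boundary V E C \<inter> Z \<noteq> {}"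
    "\<And>C. v \<in> C \<Longrightarrow> u \<notin> C \<Longrightarrow> boundary V E C \<inter> Z \<noteq> {}"
proof -
  obtain f and n :: nat where f: "f 0 = u" "f n = v" "\<And>i. i \<le> n \<Longrightarrow> f i \<in> V"
    "\<And>i. i < n \<Longrightarrow> {f i, f (Suc i)} \<in> E"
    using joined_path[OF assms] by metis
  let ?Z = "(\<lambda>i. {f i, f (Suc i)}) ` {..<n}"
  have *: "boundary V E C \<inter> ?Z \<noteq> {}" if "(u \<in> C) \<noteq> (v \<in> C)" for C
  proof -
    have "\<exists>i<n. (f i \<in> C) \<noteq> (f (Suc i) \<in> C)"
    proof (rule ccontr)
      assume "\<not> ?thesis"
      then have "i \<le> n \<Longrightarrow> f i \<in> C \<longleftrightarrow> f 0 \<in> C" for i by (induction i) auto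
      with f that show False by auto
    qed
    then obtain i where "i < n" "(f i \<in> C) \<noteq> (f (Suc i) \<in> C)" by auto
    with f(3,4)[of i] f(3)[of "Suc i"] have "{f i, f (Suc i)} \<in> boundary V E C"
      by (cases "f i \<in> C") (auto simp: boundary_iff doubleton_eq_iff insert_commute)
    with \<open>i < n\<close> show ?thesis by auto
  qed
  show thesis by (rule that[of ?Z]) (use f * in auto)
qed

lemma connected_boundary_nonempty:
  assumes "induces_connected E V" "u \<in> V" "u \<in> C" "v \<in> V" "v \<notin> C"
  shows "boundary V E C \<noteq> {}"
  using path_edges[OF induces_connectedD[OF assms(1,2,4)]] assms by (metis inf_bot_left)

text \<open>Whether a vertex is classified alike by \<open>U\<close> and by \<open>W\<close> does
  not change along an edge, since an edge crosses both sets or neither; connectedness then gives the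
  same answer for all vertices.\<close>

lemma boundary_determines:
  assumes "induces_connected E V" "boundary V E U = boundary V E W" "U \<subseteq> V" "W \<subseteq> V"
  shows "W = U \<or> W = V - U"
proof -
  have "W = U \<or> W = V - U" if a: "a \<in> V" for a
  proof -
    have *: "v \<in> V \<and> ((v \<in> U \<longleftrightarrow> v \<in> W) \<longleftrightarrow> (a \<in> U \<longleftrightarrow> a \<in> W))" if "v \<in> V" for v
    proof -
      have "v \<in> {v. v \<in> V \<and> ((v \<in> U \<longleftrightarrow> v \<in> W) \<longleftrightarrow> (a \<in> U \<longleftrightarrow> a \<in> W))}"
        using induces_connectedD[OF assms(1) a that]
      proof (rule joined_closed, goal_cases)
        case 1 then show ?case using a by simp
      next
        case (2 x y)
        have "{x, y} \<in> boundary V E U \<longleftrightarrow> {x, y} \<in> boundary V E W" using assms by simp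
        moreover have "{x, y} \<in> boundary V E C \<longleftrightarrow> (x \<in> C) \<noteq> (y \<in> C)" for C
          using 2 by (auto simp: boundary_iff doubleton_eq_iff)
        ultimately show ?case using 2 by auto
      qed
      then show ?thesis by simp
    qed
    show ?thesis
    proof (cases "a \<in> U \<longleftrightarrow> a \<in> W")
      case True then show ?thesis using * assms by blast
    next
      case False then show ?thesis using * assms by blast
    qed
  qed
  then show ?thesis using assms by (cases "V = {}") auto
qed

text \<open>Points are added one at a time, each with a path inside \<open>P\<close> to the part
  already built. It is applied to \<open>V\<close> itself, to enclose the boundary of a cut, and to
  the single blocks of a contraction.\<close>

lemma finite_connected_hull:
  assumes conn: "induces_connected E P" and "finite B" "B \<subseteq> P"
  shows "\<exists>F. finite F \<and> B \<subseteq> F \<and> F \<subseteq> P \<and> induces_connected E F"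
  using assms(2,3)
proof (induction B rule: finite_induct)
  case empty
  then show ?case by (intro exI[of _ "{}"]) (auto simp: induces_connected_def)
next
  case (insert b B)
  then obtain F where F: "finite F" "B \<subseteq> F" "F \<subseteq> P" "induces_connected E F" by auto
  show ?case
  proof (cases "F = {}")
    case True
    with F insert show ?thesis
      by (intro exI[of _ "{b}"]) (auto simp: induces_connected_def joined_refl)
  next
    case False
    then obtain a where a: "a \<in> F" by auto
    have "(a, b) \<in> joined E P" using conn a F insert by (auto intro: induces_connectedD)
    then obtain f and n :: nat where f: "f 0 = a" "f n = b" "\<And>i. i \<le> n \<Longrightarrow> f i \<in> P"
      "\<And>i. i < n \<Longrightarrow> {f i, f (Suc i)} \<in> E"
      using joined_path by metis
    let ?F = "F \<union> f ` {..n}"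
    have "induces_connected E ?F"
    proof (rule induces_connectedI_root[of _ a])
      fix v assume "v \<in> ?F"
      then show "(a, v) \<in> joined E ?F"
      proof
        assume "v \<in> F"
        then show ?thesis using F a by (auto intro: joined_mono[OF induces_connectedD])
      next
        assume "v \<in> f ` {..n}"
        then obtain i where i: "i \<le> n" "v = f i" by auto
        have "(f 0, f i) \<in> joined E ?F"
          by (rule path_joined) (use f i in auto)
        with f i show ?thesis by simp
      qed
    qed
    moreover have "b \<in> ?F" using f(2) by (metis UnCI atMost_iff imageI order_refl)
    ultimately show ?thesis using F f by (intro exI[of _ ?F]) auto
  qed
qed

text \<open>Only finitely many components of \<open>W\<close> occur, because each of them meets the finite boundary.\<close>

lemma infinite_component:
  assumes conn: "induces_connected E V" and W: "W \<subseteq> V" "W \<noteq> V" and fin: "finite (boundary V E W)"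
    and inf: "infinite (R \<inter> W)"
  obtains U where "U \<subseteq> W" "induces_connected E U" "infinite (R \<inter> U)" "boundary V E U \<subseteq> boundary V E W"
    "\<exists>w\<in>W. U = joined E W `` {w}"
proof -
  let ?K = "W // joined E W"
  have "\<Union> ?K = W" using Union_quotient[OF equiv_joined] .
  define B where "B = \<Union> (boundary V E W)"
  have "finite e" if "e \<in> boundary V E W" for e
    using that unfolding boundary_iff by (metis finite.emptyI finite_insert)
  then have "finite B" unfolding B_def using fin by (intro finite_Union) auto
  have meets: "\<exists>b\<in>B. U = joined E W `` {b}" if U: "U \<in> ?K" for U
  proof -
    obtain w where w: "w \<in> W" "U = joined E W `` {w}" using U by (auto elim: quotientE)
    obtain v where v: "v \<in> V" "v \<notin> W" using W by auto
    have "w \<in> U" using w by (auto intro: joined_refl)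
    moreover have "U \<subseteq> W" using w by (auto dest: joined_in)
    ultimately have "boundary V E U \<noteq> {}"
      using connected_boundary_nonempty[OF conn, of w U v] w v W by auto
    then obtain x y where xy: "{x, y} \<in> E" "x \<in> U" "y \<in> V" "y \<notin> U" by (auto simp: boundary_iff)
    then have "y \<notin> W" using component_closed[of x E W w y] w by auto
    with xy \<open>U \<subseteq> W\<close> have "x \<in> B" unfolding B_def using boundaryI[of x y E W V] by auto
    moreover have "U = joined E W `` {x}"
      using w xy equiv_class_eq[OF equiv_joined] by fastforce
    ultimately show ?thesis by auto
  qed
  have "finite ?K"
    by (rule finite_subset[of _ "(\<lambda>b. joined E W `` {b}) ` B"]) (use meets \<open>finite B\<close> in auto)
  moreover have "R \<inter> W = (\<Union>U\<in>?K. R \<inter> U)" using \<open>\<Union> ?K = W\<close> by auto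
  ultimately obtain U where U: "U \<in> ?K" "infinite (R \<inter> U)" using inf by (metis finite_UN_I)
  then obtain w where w: "w \<in> W" "U = joined E W `` {w}" by (auto elim: quotientE)
  show thesis
  proof (rule that[of U])
    show sub: "U \<subseteq> W" using w by (auto dest: joined_in)
    show "induces_connected E U" using w component_connected by auto
    show "infinite (R \<inter> U)" by fact
    have cl: "\<And>x y. x \<in> U \<Longrightarrow> y \<in> W \<Longrightarrow> {x, y} \<in> E \<Longrightarrow> y \<in> U" using component_closed[of _ E W w] w by simp
    show "boundary V E U \<subseteq> boundary V E W"
      unfolding boundary_iff subset_iff using sub cl by blast
    show "\<exists>w\<in>W. U = joined E W `` {w}" using w by auto
  qed
qed

text \<open>From a vertex outside \<open>U\<close>, walk to \<open>W\<close> and stop on first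
  entering it. Until then the walk runs in \<open>V - W\<close>, where the component
  \<open>U\<close> cannot be entered from outside; the connected set \<open>W\<close> joins the ends
  of all these walks.\<close>

lemma compl_component_connected:
  assumes conn: "induces_connected E V" and W: "W \<subseteq> V" "W \<noteq> {}" "induces_connected E W"
    and U: "U = joined E (V - W) `` {w}"
  shows "induces_connected E (V - U)"
proof -
  obtain r where r: "r \<in> W" using W by auto
  have sub: "U \<subseteq> V - W" using U by (auto dest: joined_in)
  have W': "(r, x) \<in> joined E (V - U)" if "x \<in> W" for x
    using induces_connectedD[OF W(3) r that] by (rule joined_mono) (use sub W in auto)
  show ?thesis
  proof (rule induces_connectedI_root[of _ r])
    fix v assume v: "v \<in> V - U"
    then obtain f and n :: nat where f: "f 0 = v" "f n = r" "\<And>i. i \<le> n \<Longrightarrow> f i \<in> V"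
      "\<And>i. i < n \<Longrightarrow> {f i, f (Suc i)} \<in> E"
      using joined_path[OF induces_connectedD[OF conn], of v r] r W by (metis DiffD1 subsetD)
    define m where "m = (LEAST i. f i \<in> W)"
    have fn: "f n \<in> W" using f r by simp
    have m: "f m \<in> W" "m \<le> n" "\<And>i. i < m \<Longrightarrow> f i \<notin> W"
      using fn unfolding m_def by (auto intro: LeastI Least_le dest: not_less_Least)
    have nU: "f i \<notin> U" if "i \<le> m" for i
      using that
    proof (induction i)
      case 0 then show ?case using v f by auto
    next
      case (Suc i)
      show ?case
      proof
        assume a: "f (Suc i) \<in> U"
        have "{f (Suc i), f i} \<in> E" using f(4)[of i] Suc m by (simp add: insert_commute)
        then have "f i \<in> U" using component_closed[of "f (Suc i)" E "V - W" w "f i"] a U Suc m f(3)[of i] by auto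
        with Suc show False by auto
      qed
    qed
    have "(f 0, f m) \<in> joined E (V - U)"
      by (rule path_joined) (use nU f m in auto)
    then show "(r, v) \<in> joined E (V - U)"
      using W'[OF m(1)] f by (auto intro: joined_trans joined_sym)
  qed
qed

text \<open>One component is not enough, since the complement of a component \<open>U\<close> of
  \<open>W\<close> may be disconnected. Passing on to a component \<open>C\<close> of
  \<open>V - U\<close> makes both sides connected, and neither passage creates a boundary
  edge.\<close>

lemma separating_cut:
  assumes conn: "induces_connected E V" and W: "W \<subseteq> V"
    and fin: "finite (boundary V E W)" and R: "infinite (R \<inter> W)" "infinite (R \<inter> (V - W))"
  obtains C where "cut V E C" "infinite (R \<inter> C)" "infinite (R \<inter> (V - C))"
    "boundary V E C \<subseteq> boundary V E W"
proof -
  have WV: "W \<noteq> V" using R by auto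
  obtain U where U: "U \<subseteq> W" "induces_connected E U" "infinite (R \<inter> U)" "boundary V E U \<subseteq> boundary V E W"
    using infinite_component[OF conn W WV fin R(1)] by metis
  have UV: "U \<subseteq> V" using U W by auto
  have b: "boundary V E (V - U) = boundary V E U" using UV by (rule boundary_compl)
  have finU: "finite (boundary V E (V - U))" using b U fin finite_subset by metis
  have infU: "infinite (R \<inter> (V - U))"
    by (rule infinite_super[OF _ R(2)]) (use U in auto)
  have neU: "U \<noteq> {}" using U by auto
  obtain C w where C: "C \<subseteq> V - U" "induces_connected E C" "infinite (R \<inter> C)"
    "boundary V E C \<subseteq> boundary V E (V - U)" "C = joined E (V - U) `` {w}"
    by (rule infinite_component[OF conn _ _ finU infU]) (use UV neU in auto)
  have inf: "infinite (R \<inter> (V - C))"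
    by (rule infinite_super[OF _ U(3)]) (use UV C in auto)
  show thesis
  proof (rule that[of C])
    show "boundary V E C \<subseteq> boundary V E W" using C b U by auto
    then have "finite (boundary V E C)" using fin finite_subset by auto
    moreover have "induces_connected E (V - C)"
      using compl_component_connected[OF conn UV neU U(2) C(5)] .
    ultimately show "cut V E C"
      unfolding cut_def using C(1-3) inf by fastforce
  qed (use C inf in auto)
qed

section \<open>Rays and bi-infinite paths\<close>

text \<open>Koenig's lemma along geodesics: a vertex with infinitely many vertices geodesically
  beyond it has a neighbour, one step further from \<open>r\<close>, with the same property.
  Distances from \<open>r\<close> increase along the ray, so it is injective.\<close>

lemma ray_exists:
  assumes conn: "induces_connected E W" and inf: "infinite W" and r: "r \<in> W"
    and lf: "\<And>v. v \<in> W \<Longrightarrow> finite {u \<in> W. {u, v} \<in> E}"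
  obtains f :: "nat \<Rightarrow> 'v" where "inj f" "range f \<subseteq> W" "\<And>i. {f i, f (Suc i)} \<in> E"
proof -
  define R where "R = {(x, y). x \<in> W \<and> y \<in> W \<and> {x, y} \<in> E}"
  define d where "d v = (LEAST n. (r, v) \<in> R ^^ n)" for v
  \<comment> \<open>The vertices beyond \<open>u\<close>: those reached from \<open>r\<close> by
    some geodesic through \<open>u\<close>.\<close>
  define D where "D u = {w \<in> W. \<exists>m. (u, w) \<in> R ^^ m \<and> d w = d u + m}" for u
  have ex: "\<exists>n. (r, v) \<in> R ^^ n" if "v \<in> W" for v
    using induces_connectedD[OF conn r that] rtrancl_imp_relpow unfolding joined_def R_def by fastforce
  have dR: "(r, v) \<in> R ^^ d v" if "v \<in> W" for v
    unfolding d_def using LeastI_ex[OF ex[OF that]] .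
  have dle: "d v \<le> n" if "(r, v) \<in> R ^^ n" for v n
    unfolding d_def using that by (rule Least_le)
  have d_add: "d w \<le> d v + m" if "v \<in> W" "(v, w) \<in> R ^^ m" for v w m
    by (rule dle) (use dR[OF that(1)] that(2) in \<open>auto simp: relpow_add\<close>)
  have "d r = 0" using dle[of r 0] by simp
  then have "D r = W" unfolding D_def using dR by auto
  have next_ex: "\<exists>u'. (u' \<in> W \<and> infinite (D u')) \<and> (u, u') \<in> R \<and> d u' = Suc (d u)"
    if u: "u \<in> W" "infinite (D u)" for u
  proof (rule ccontr)
    assume neg: "\<not> ?thesis"
    let ?N = "{u' \<in> W. {u', u} \<in> E \<and> d u' = Suc (d u)}"
    have "D u \<subseteq> insert u (\<Union>u' \<in> ?N. D u')"
    proof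
      fix w assume w: "w \<in> D u"
      then obtain m where m: "(u, w) \<in> R ^^ m" "d w = d u + m" "w \<in> W" by (auto simp: D_def)
      show "w \<in> insert u (\<Union>u' \<in> ?N. D u')"
      proof (cases m)
        case 0 then show ?thesis using m by auto
      next
        case (Suc m')
        then obtain u' where u': "(u, u') \<in> R" "(u', w) \<in> R ^^ m'" using m by (meson relpow_Suc_E2)
        have "u' \<in> W" using u' by (auto simp: R_def)
        have "d u' \<le> d u + 1" using d_add[of u u' 1] u' u by simp
        moreover have "d w \<le> d u' + m'" using d_add u' \<open>u' \<in> W\<close> by blast
        ultimately have "d u' = Suc (d u)" "d w = d u' + m'" using m Suc by auto
        then have "w \<in> D u'" "u' \<in> ?N"
          using m u' by (auto simp: D_def R_def insert_commute)
        then show ?thesis by auto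
      qed
    qed
    moreover have "finite ?N" by (rule finite_subset[OF _ lf[OF u(1)]]) auto
    moreover have "finite (D u')" if "u' \<in> ?N" for u'
      using neg that u by (auto simp: R_def insert_commute)
    ultimately have "finite (D u)" by (meson finite_UN_I finite_insert finite_subset)
    with u show False by simp
  qed
  obtain f :: "nat \<Rightarrow> 'v" where f: "\<And>n. f n \<in> W \<and> infinite (D (f n))"
      "\<And>n. (f n, f (Suc n)) \<in> R \<and> d (f (Suc n)) = Suc (d (f n))"
  proof -
    have "\<exists>f. \<forall>n. (f n \<in> W \<and> infinite (D (f n))) \<and> (f n, f (Suc n)) \<in> R \<and> d (f (Suc n)) = Suc (d (f n))"
      by (rule dependent_nat_choice) (use r \<open>D r = W\<close> inf next_ex in auto)
    with that show thesis by auto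
  qed
  have "d (f n) = d (f 0) + n" for n by (induction n) (auto simp: f)
  then have "inj f" by (metis add_left_cancel injI)
  then show thesis
    by (rule that) (use f in \<open>auto simp: R_def\<close>)
qed

text \<open>A ray on each side is joined by a shortest walk between the rays; the result is simple
  because minimality keeps the walk off both rays except at its ends.\<close>

lemma biinfinite_path_across:
  assumes conn: "induces_connected E V" and lf: "locally_finite V E" and W: "W \<subseteq> V"
    and fin: "finite (boundary V E W)" and inf: "infinite W" "infinite (V - W)"
  obtains \<alpha> where "biinfinite_path V E \<alpha>" "infinite (range \<alpha> \<inter> W)" "infinite (range \<alpha> \<inter> (V - W))"
proof -
  have ray: "\<exists>f :: nat \<Rightarrow> 'a. inj f \<and> range f \<subseteq> A \<and> (\<forall>i. {f i, f (Suc i)} \<in> E)"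
    if A: "A \<subseteq> V" "finite (boundary V E A)" "infinite A" "A \<noteq> V" for A
  proof -
    have "infinite (V \<inter> A)" using A by (simp add: Int_absorb1)
    then obtain U where U: "U \<subseteq> A" "induces_connected E U" "infinite (V \<inter> U)"
      using infinite_component[OF conn A(1,4,2)] by metis
    have "infinite U" using U(3) by auto
    then obtain r where "r \<in> U" by (metis finite.emptyI ex_in_conv)
    have lfU: "finite {u \<in> U. {u, v} \<in> E}" if "v \<in> U" for v
      using lf A U that unfolding locally_finite_def
      by (intro finite_subset[of "{u \<in> U. {u, v} \<in> E}" "{u. {u, v} \<in> E}"]) auto
    obtain f :: "nat \<Rightarrow> 'a" where "inj f" "range f \<subseteq> U" "\<And>i. {f i, f (Suc i)} \<in> E"
      using ray_exists[OF U(2) \<open>infinite U\<close> \<open>r \<in> U\<close> lfU] by blast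
    with U show ?thesis by blast
  qed
  obtain f :: "nat \<Rightarrow> 'a" where f: "inj f" "range f \<subseteq> W" "\<And>i. {f i, f (Suc i)} \<in> E"
    using ray[OF W fin inf(1)] inf by (metis Diff_cancel finite.emptyI)
  obtain g :: "nat \<Rightarrow> 'a" where g: "inj g" "range g \<subseteq> V - W" "\<And>i. {g i, g (Suc i)} \<in> E"
  proof -
    have "W \<noteq> {}" using inf(1) by auto
    then have "V - W \<noteq> V" using W by auto
    then show thesis using ray[of "V - W"] inf(2) fin that by (auto simp: boundary_compl[OF W])
  qed
  have fW: "f l \<in> W" and fV: "f l \<in> V" and gW: "g l \<notin> W" and gV: "g l \<in> V" for l
    using range_subsetD[OF f(2)] range_subsetD[OF g(2)] W by auto
  define R where "R = {(x, y). x \<in> V \<and> y \<in> V \<and> {x, y} \<in> E}"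
  \<comment> \<open>The minimum runs over the indices on both rays, so a walk of length
    \<open>N\<close> can neither touch a ray too early or too late nor visit a vertex twice: each
    would give a shorter walk.\<close>
  define N where "N = (LEAST n. \<exists>i j. (f i, g j) \<in> R ^^ n)"
  have "(f 0, g 0) \<in> joined E V"
    by (rule induces_connectedD[OF conn fV gV])
  then have ex: "\<exists>n i j. (f i, g j) \<in> R ^^ n"
    using rtrancl_imp_relpow unfolding joined_def R_def by fastforce
  obtain i j where "(f i, g j) \<in> R ^^ N" using LeastI_ex[OF ex] unfolding N_def by auto
  then obtain p where p: "p 0 = f i" "p N = g j" "\<And>l. l < N \<Longrightarrow> (p l, p (Suc l)) \<in> R"
    unfolding relpow_fun_conv by auto
  have Nmin: "N \<le> n" if "(f i', g j') \<in> R ^^ n" for i' j' n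
    unfolding N_def by (rule Least_le) (use that in auto)
  have sub: "(p a, p b) \<in> R ^^ (b - a)" if "a \<le> b" "b \<le> N" for a b
    unfolding relpow_fun_conv
    by (rule exI[of _ "\<lambda>l. p (a + l)"]) (use that p in auto)
  have pf: "p l \<noteq> f i'" if "0 < l" "l \<le> N" for l i'
    using Nmin[of i' j "N - l"] sub[of l N] that p by auto
  have pg: "p l \<noteq> g j'" if "l < N" for l j'
    using Nmin[of i j' l] sub[of 0 l] that p by auto
  have pinj: "p a \<noteq> p b" if "a < b" "b \<le> N" for a b
  proof
    assume "p a = p b"
    then have "(p 0, p N) \<in> R ^^ (a + (N - b))"
      unfolding relpow_add using sub[of 0 a] sub[of b N] that by auto
    with Nmin[of i j] p that show False by fastforce
  qed
  have fg: "f a \<noteq> g b" for a b using fW gW by metis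
  have N0: "0 < N" using p fg by (cases N) auto
  \<comment> \<open>The ray \<open>f\<close> is traversed backwards, arriving at \<open>f i\<close>
    at time 0; the walk fills the times strictly between 0 and \<open>N\<close>; \<open>g\<close>
    takes over with \<open>g j\<close> at time \<open>N\<close>. The parts of the rays before
    \<open>i\<close> and \<open>j\<close> are dropped.\<close>
  define \<alpha> where "\<alpha> t = (if t \<le> 0 then f (i + nat (- t)) else if t < int N then p (nat t)
      else g (j + nat (t - int N)))" for t :: int
  have "\<alpha> x \<noteq> \<alpha> y" if "x < y" for x y
  proof -
    consider "y \<le> 0" | "x \<le> 0" "0 < y" "y < int N" | "x \<le> 0" "int N \<le> y"
      | "0 < x" "y < int N" | "0 < x" "x < int N" "int N \<le> y" | "int N \<le> x"
      by linarith
    then show ?thesis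
    proof cases
      case 1 then show ?thesis using that f(1) by (auto simp: \<alpha>_def inj_eq)
    next
      case 2 then show ?thesis using pf[of "nat y" "i + nat (- x)"] by (simp add: \<alpha>_def nat_le_iff)
    next
      case 3 then show ?thesis using fg N0 by (auto simp: \<alpha>_def)
    next
      case 4 then show ?thesis using pinj[of "nat x" "nat y"] that by (auto simp: \<alpha>_def)
    next
      case 5 then show ?thesis using pg[of "nat x"] by (auto simp: \<alpha>_def)
    next
      case 6 then show ?thesis using that g(1) N0 by (auto simp: \<alpha>_def inj_eq)
    qed
  qed
  then have inj: "inj \<alpha>" by (intro linorder_injI) auto
  have pV: "p l \<in> V" if "l < N" for l using p(3)[OF that] by (auto simp: R_def)
  have ran: "range \<alpha> \<subseteq> V" using fV gV pV by (auto simp: \<alpha>_def)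
  have edge: "{\<alpha> t, \<alpha> (t + 1)} \<in> E" for t
  proof -
    consider "t < 0" | "0 \<le> t" "t < int N" | "int N \<le> t" by linarith
    then show ?thesis
    proof cases
      case 1
      then have "nat (- t) = Suc (nat (- (t + 1)))" by auto
      then show ?thesis using 1 f(3)[of "i + nat (- (t + 1))"] by (auto simp: \<alpha>_def insert_commute)
    next
      case 2
      have "\<alpha> t = p (nat t)" using 2 p by (auto simp: \<alpha>_def)
      moreover have "\<alpha> (t + 1) = p (Suc (nat t))"
      proof (cases "t + 1 = int N")
        case True
        then have "N = Suc (nat t)" using 2 by auto
        then show ?thesis using 2 p True by (auto simp: \<alpha>_def)
      next
        case False
        then show ?thesis using 2 by (auto simp: \<alpha>_def nat_add_distrib)
      qed
      ultimately show ?thesis using p(3)[of "nat t"] 2 by (auto simp: R_def)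
    next
      case 3
      then have "nat (t + 1 - int N) = Suc (nat (t - int N))" by auto
      then show ?thesis using 3 N0 g(3)[of "j + nat (t - int N)"] by (auto simp: \<alpha>_def)
    qed
  qed
  have "infinite (range (\<lambda>n. \<alpha> (- int n)))" "infinite (range (\<lambda>n. \<alpha> (int N + int n)))"
    using inj by (auto intro!: range_inj_infinite injI dest: injD)
  moreover have "\<alpha> (- int n) \<in> W" "\<alpha> (int N + int n) \<in> V - W" for n
    using fW gW gV N0 by (auto simp: \<alpha>_def)
  then have "range (\<lambda>n. \<alpha> (- int n)) \<subseteq> range \<alpha> \<inter> W"
    "range (\<lambda>n. \<alpha> (int N + int n)) \<subseteq> range \<alpha> \<inter> (V - W)" by auto
  ultimately have "infinite (range \<alpha> \<inter> W)" "infinite (range \<alpha> \<inter> (V - W))"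
    using infinite_super by blast+
  then show thesis
    using inj ran edge by (intro that[of \<alpha>]) (auto simp: biinfinite_path_def)
qed

section \<open>Optimal cuts are nested\<close>

lemma induces_connected_remove_edge:
  assumes "induces_connected E C" "\<not> e \<subseteq> C"
  shows "induces_connected (E - {e}) C"
proof -
  have "{(x, y). x \<in> C \<and> y \<in> C \<and> {x, y} \<in> E - {e}} = {(x, y). x \<in> C \<and> y \<in> C \<and> {x, y} \<in> E}"
    using assms(2) by auto
  then have "joined (E - {e}) C = joined E C" by (simp add: joined_def)
  with assms show ?thesis by (simp add: induces_connected_def)
qed

text \<open>Removing the edge lowers the size of all cuts through it by one, and a path between its end points
  that survives the removal must cross each of them.\<close>

lemma finite_cuts_through_edge:
  "finite {C. C \<subseteq> V \<and> induces_connected E C \<and> induces_connected E (V - C) \<and>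
     finite (boundary V E C) \<and> card (boundary V E C) \<le> k \<and> e \<in> boundary V E C}"
\<comment> \<open>Deleting \<open>e\<close> changes the edge set, and the smaller bound is then
  applied to another edge \<open>f\<close>, so both must be general in the induction.\<close>
proof (induction k arbitrary: E e)
  case 0
  then show ?case by (auto simp: card_eq_0_iff intro: finite_subset[of _ "{}"])
next
  case (Suc k)
  define S where "S k E e = {C. C \<subseteq> V \<and> induces_connected E C \<and> induces_connected E (V - C) \<and>
     finite (boundary V E C) \<and> card (boundary V E C) \<le> k \<and> e \<in> boundary V E C}" for k E e
  have IH: "finite (S k E e)" for E e unfolding S_def by (rule Suc)
  have "finite (S (Suc k) E e)"
  proof (cases "S (Suc k) E e = {}")
    case True then show ?thesis by simp
  next
    case False
    then obtain C0 where C0: "C0 \<in> S (Suc k) E e" by auto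
    then obtain u v where e: "e = {u, v}" "e \<in> E" "u \<in> V" "v \<in> V"
      by (auto simp: S_def boundary_iff)
    let ?E = "E - {e}"
    have C: "(u \<in> C) \<noteq> (v \<in> C)" "induces_connected ?E C" "induces_connected ?E (V - C)"
      "boundary V ?E C = boundary V E C - {e}" "C \<subseteq> V"
      if "C \<in> S (Suc k) E e" for C
    proof -
      show uv: "(u \<in> C) \<noteq> (v \<in> C)" using that e by (auto simp: S_def boundary_iff doubleton_eq_iff)
      show "induces_connected ?E C" "induces_connected ?E (V - C)"
        using that e uv by (auto simp: S_def intro!: induces_connected_remove_edge)
      show "boundary V ?E C = boundary V E C - {e}" by (auto simp: boundary_def)
      show "C \<subseteq> V" using that by (auto simp: S_def)
    qed
    show ?thesis
    proof (cases "(u, v) \<in> joined ?E V")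
      case True
      then obtain Z where Z: "Z \<subseteq> ?E" "finite Z" "\<And>C. u \<in> C \<Longrightarrow> v \<notin> C \<Longrightarrow> boundary V ?E C \<inter> Z \<noteq> {}"
        "\<And>C. v \<in> C \<Longrightarrow> u \<notin> C \<Longrightarrow> boundary V ?E C \<inter> Z \<noteq> {}"
        using path_edges by metis
      have "S (Suc k) E e \<subseteq> (\<Union>f\<in>Z. S k ?E f)"
      proof
        fix C assume CS: "C \<in> S (Suc k) E e"
        then obtain f where f: "f \<in> Z" "f \<in> boundary V ?E C" using Z(3,4)[of C] C(1)[OF CS] by blast
        have fin: "finite (boundary V E C)" and "e \<in> boundary V E C" "card (boundary V E C) \<le> Suc k"
          using CS by (auto simp: S_def)
        then have "card (boundary V ?E C) \<le> k"
          unfolding C(4)[OF CS] by (simp add: card_Diff_singleton)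
        then have "C \<in> S k ?E f"
          unfolding S_def using C(2-5)[OF CS] f fin by auto
        then show "C \<in> (\<Union>f\<in>Z. S k ?E f)" using f by auto
      qed
      then show ?thesis using Z(2) IH by (rule finite_subset[OF _ finite_UN_I])
    next
      case False
      \<comment> \<open>Now \<open>e\<close> is a bridge. Since \<open>C\<close> and
        \<open>V - C\<close> stay connected after its deletion, \<open>C\<close> must be the
        component of the end point of \<open>e\<close> that it contains, which leaves two
        candidates.\<close>
      have comp: "C = joined ?E V `` {x}"
        if CS: "C \<in> S (Suc k) E e" and x: "x \<in> C" "y \<notin> C" "{x, y} = {u, v}" for C x y
      proof
        have xV: "x \<in> V" "y \<in> V" using x e C(5)[OF CS] by (auto simp: doubleton_eq_iff)
        show "C \<subseteq> joined ?E V `` {x}"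
          using induces_connectedD[OF C(2)[OF CS] x(1)] C(5)[OF CS] by (auto intro: joined_mono)
        have nj: "(x, y) \<notin> joined ?E V" using False x(3) by (auto simp: doubleton_eq_iff dest: joined_sym)
        show "joined ?E V `` {x} \<subseteq> C"
        proof
          fix w assume "w \<in> joined ?E V `` {x}"
          then have w: "(x, w) \<in> joined ?E V" by simp
          show "w \<in> C"
          proof (rule ccontr)
            assume "w \<notin> C"
            then have "(w, y) \<in> joined ?E (V - C)"
              using joined_in(2)[OF w] xV x by (intro induces_connectedD[OF C(3)[OF CS]]) auto
            then have "(w, y) \<in> joined ?E V" by (rule joined_mono) auto
            with w nj show False by (meson joined_trans)
          qed
        qed
      qed
      have "C \<in> {joined ?E V `` {u}, joined ?E V `` {v}}" if CS: "C \<in> S (Suc k) E e" for C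
        using C(1)[OF CS] comp[OF CS, of u v] comp[OF CS, of v u] by (auto simp: insert_commute)
      then have "S (Suc k) E e \<subseteq> {joined ?E V `` {u}, joined ?E V `` {v}}" by blast
      then show ?thesis by (rule finite_subset) auto
    qed
  qed
  then show ?case by (simp add: S_def)
qed

section \<open>Corners of two cuts\<close>

lemma nested_sym: "C \<subseteq> V \<Longrightarrow> D \<subseteq> V \<Longrightarrow> nested V C D \<Longrightarrow> nested V D C"
  unfolding nested_def by blast

lemma nested_compl_left: "C \<subseteq> V \<Longrightarrow> nested V (V - C) D \<longleftrightarrow> nested V C D"
  unfolding nested_def by (auto simp: double_diff)

lemma nested_compl_right: "D \<subseteq> V \<Longrightarrow> nested V C (V - D) \<longleftrightarrow> nested V C D"
  unfolding nested_def by (auto simp: double_diff)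

text \<open>One side of \<open>C\<close> lies in a side of \<open>F\<close>, and each side of
  \<open>C\<close> contains one of the two corners.\<close>

lemma nested_corners:
  assumes "C \<subseteq> V" "D \<subseteq> V" "F \<subseteq> V" "nested V C F"
  shows "nested V (C \<inter> D) F \<or> nested V ((V - C) \<inter> (V - D)) F"
  using assms unfolding nested_def by blast

text \<open>Some side of \<open>C\<close> and some side of \<open>D\<close> lie in sides of
  \<open>F\<close>. These must be the same side of \<open>F\<close>, for otherwise the two would be
  disjoint and \<open>C\<close>, \<open>D\<close> nested. Each corner then lies in that side or
  contains its complement.\<close>

lemma nested_both_corners:
  assumes "C \<subseteq> V" "D \<subseteq> V" "F \<subseteq> V" "nested V C F" "nested V D F" "\<not> nested V C D"
  shows "nested V (C \<inter> D) F" "nested V ((V - C) \<inter> (V - D)) F"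
  using assms unfolding nested_def by blast+

lemma cut_compl: "cut V E C \<Longrightarrow> cut V E (V - C)"
  by (auto simp: cut_def boundary_compl double_diff)

lemma k_cut_compl: "k_cut V E k C \<Longrightarrow> k_cut V E k (V - C)"
  by (auto simp: k_cut_def cut_compl boundary_compl cut_def[of V E C])

text \<open>An edge counted on the left crosses \<open>C\<close> or \<open>D\<close>; an edge
  counted twice joins the two corners and crosses both. Inclusion-exclusion on both sides turns this
  into the inequality.\<close>

lemma boundary_submodular:
  assumes "C \<subseteq> V" "D \<subseteq> V" "finite (boundary V E C)" "finite (boundary V E D)"
  shows "card (boundary V E (C \<inter> D)) + card (boundary V E ((V - C) \<inter> (V - D)))
    \<le> card (boundary V E C) + card (boundary V E D)"
    and "finite (boundary V E (C \<inter> D))" "finite (boundary V E ((V - C) \<inter> (V - D)))"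
proof -
  let ?A = "boundary V E (C \<inter> D)" and ?B = "boundary V E ((V - C) \<inter> (V - D))"
  let ?C = "boundary V E C" and ?D = "boundary V E D"
  have edge: "e \<in> boundary V E P \<longleftrightarrow> (u \<in> P) \<noteq> (v \<in> P)"
    if "e = {u, v}" "e \<in> E" "u \<in> V" "v \<in> V" for e u v P
    using that by (auto simp: boundary_iff doubleton_eq_iff)
  have ends: "\<exists>u v. e = {u, v} \<and> e \<in> E \<and> u \<in> V \<and> v \<in> V" if "e \<in> ?A \<union> ?B" for e
    using that
  proof
    assume "e \<in> ?A"
    then show ?thesis by (rule boundary_ends) (use assms in auto)
  next
    assume "e \<in> ?B"
    then show ?thesis by (rule boundary_ends) (use assms in auto)
  qed
  have sub: "?A \<union> ?B \<subseteq> ?C \<union> ?D"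
  proof
    fix e assume e: "e \<in> ?A \<union> ?B"
    then obtain u v where "e = {u, v}" "e \<in> E" "u \<in> V" "v \<in> V" using ends by blast
    with e show "e \<in> ?C \<union> ?D" by (auto simp: edge)
  qed
  have int: "?A \<inter> ?B \<subseteq> ?C \<inter> ?D"
  proof
    fix e assume e: "e \<in> ?A \<inter> ?B"
    then obtain u v where "e = {u, v}" "e \<in> E" "u \<in> V" "v \<in> V" using ends by blast
    with e show "e \<in> ?C \<inter> ?D" by (auto simp: edge)
  qed
  have fin: "finite (?C \<union> ?D)" using assms by simp
  then show fA: "finite ?A" and fB: "finite ?B" using sub by (auto intro: finite_subset)
  have "card ?A + card ?B = card (?A \<union> ?B) + card (?A \<inter> ?B)" using fA fB by (rule card_Un_Int)
  also have "\<dots> \<le> card (?C \<union> ?D) + card (?C \<inter> ?D)"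
    using card_mono[OF fin sub] card_mono[OF _ int] assms by simp
  also have "\<dots> = card ?C + card ?D" using card_Un_Int assms by metis
  finally show "card ?A + card ?B \<le> card ?C + card ?D" .
qed

locale connected_graph =
  fixes V :: "'v set" and E :: "'v set set" and k :: nat
  assumes connected: "induces_connected E V"
begin

lemma finite_k_cuts_through: "finite {C. k_cut V E k C \<and> e \<in> boundary V E C}"
  by (rule finite_subset[OF _ finite_cuts_through_edge[of V E k e]]) (auto simp: k_cut_def cut_def)

lemma finite_k_cuts_separating:
  assumes "u \<in> V" "v \<in> V"
  shows "finite {C. k_cut V E k C \<and> u \<in> C \<and> v \<notin> C}"
proof -
  obtain Z where Z: "finite Z" "\<And>C. u \<in> C \<Longrightarrow> v \<notin> C \<Longrightarrow> boundary V E C \<inter> Z \<noteq> {}"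
    using path_edges[OF induces_connectedD[OF connected assms]] by metis
  have "{C. k_cut V E k C \<and> u \<in> C \<and> v \<notin> C} \<subseteq> (\<Union>e\<in>Z. {C. k_cut V E k C \<and> e \<in> boundary V E C})"
    using Z(2) by blast
  then show ?thesis using Z(1) finite_k_cuts_through by (auto intro: finite_subset)
qed

text \<open>If \<open>D\<close> crosses \<open>C\<close>, both sides of \<open>D\<close> meet a
  finite connected set \<open>F\<close> around the boundary of \<open>C\<close>: a connected set
  avoiding \<open>F\<close> contains no edge across \<open>C\<close>, so it lies on one side. Hence
  one of the finitely many edges inside \<open>F\<close> belongs to the boundary of
  \<open>D\<close>.\<close>

lemma finite_crossing:
  assumes C: "cut V E C"
  shows "finite {D. k_cut V E k D \<and> \<not> nested V C D}"
proof -
  let ?B = "\<Union> (boundary V E C)"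
  have CV: "C \<subseteq> V" and finC: "finite (boundary V E C)" using C by (auto simp: cut_def)
  have "finite ?B"
    using finC by (intro finite_Union) (auto simp: boundary_def)
  moreover have "?B \<subseteq> V" using CV by (auto simp: boundary_def)
  ultimately obtain F where F: "finite F" "?B \<subseteq> F" "F \<subseteq> V" "induces_connected E F"
    using finite_connected_hull[OF connected] by metis
  let ?Z = "{e \<in> E. e \<subseteq> F}"
  have "finite ?Z" by (rule finite_subset[of _ "Pow F"]) (use F in auto)
  have nest: "nested V C D" if D: "D \<subseteq> V" "induces_connected E D" "D \<inter> F = {}" for D
  proof (rule ccontr)
    assume "\<not> nested V C D"
    then obtain a b where ab: "a \<in> D" "a \<in> C" "b \<in> D" "b \<notin> C" using D(1) CV unfolding nested_def by blast
    then have "boundary D E C \<noteq> {}" using connected_boundary_nonempty[OF D(2)] by blast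
    then obtain x y where xy: "{x, y} \<in> E" "x \<in> C" "y \<in> D" "y \<notin> C" by (auto simp: boundary_iff)
    then have "{x, y} \<in> boundary V E C" using D(1) by (auto intro: boundaryI)
    then have "y \<in> F" using F(2) by auto
    with xy D(3) show False by auto
  qed
  have "{D. k_cut V E k D \<and> \<not> nested V C D} \<subseteq> (\<Union>e\<in>?Z. {D. k_cut V E k D \<and> e \<in> boundary V E D})"
  proof
    fix D assume "D \<in> {D. k_cut V E k D \<and> \<not> nested V C D}"
    then have D: "k_cut V E k D" "\<not> nested V C D" by auto
    then have D': "D \<subseteq> V" "induces_connected E D" "induces_connected E (V - D)"
      by (auto simp: k_cut_def cut_def)
    obtain a where "a \<in> D \<inter> F" using nest[OF D'(1,2)] D(2) by auto
    moreover obtain b where "b \<in> (V - D) \<inter> F"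
      using nest[OF _ D'(3)] D(2) nested_compl_right[OF D'(1)] by auto
    ultimately have "boundary F E (D \<inter> F) \<noteq> {}"
      using connected_boundary_nonempty[OF F(4), of a "D \<inter> F" b] by auto
    then obtain x y where xy: "{x, y} \<in> E" "x \<in> D" "x \<in> F" "y \<in> F" "y \<notin> D"
      by (auto simp: boundary_iff)
    then have "{x, y} \<in> boundary V E D" "{x, y} \<in> ?Z" using F(3) by (auto intro!: boundaryI)
    then show "D \<in> (\<Union>e\<in>?Z. {D. k_cut V E k D \<and> e \<in> boundary V E D})" using D by blast
  qed
  then show ?thesis using \<open>finite ?Z\<close> finite_k_cuts_through by (auto intro: finite_subset)
qed

lemma crossing_number_compl: "C \<subseteq> V \<Longrightarrow> crossing_number V E k (V - C) = crossing_number V E k C"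
  by (simp add: crossing_number_def nested_compl_left)

text \<open>The count parallels \<open>boundary_submodular\<close>: a cut crossing a corner crosses
  \<open>C\<close> or \<open>D\<close>, and one crossing both corners crosses both. Strictness comes
  from \<open>C\<close> itself, which crosses \<open>D\<close> but is nested with both
  corners.\<close>

lemma crossing_number_corners:
  assumes C: "k_cut V E k C" and D: "k_cut V E k D" and nn: "\<not> nested V C D"
    and corners: "cut V E (C \<inter> D)" "cut V E ((V - C) \<inter> (V - D))"
  shows "crossing_number V E k (C \<inter> D) + crossing_number V E k ((V - C) \<inter> (V - D))
    < crossing_number V E k C + crossing_number V E k D"
proof -
  define S where "S C = {F. k_cut V E k F \<and> \<not> nested V C F}" for C
  let ?A = "C \<inter> D" and ?B = "(V - C) \<inter> (V - D)"
  have sub: "C \<subseteq> V" "D \<subseteq> V" using C D by (auto simp: k_cut_def cut_def)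
  have FV: "k_cut V E k F \<Longrightarrow> F \<subseteq> V" for F by (auto simp: k_cut_def cut_def)
  have fin: "finite (S C)" "finite (S D)" "finite (S ?A)" "finite (S ?B)"
    unfolding S_def using C D corners unfolding k_cut_def[of V E k C] k_cut_def[of V E k D]
    by (simp_all add: finite_crossing)
  have un: "S ?A \<union> S ?B \<subseteq> S C \<union> S D"
    unfolding S_def using nested_both_corners[OF sub FV _ _ nn] by blast
  have "C \<notin> S ?A \<union> S ?B" by (auto simp: S_def nested_def)
  moreover have "C \<in> S D" unfolding S_def using C nn nested_sym[OF sub(2,1)] by auto
  ultimately have less: "S ?A \<union> S ?B \<subset> S C \<union> S D" using un by blast
  have int: "S ?A \<inter> S ?B \<subseteq> S C \<inter> S D"
  proof
    fix F assume F: "F \<in> S ?A \<inter> S ?B"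
    then have k: "k_cut V E k F" by (auto simp: S_def)
    then show "F \<in> S C \<inter> S D"
      using F nested_corners[OF sub FV[OF k]] nested_corners[OF sub(2,1) FV[OF k]]
      by (auto simp: S_def Int_commute)
  qed
  have "card (S ?A) + card (S ?B) = card (S ?A \<union> S ?B) + card (S ?A \<inter> S ?B)"
    using fin by (intro card_Un_Int)
  also have "\<dots> < card (S C \<union> S D) + card (S C \<inter> S D)"
    using psubset_card_mono[OF _ less] card_mono[OF _ int] fin by (simp add: add_less_le_mono)
  also have "\<dots> = card (S C) + card (S D)" using card_Un_Int fin by metis
  finally show ?thesis by (simp add: crossing_number_def S_def)
qed

text \<open>Corners are at first only known to separate a path, not to be connected; hence a version
  of \<open>cuts_of\<close> that does not ask for a cut. Minimality makes them cuts in
  \<open>min_cut_le\<close>.\<close>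

definition separates :: "(int \<Rightarrow> 'v) \<Rightarrow> 'v set \<Rightarrow> bool" where
  "separates \<alpha> W \<longleftrightarrow> infinite (range \<alpha> \<inter> W) \<and> infinite (range \<alpha> \<inter> (V - W))"

lemma cuts_of_iff: "C \<in> cuts_of V E \<alpha> \<longleftrightarrow> cut V E C \<and> separates \<alpha> C"
  by (auto simp: cuts_of_def separates_def)

lemma min_cuts_of_iff: "C \<in> min_cuts_of V E \<alpha> \<longleftrightarrow>
    C \<in> cuts_of V E \<alpha> \<and> (\<forall>D\<in>cuts_of V E \<alpha>. card (boundary V E C) \<le> card (boundary V E D))"
  by (auto simp: min_cuts_of_def is_arg_min_def not_less)

lemma opt_cuts_of_iff: "C \<in> opt_cuts_of V E k \<alpha> \<longleftrightarrow>
    C \<in> min_cuts_of V E \<alpha> \<and> (\<forall>D\<in>min_cuts_of V E \<alpha>. crossing_number V E k C \<le> crossing_number V E k D)"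
  by (auto simp: opt_cuts_of_def is_arg_min_def not_less)

lemma separates_compl: "W \<subseteq> V \<Longrightarrow> separates \<alpha> (V - W) \<longleftrightarrow> separates \<alpha> W"
  by (auto simp: separates_def double_diff)

lemma cuts_of_compl: "C \<in> cuts_of V E \<alpha> \<Longrightarrow> V - C \<in> cuts_of V E \<alpha>"
  by (auto simp: cuts_of_iff cut_compl separates_compl cut_def[of V E C])

lemma min_cuts_of_compl:
  assumes "C \<in> min_cuts_of V E \<alpha>" shows "V - C \<in> min_cuts_of V E \<alpha>"
proof -
  have "C \<subseteq> V" using assms by (auto simp: min_cuts_of_iff cuts_of_iff cut_def)
  with assms show ?thesis by (auto simp: min_cuts_of_iff cuts_of_compl boundary_compl)
qed

lemma opt_cuts_of_compl:
  assumes "C \<in> opt_cuts_of V E k \<alpha>" shows "V - C \<in> opt_cuts_of V E k \<alpha>"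
proof -
  have "C \<subseteq> V" using assms by (auto simp: opt_cuts_of_iff min_cuts_of_iff cuts_of_iff cut_def)
  with assms show ?thesis by (auto simp: opt_cuts_of_iff min_cuts_of_compl crossing_number_compl)
qed

text \<open>Any separating \<open>W\<close> yields a cut \<open>U\<close> whose boundary is part of
  that of \<open>W\<close>, and \<open>U\<close> competes with \<open>C\<close>. If the sizes agree,
  the two boundaries coincide, so \<open>W\<close> is \<open>U\<close> or its complement and hence
  connected on both sides.\<close>

lemma min_cut_le:
  assumes C: "C \<in> min_cuts_of V E \<alpha>" and \<alpha>: "biinfinite_path V E \<alpha>"
    and W: "W \<subseteq> V" "finite (boundary V E W)" "separates \<alpha> W"
  shows "card (boundary V E C) \<le> card (boundary V E W)"
    and "card (boundary V E W) \<le> card (boundary V E C) \<Longrightarrow> W \<in> min_cuts_of V E \<alpha>"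
proof -
  obtain U where U: "cut V E U" "infinite (range \<alpha> \<inter> U)" "infinite (range \<alpha> \<inter> (V - U))"
    "boundary V E U \<subseteq> boundary V E W"
    using separating_cut[OF connected W(1,2)] W(3) unfolding separates_def by metis
  then have UC: "U \<in> cuts_of V E \<alpha>" by (auto simp: cuts_of_iff separates_def)
  have le: "card (boundary V E U) \<le> card (boundary V E W)" using U W card_mono by blast
  moreover have CU: "card (boundary V E C) \<le> card (boundary V E U)" using C UC by (auto simp: min_cuts_of_iff)
  ultimately show "card (boundary V E C) \<le> card (boundary V E W)" by simp
  assume "card (boundary V E W) \<le> card (boundary V E C)"
  then have eq: "boundary V E U = boundary V E W" using CU U(4) W(2) by (intro card_seteq) auto
  have "U \<subseteq> V" using U by (auto simp: cut_def)
  then have "W = U \<or> W = V - U" using boundary_determines[OF connected eq] W by auto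
  then have "cut V E W" using U(1) cut_compl by auto
  then have "W \<in> cuts_of V E \<alpha>" using W by (auto simp: cuts_of_iff)
  then show "W \<in> min_cuts_of V E \<alpha>"
    using C \<open>card (boundary V E W) \<le> card (boundary V E C)\<close> by (auto simp: min_cuts_of_iff)
qed

end

locale accessible_graph = connected_graph V E k
  for V :: "'v set" and E :: "'v set set" and k :: nat +
  assumes accessible: "accessible_with V E k"
begin

text \<open>Accessibility enters here: a minimal cut is no larger than the \<open>k\<close>-cut it
  provides, so one bound serves all paths.\<close>

lemma min_cut_k_cut:
  assumes "C \<in> min_cuts_of V E \<alpha>" "biinfinite_path V E \<alpha>"
  shows "k_cut V E k C"
proof -
  have C: "C \<in> cuts_of V E \<alpha>" using assms by (auto simp: min_cuts_of_iff)
  then obtain D where D: "D \<in> cuts_of V E \<alpha>" "k_cut V E k D"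
    using accessible assms(2) unfolding accessible_with_def by fastforce
  then have "card (boundary V E C) \<le> card (boundary V E D)" using assms(1) by (auto simp: min_cuts_of_iff)
  with C D(2) show ?thesis by (auto simp: k_cut_def cuts_of_iff)
qed

lemma opt_cut_k_cut: "C \<in> opt_cuts V E k \<Longrightarrow> k_cut V E k C"
  by (auto simp: opt_cuts_def opt_cuts_of_iff intro: min_cut_k_cut)

lemma opt_cut_cut: "C \<in> opt_cuts V E k \<Longrightarrow> cut V E C"
  using opt_cut_k_cut by (auto simp: k_cut_def)

lemma opt_cuts_compl: "C \<in> opt_cuts V E k \<Longrightarrow> V - C \<in> opt_cuts V E k"
  by (auto simp: opt_cuts_def opt_cuts_of_compl)

lemma opt_cut_exists:
  assumes "cuts_of V E \<alpha> \<noteq> {}" shows "opt_cuts_of V E k \<alpha> \<noteq> {}"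
proof -
  obtain C where "C \<in> cuts_of V E \<alpha>" using assms by auto
  from is_arg_min_arg_min_nat[of "\<lambda>C. C \<in> cuts_of V E \<alpha>", OF this]
  have "arg_min (\<lambda>D. card (boundary V E D)) (\<lambda>D. D \<in> cuts_of V E \<alpha>) \<in> min_cuts_of V E \<alpha>"
    by (simp add: min_cuts_of_def)
  from is_arg_min_arg_min_nat[of "\<lambda>C. C \<in> min_cuts_of V E \<alpha>", OF this]
  show ?thesis by (auto simp: opt_cuts_of_def)
qed

text \<open>Each corner is charged to the path it separates, giving lower bounds that add up to the
  upper bound of \<open>boundary_submodular\<close>. Equality makes both corners minimal, and then
  optimality contradicts \<open>crossing_number_corners\<close>.\<close>

lemma opposite_corners:
  assumes \<alpha>: "biinfinite_path V E \<alpha>" "C \<in> opt_cuts_of V E k \<alpha>"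
    and \<beta>: "biinfinite_path V E \<beta>" "D \<in> opt_cuts_of V E k \<beta>"
    and sep: "separates \<alpha> (C \<inter> D)" "separates \<beta> ((V - C) \<inter> (V - D))"
  shows "nested V C D"
proof (rule ccontr)
  assume nn: "\<not> nested V C D"
  have C: "C \<in> min_cuts_of V E \<alpha>" and D: "D \<in> min_cuts_of V E \<beta>" using \<alpha> \<beta> by (auto simp: opt_cuts_of_iff)
  have kC: "k_cut V E k C" "k_cut V E k D" using C D \<alpha> \<beta> min_cut_k_cut by auto
  then have sub: "C \<subseteq> V" "D \<subseteq> V" and fin: "finite (boundary V E C)" "finite (boundary V E D)"
    by (auto simp: k_cut_def cut_def)
  let ?A = "C \<inter> D" and ?B = "(V - C) \<inter> (V - D)"
  note sm = boundary_submodular[OF sub fin]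
  have AV: "?A \<subseteq> V" "?B \<subseteq> V" using sub by auto
  note lA = min_cut_le[OF C \<alpha>(1) AV(1) sm(2) sep(1)]
  note lB = min_cut_le[OF D \<beta>(1) AV(2) sm(3) sep(2)]
  have A: "?A \<in> min_cuts_of V E \<alpha>" using lA lB(1) sm(1) by simp
  have B: "?B \<in> min_cuts_of V E \<beta>" using lB lA(1) sm(1) by simp
  have "crossing_number V E k ?A + crossing_number V E k ?B < crossing_number V E k C + crossing_number V E k D"
    by (rule crossing_number_corners[OF kC nn]) (use A B in \<open>auto simp: min_cuts_of_iff cuts_of_iff\<close>)
  moreover have "crossing_number V E k C \<le> crossing_number V E k ?A"
    using \<alpha>(2) A by (auto simp: opt_cuts_of_iff)
  moreover have "crossing_number V E k D \<le> crossing_number V E k ?B"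
    using \<beta>(2) B by (auto simp: opt_cuts_of_iff)
  ultimately show False by simp
qed

text \<open>Both corners on one diagonal are charged to \<alpha>, both on the other to \<beta>. For
  the boundary sizes c of \<open>C\<close> and d of \<open>D\<close> the submodular bounds give 2c
  \<le> c + d and 2d \<le> c + d, so c = d and all four corners are minimal. The crossing numbers
  then satisfy both inequalities strictly, which is impossible.\<close>

lemma crossing_diagonals:
  assumes \<alpha>: "biinfinite_path V E \<alpha>" "C \<in> opt_cuts_of V E k \<alpha>"
    and \<beta>: "biinfinite_path V E \<beta>" "D \<in> opt_cuts_of V E k \<beta>"
    and sep\<alpha>: "separates \<alpha> (C \<inter> D)" "separates \<alpha> ((V - C) \<inter> (V - D))"
    and sep\<beta>: "separates \<beta> (C \<inter> (V - D))" "separates \<beta> ((V - C) \<inter> D)"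
  shows "nested V C D"
proof (rule ccontr)
  assume nn: "\<not> nested V C D"
  have C: "C \<in> min_cuts_of V E \<alpha>" and D: "D \<in> min_cuts_of V E \<beta>" using \<alpha> \<beta> by (auto simp: opt_cuts_of_iff)
  have kC: "k_cut V E k C" "k_cut V E k D" using C D \<alpha> \<beta> min_cut_k_cut by auto
  then have sub: "C \<subseteq> V" "D \<subseteq> V" "V - D \<subseteq> V" and fin: "finite (boundary V E C)" "finite (boundary V E D)"
    by (auto simp: k_cut_def cut_def)
  have finD: "finite (boundary V E (V - D))" using fin boundary_compl[OF sub(2)] by simp
  have DD: "V - (V - D) = D" using sub by auto
  let ?A = "C \<inter> D" and ?B = "(V - C) \<inter> (V - D)" and ?A' = "C \<inter> (V - D)" and ?B' = "(V - C) \<inter> D"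
  note sm = boundary_submodular[OF sub(1,2) fin]
  note sm' = boundary_submodular[OF sub(1,3) fin(1) finD, unfolded DD boundary_compl[OF sub(2)]]
  have AV: "?A \<subseteq> V" "?B \<subseteq> V" "?A' \<subseteq> V" "?B' \<subseteq> V" using sub by auto
  note lA = min_cut_le[OF C \<alpha>(1) AV(1) sm(2) sep\<alpha>(1)]
  note lB = min_cut_le[OF C \<alpha>(1) AV(2) sm(3) sep\<alpha>(2)]
  note lA' = min_cut_le[OF D \<beta>(1) AV(3) sm'(2) sep\<beta>(1)]
  note lB' = min_cut_le[OF D \<beta>(1) AV(4) sm'(3) sep\<beta>(2)]
  have A: "?A \<in> min_cuts_of V E \<alpha>" "?B \<in> min_cuts_of V E \<alpha>"
    using lA lB lA'(1) lB'(1) sm(1) sm'(1) by simp_all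
  have B: "?A' \<in> min_cuts_of V E \<beta>" "?B' \<in> min_cuts_of V E \<beta>"
    using lA(1) lB(1) lA' lB' sm(1) sm'(1) by simp_all
  have "crossing_number V E k ?A + crossing_number V E k ?B < crossing_number V E k C + crossing_number V E k D"
    by (rule crossing_number_corners[OF kC nn]) (use A in \<open>auto simp: min_cuts_of_iff cuts_of_iff\<close>)
  moreover have "crossing_number V E k ?A' + crossing_number V E k ?B'
      < crossing_number V E k C + crossing_number V E k D"
    using crossing_number_corners[OF kC(1) k_cut_compl[OF kC(2)]] nn B
    by (auto simp: min_cuts_of_iff cuts_of_iff DD nested_compl_right[OF sub(2)] crossing_number_compl[OF sub(2)])
  moreover have "crossing_number V E k C \<le> crossing_number V E k ?A" "crossing_number V E k C \<le> crossing_number V E k ?B"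
    using \<alpha>(2) A by (auto simp: opt_cuts_of_iff)
  moreover have "crossing_number V E k D \<le> crossing_number V E k ?A'" "crossing_number V E k D \<le> crossing_number V E k ?B'"
    using \<beta>(2) B by (auto simp: opt_cuts_of_iff)
  ultimately show False by simp
qed

lemma opt_cuts_nested:
  assumes "C \<in> opt_cuts V E k" "D \<in> opt_cuts V E k"
  shows "nested V C D"
proof -
  obtain \<alpha> \<beta> where \<alpha>: "biinfinite_path V E \<alpha>" "C \<in> opt_cuts_of V E k \<alpha>"
    and \<beta>: "biinfinite_path V E \<beta>" "D \<in> opt_cuts_of V E k \<beta>"
    using assms by (auto simp: opt_cuts_def)
  have sub: "C \<subseteq> V" "D \<subseteq> V" using opt_cut_cut[OF assms(1)] opt_cut_cut[OF assms(2)] by (simp_all add: cut_def)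
  note C' = opt_cuts_of_compl[OF \<alpha>(2)] and D' = opt_cuts_of_compl[OF \<beta>(2)]
  have VV: "V - (V - C) = C" "V - (V - D) = D" using sub by auto
  note nc = nested_compl_left[OF sub(1)] nested_compl_right[OF sub(2)]
  let ?i = "\<lambda>\<gamma> A B. infinite (range \<gamma> \<inter> (A \<inter> B))"
  have inf: "infinite (range \<alpha> \<inter> C)" "infinite (range \<alpha> \<inter> (V - C))"
    "infinite (range \<beta> \<inter> D)" "infinite (range \<beta> \<inter> (V - D))"
    using \<alpha> \<beta> by (auto simp: opt_cuts_of_iff min_cuts_of_iff cuts_of_def)
  \<comment> \<open>A corner inside a side \<open>A\<close> of \<open>C\<close> leaves infinitely
    much of \<alpha> outside, on the other side of \<open>C\<close>. For \<beta> the sides of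
    \<open>D\<close> play this part.\<close>
  have sep\<alpha>: "separates \<alpha> (A \<inter> B)" if "?i \<alpha> A B" "A \<in> {C, V - C}" for A B
  proof -
    have "infinite (range \<alpha> \<inter> (V - A))" using that(2) inf VV by auto
    moreover have "range \<alpha> \<inter> (V - A) \<subseteq> range \<alpha> \<inter> (V - A \<inter> B)" by auto
    ultimately show ?thesis unfolding separates_def using that(1) infinite_super by blast
  qed
  have sep\<beta>: "separates \<beta> (A \<inter> B)" if "?i \<beta> A B" "B \<in> {D, V - D}" for A B
  proof -
    have "infinite (range \<beta> \<inter> (V - B))" using that(2) inf VV by auto
    moreover have "range \<beta> \<inter> (V - B) \<subseteq> range \<beta> \<inter> (V - A \<inter> B)" by auto
    ultimately show ?thesis unfolding separates_def using that(1) infinite_super by blast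
  qed
  have opp: "nested V C D"
    if "?i \<alpha> A B" "?i \<beta> (V - A) (V - B)" "A \<in> {C, V - C}" "B \<in> {D, V - D}" for A B
  proof -
    have "nested V A B"
      by (rule opposite_corners[OF \<alpha>(1) _ \<beta>(1)]) (use that \<alpha>(2) \<beta>(2) C' D' sep\<alpha> sep\<beta> VV in auto)
    then show ?thesis using that(3,4) nc nested_compl_right[OF sub(2), of "V - C"] by auto
  qed
  have diag: "nested V C D"
    if "?i \<alpha> C B" "?i \<alpha> (V - C) (V - B)" "?i \<beta> C (V - B)" "?i \<beta> (V - C) B" "B \<in> {D, V - D}" for B
  proof -
    have "nested V C B"
      by (rule crossing_diagonals[OF \<alpha> \<beta>(1)]) (use that \<beta>(2) D' sep\<alpha> sep\<beta> VV in auto)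
    then show ?thesis using that(5) nc by auto
  qed
  have split: "?i \<gamma> A D \<or> ?i \<gamma> A (V - D)" if "infinite (range \<gamma> \<inter> A)" "A \<subseteq> V" for \<gamma> A
  proof -
    have "range \<gamma> \<inter> A = range \<gamma> \<inter> (A \<inter> D) \<union> range \<gamma> \<inter> (A \<inter> (V - D))" using that by auto
    with that show ?thesis by (metis finite_Un)
  qed
  have split': "?i \<gamma> C B \<or> ?i \<gamma> (V - C) B" if "infinite (range \<gamma> \<inter> B)" "B \<subseteq> V" for \<gamma> B
  proof -
    have "range \<gamma> \<inter> B = range \<gamma> \<inter> (C \<inter> B) \<union> range \<gamma> \<inter> ((V - C) \<inter> B)" using that by auto
    with that show ?thesis by (metis finite_Un)
  qed
  \<comment> \<open>\<alpha> reaches into a corner on each side of \<open>C\<close>, \<beta> into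
    one on each side of \<open>D\<close>. If \<alpha> occupies \<open>A \<inter> B\<close> and no
    opposite corners apply, \<beta> must occupy \<open>A \<inter> (V - B)\<close>; this pushes
    \<alpha> into \<open>(V - A) \<inter> (V - B)\<close> and then \<beta> into
    \<open>(V - A) \<inter> B\<close>, the diagonal pattern.\<close>
  have "?i \<alpha> C D \<or> ?i \<alpha> C (V - D)" "?i \<alpha> (V - C) D \<or> ?i \<alpha> (V - C) (V - D)"
    "?i \<beta> C D \<or> ?i \<beta> (V - C) D" "?i \<beta> C (V - D) \<or> ?i \<beta> (V - C) (V - D)"
    using split split' sub inf by auto
  then show ?thesis
    using opp[of C D] opp[of C "V - D"] opp[of "V - C" D] opp[of "V - C" "V - D"]
      diag[of D] diag[of "V - D"] unfolding VV by blast
qed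

end

section \<open>The structure tree is a tree\<close>

context accessible_graph
begin

abbreviation "opts \<equiv> opt_cuts V E k"

lemma opt_cut_props:
  assumes "C \<in> opts" shows "C \<subseteq> V" "C \<noteq> {}" "V - C \<noteq> {}" "V - (V - C) = C"
  using opt_cut_cut[OF assms] by (auto simp: cut_def)

section \<open>The covering order on optimal cuts\<close>

lemma finite_opt_cuts_between:
  assumes "C \<in> opts" "D \<in> opts" shows "finite {F \<in> opts. C \<subseteq> F \<and> F \<subseteq> D}"
proof -
  obtain u where "u \<in> C" using opt_cut_props(2)[OF assms(1)] by auto
  moreover obtain v where "v \<in> V - D" using opt_cut_props(3)[OF assms(2)] by auto
  moreover have "u \<in> V" using \<open>u \<in> C\<close> opt_cut_props(1)[OF assms(1)] by auto
  ultimately show ?thesis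
    by (intro finite_subset[OF _ finite_k_cuts_separating[of u v]]) (auto intro: opt_cut_k_cut)
qed

text \<open>The covering relation of the optimal cuts ordered by inclusion. In these terms two
  distinct optimal cuts \<open>C\<close> and \<open>D\<close> lie in the same tree vertex when
  \<open>D\<close> covers \<open>V - C\<close>.\<close>

definition covers :: "'v set \<Rightarrow> 'v set \<Rightarrow> bool" where
  "covers C D \<longleftrightarrow> C \<subset> D \<and> (\<forall>F\<in>opts. C \<subset> F \<and> F \<subseteq> D \<longrightarrow> D = F)"

lemma opt_equiv_iff:
  "(C, D) \<in> opt_equiv V E k \<longleftrightarrow> C \<in> opts \<and> D \<in> opts \<and> (C = D \<or> covers (V - C) D)"
  by (auto simp: opt_equiv_def covers_def)

text \<open>Complementation reverses the inclusion order; this makes \<open>opt_equiv\<close>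
  symmetric.\<close>

lemma covers_compl:
  assumes "C \<in> opts" "D \<in> opts" "covers C D" shows "covers (V - D) (V - C)"
  unfolding covers_def
proof (intro conjI ballI impI)
  have CD: "C \<subset> D" "\<And>F. F \<in> opts \<Longrightarrow> C \<subset> F \<Longrightarrow> F \<subseteq> D \<Longrightarrow> D = F"
    using assms(3) unfolding covers_def by auto
  note C = opt_cut_props(1)[OF assms(1)] and D = opt_cut_props(1)[OF assms(2)]
  show "V - D \<subset> V - C" using CD(1) C D by auto
  fix F assume F: "F \<in> opts" "V - D \<subset> F \<and> F \<subseteq> V - C"
  note F' = opt_cut_props(1)[OF F(1)]
  have "C \<subseteq> V - F" "V - F \<subset> D" using F(2) C D F' by auto
  then have "C = V - F" using CD(2)[OF opt_cuts_compl[OF F(1)]] by auto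
  then show "V - C = F" using F' by auto
qed

text \<open>Only finitely many optimal cuts lie between \<open>C\<close> and \<open>D\<close>, so
  there is a minimal one strictly above \<open>C\<close>.\<close>

lemma covering_above:
  assumes "C \<in> opts" "D \<in> opts" "C \<subset> D"
  obtains F where "F \<in> opts" "covers C F" "F \<subseteq> D"
proof -
  define S where "S = {F \<in> opts. C \<subset> F \<and> F \<subseteq> D}"
  have "finite S" unfolding S_def
    by (rule finite_subset[OF _ finite_opt_cuts_between[OF assms(1,2)]]) auto
  moreover have "D \<in> S" using assms by (auto simp: S_def)
  ultimately obtain F where F: "F \<in> S" "\<forall>F'\<in>S. F' \<subseteq> F \<longrightarrow> F = F'"
    using finite_has_minimal2[of S D] by blast
  then have "covers C F" unfolding covers_def S_def by auto
  with F show thesis by (intro that[of F]) (auto simp: S_def)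
qed

lemma covering_below:
  assumes "C \<in> opts" "D \<in> opts" "C \<subset> D"
  obtains F where "F \<in> opts" "covers F D" "C \<subseteq> F"
proof -
  have "V - D \<subset> V - C"
    using assms(3) opt_cut_props(1)[OF assms(1)] opt_cut_props(1)[OF assms(2)] by auto
  then obtain F where F: "F \<in> opts" "covers (V - D) F" "F \<subseteq> V - C"
    using covering_above[OF opt_cuts_compl opt_cuts_compl] assms by metis
  from covers_compl[OF opt_cuts_compl[OF assms(2)] F(1,2)] have "covers (V - F) D"
    using opt_cut_props[OF assms(2)] by simp
  moreover have "C \<subseteq> V - F" using F(3) opt_cut_props(1)[OF assms(1)] by auto
  ultimately show thesis using that opt_cuts_compl[OF F(1)] by blast
qed

text \<open>Transitivity of \<open>opt_equiv\<close>, split by nestedness of \<open>C\<close> and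
  \<open>F\<close>: an inclusion between the two collapses to equality by covering, \<open>C\<close>
  inside \<open>V - F\<close> would make \<open>V - D\<close> empty, and
  \<open>V - C \<subseteq> F\<close> is the substantial case.\<close>

lemma covers_compl_trans:
  assumes O: "C \<in> opts" "D \<in> opts" "F \<in> opts" and CD: "covers (V - C) D" and DF: "covers (V - D) F"
  shows "C = F \<or> covers (V - C) F"
proof -
  note p = opt_cut_props(1,2)[OF O(1)] opt_cut_props(1,2)[OF O(2)] opt_cut_props(1,2)[OF O(3)]
    opt_cut_props(3)[OF O(1)] opt_cut_props(3)[OF O(2)] opt_cut_props(3)[OF O(3)]
  have n: "nested V C F" using opt_cuts_nested O by simp
  have CD': "V - C \<subset> D" "\<And>H. H \<in> opts \<Longrightarrow> V - C \<subset> H \<Longrightarrow> H \<subseteq> D \<Longrightarrow> D = H"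
    using CD by (auto simp: covers_def)
  have DF': "V - D \<subset> F" "\<And>H. H \<in> opts \<Longrightarrow> V - D \<subset> H \<Longrightarrow> H \<subseteq> F \<Longrightarrow> F = H"
    using DF by (auto simp: covers_def)
  have DC: "V - D \<subset> C" using CD'(1) p(1,3) by auto
  consider "C \<subseteq> F" | "F \<subseteq> C" | "C \<subseteq> V - F" | "V - C \<subseteq> F"
    using n p(1,5) unfolding nested_def by blast
  then show ?thesis
  proof cases
    case 1
    then have "F = C" using DF'(2)[OF O(1)] DC by blast
    then show ?thesis by simp
  next
    case 2
    have "covers (V - D) C"
      using covers_compl[OF opt_cuts_compl[OF O(1)] O(2) CD] opt_cut_props(4)[OF O(1)] by simp
    then show ?thesis using 2 DF'(1) O(3) unfolding covers_def by blast
  next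
    case 3
    then have "V - D \<subseteq> F \<inter> (V - F)" using DC DF'(1) by auto
    then show ?thesis using p(8) by auto
  next
    case 4
    have ne: "V - C \<noteq> F"
    proof
      assume "V - C = F"
      then have "V - D \<subseteq> C \<inter> (V - C)" using DC DF'(1) by auto
      then show False using p(8) by auto
    qed
    \<comment> \<open>A competitor \<open>H\<close> is compared with \<open>D\<close>: an inclusion
      between \<open>H\<close> and \<open>D\<close> would force \<open>F = V\<close>,
      \<open>H\<close> inside \<open>V - D\<close> would make \<open>V - C\<close> empty, and for
      \<open>V - D \<subseteq> H\<close> the covering of \<open>V - D\<close> by \<open>F\<close>
      decides.\<close>
    have "F = H" if H: "H \<in> opts" "V - C \<subset> H" "H \<subseteq> F" for H
    proof -
      note ph = opt_cut_props(1)[OF H(1)]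
      have "nested V H D" using opt_cuts_nested H O by simp
      then consider "H \<subseteq> D" | "D \<subseteq> H" | "V - D \<subseteq> H" | "H \<subseteq> V - D"
        using p(3) ph unfolding nested_def by blast
      then show ?thesis
      proof cases
        case 1
        then have "D = H" using CD'(2)[OF H(1,2)] by simp
        then have "F = V" using H(3) DF'(1) p(5) by auto
        then show ?thesis using p(9) by simp
      next
        case 2
        then have "F = V" using H(3) DF'(1) p(5) by auto
        then show ?thesis using p(9) by simp
      next
        case 3
        show ?thesis
        proof (cases "V - D = H")
          case True
          then have "V - C \<subseteq> D \<inter> (V - D)" using H(2) CD'(1) by auto
          then show ?thesis using p(7) by auto
        next
          case False
          then show ?thesis using DF'(2)[OF H(1)] 3 H(3) by blast
        qed
      next
        case 4
        then have "V - C \<subseteq> D \<inter> (V - D)" using H(2) CD'(1) by auto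
        then show ?thesis using p(7) by auto
      qed
    qed
    then show ?thesis using 4 ne unfolding covers_def by blast
  qed
qed

lemma equiv_opt_equiv: "equiv opts (opt_equiv V E k)"
proof (intro equivI symI transI)
  show "opt_equiv V E k \<subseteq> opts \<times> opts" by (auto simp: opt_equiv_iff)
  show "refl_on opts (opt_equiv V E k)" by (auto simp: refl_on_def opt_equiv_iff)
  fix C D assume CD: "(C, D) \<in> opt_equiv V E k"
  then have "C = D \<or> covers (V - D) C"
    using covers_compl[OF opt_cuts_compl, of C D] opt_cut_props(4)[of C] by (auto simp: opt_equiv_iff)
  then show "(D, C) \<in> opt_equiv V E k" using CD by (auto simp: opt_equiv_iff)
next
  fix C D F assume "(C, D) \<in> opt_equiv V E k" "(D, F) \<in> opt_equiv V E k"
  then show "(C, F) \<in> opt_equiv V E k"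
    using covers_compl_trans[of C D F] by (auto simp: opt_equiv_iff)
qed

abbreviation "opt_class C \<equiv> opt_equiv V E k `` {C}"

lemma opt_class_eq: "C \<in> opts \<Longrightarrow> D \<in> opts \<Longrightarrow> opt_class C = opt_class D \<longleftrightarrow> (C, D) \<in> opt_equiv V E k"
  using eq_equiv_class_iff[OF equiv_opt_equiv] by simp

section \<open>The structure tree as a bidirected graph\<close>

abbreviation "T \<equiv> structure_tree V E k"
abbreviation "trev \<equiv> structure_tree_rev V E k"

lemma T_simps:
  "verts T = opts // opt_equiv V E k"
  "arcs T = {(C, V - C) | C. C \<in> opts}"
  "tail T e = opt_class (fst e)"
  "head T e = opt_class (snd e)"
  by (auto simp: structure_tree_def split: prod.splits)

lemma trev_simp: "e \<in> arcs T \<Longrightarrow> trev e = (snd e, fst e)"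
  by (cases e) (auto simp: structure_tree_rev_def)

lemma arc_rev: "e \<in> arcs T \<Longrightarrow> (snd e, fst e) \<in> arcs T"
proof -
  assume "e \<in> arcs T"
  then obtain C where C: "e = (C, V - C)" "C \<in> opts" by (auto simp: T_simps)
  then have "(V - C, V - (V - C)) \<in> arcs T" using opt_cuts_compl unfolding T_simps by blast
  then show ?thesis using C opt_cut_props(4) by simp
qed

lemma bidirected: "bidirected_digraph T trev"
proof
  fix a assume a: "a \<in> arcs T"
  then obtain C where C: "a = (C, V - C)" "C \<in> opts" by (auto simp: T_simps)
  then show "tail T a \<in> verts T" "head T a \<in> verts T"
    by (auto simp: T_simps opt_cuts_compl quotientI)
  show "trev (trev a) = a" using trev_simp[OF a] trev_simp[OF arc_rev[OF a]] by simp
  show "tail T (trev a) = head T a" using trev_simp[OF a] by (simp add: T_simps)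
next
  fix a
  show "a \<in> arcs T \<longleftrightarrow> trev a \<noteq> a"
  proof
    assume a: "a \<in> arcs T"
    then obtain C where C: "a = (C, V - C)" "C \<in> opts" by (auto simp: T_simps)
    then show "trev a \<noteq> a" using trev_simp[OF a] opt_cut_props[OF C(2)] by auto
  next
    assume "trev a \<noteq> a"
    then show "a \<in> arcs T" by (cases a) (auto simp: structure_tree_rev_def split: if_splits)
  qed
qed

lemma arc_reachable: "C \<in> opts \<Longrightarrow> opt_class C \<rightarrow>\<^sup>*\<^bsub>T\<^esub> opt_class (V - C)"
proof -
  assume C: "C \<in> opts"
  interpret bidirected_digraph T trev by (rule bidirected)
  have "(C, V - C) \<in> arcs T" using C by (auto simp: T_simps)
  then have "opt_class C \<rightarrow>\<^bsub>T\<^esub> opt_class (V - C)"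
    unfolding arcs_ends_def arc_to_ends_def by (force simp: T_simps)
  then show ?thesis by auto
qed

text \<open>If \<open>F\<close> covers \<open>C\<close>, then \<open>V - C\<close> and
  \<open>F\<close> are equivalent, so the arc of \<open>C\<close> leads from the vertex of
  \<open>C\<close> to that of \<open>F\<close>. Fewer optimal cuts lie between \<open>F\<close> and
  \<open>D\<close>, which drives the induction.\<close>

lemma subset_reachable:
  assumes "C \<in> opts" "D \<in> opts" "C \<subseteq> D"
  shows "opt_class C \<rightarrow>\<^sup>*\<^bsub>T\<^esub> opt_class D"
  using assms
proof (induction "card {F \<in> opts. C \<subseteq> F \<and> F \<subseteq> D}" arbitrary: C rule: less_induct)
  case less
  interpret bidirected_digraph T trev by (rule bidirected)
  show ?case
  proof (cases "C = D")
    case True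
    then show ?thesis using less by (auto simp: T_simps quotientI)
  next
    case False
    then obtain F where F: "F \<in> opts" "covers C F" "F \<subseteq> D"
      using covering_above[of C D] less by (metis psubsetI)
    have "{H \<in> opts. F \<subseteq> H \<and> H \<subseteq> D} \<subset> {H \<in> opts. C \<subseteq> H \<and> H \<subseteq> D}"
      using F less unfolding covers_def by blast
    then have "card {H \<in> opts. F \<subseteq> H \<and> H \<subseteq> D} < card {H \<in> opts. C \<subseteq> H \<and> H \<subseteq> D}"
      using finite_opt_cuts_between less by (intro psubset_card_mono) auto
    then have "opt_class F \<rightarrow>\<^sup>*\<^bsub>T\<^esub> opt_class D" using less F by auto
    moreover have "opt_class (V - C) = opt_class F"
      using opt_class_eq[OF opt_cuts_compl[OF less(2)] F(1)] opt_cuts_compl[OF less(2)] F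
        opt_cut_props(4)[OF less(2)] by (auto simp: opt_equiv_iff)
    ultimately show ?thesis using arc_reachable[OF less(2)] by (metis reachable_trans)
  qed
qed

lemma T_connected:
  assumes "C \<in> opts" "D \<in> opts"
  shows "opt_class C \<rightarrow>\<^sup>*\<^bsub>T\<^esub> opt_class D"
proof -
  interpret bidirected_digraph T trev by (rule bidirected)
  note C = assms(1) opt_cuts_compl[OF assms(1)] and D = assms(2) opt_cuts_compl[OF assms(2)]
  note r = arc_reachable[OF C(1)] arc_reachable[OF C(2), unfolded opt_cut_props(4)[OF assms(1)]]
    arc_reachable[OF D(1)] arc_reachable[OF D(2), unfolded opt_cut_props(4)[OF assms(2)]]
  consider "C \<subseteq> D" | "C \<subseteq> V - D" | "V - C \<subseteq> D" | "V - C \<subseteq> V - D"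
    using opt_cuts_nested[OF assms] unfolding nested_def by blast
  then show ?thesis
  proof cases
    case 1 then show ?thesis using subset_reachable assms by simp
  next
    case 2 then show ?thesis using subset_reachable[OF C(1) D(2)] r by (metis reachable_trans)
  next
    case 3 then show ?thesis using subset_reachable[OF C(2) D(1)] r by (metis reachable_trans)
  next
    case 4 then show ?thesis using subset_reachable[OF C(2) D(2)] r by (metis reachable_trans)
  qed
qed

text \<open>Consecutive arcs \<open>(C, V - C)\<close> and \<open>(D, V - D)\<close> meet when
  \<open>V - C\<close> and \<open>D\<close> are equivalent. Without backtracking these two differ,
  so \<open>D\<close> covers \<open>C\<close> and the first components grow strictly along the
  walk.\<close>

lemma reduced_walk_increasing:
  assumes "C \<in> opts" "p \<noteq> []" "set p \<subseteq> arcs T" "pre_digraph.cas T (opt_class (V - C)) p u"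
    "\<forall>e\<in>set ((C, V - C) # p). trev e \<notin> set ((C, V - C) # p)"
  shows "C \<subset> fst (last p)"
  using assms
proof (induction p arbitrary: C)
  case Nil
  then show ?case by simp
next
  case (Cons e p)
  obtain D where D: "e = (D, V - D)" "D \<in> opts" using Cons.prems by (auto simp: T_simps)
  have "opt_class (V - C) = opt_class D"
    using Cons.prems D by (auto simp: pre_digraph.cas.simps T_simps)
  then have "(V - C, D) \<in> opt_equiv V E k"
    using opt_class_eq[OF opt_cuts_compl[OF Cons.prems(1)] D(2)] by simp
  moreover have "V - C \<noteq> D"
  proof
    assume "V - C = D"
    then have "trev (C, V - C) = e"
      using D Cons.prems(1) opt_cut_props(4)[OF Cons.prems(1)] trev_simp[of "(C, V - C)"] by (auto simp: T_simps)
    then show False using Cons.prems(5) by auto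
  qed
  ultimately have less: "C \<subset> D"
    using opt_cut_props(4)[OF Cons.prems(1)] by (auto simp: opt_equiv_iff covers_def)
  show ?case
  proof (cases "p = []")
    case True
    then show ?thesis using less D by simp
  next
    case False
    have "D \<subset> fst (last p)"
      by (rule Cons.IH[OF D(2) False]) (use Cons.prems D in \<open>auto simp: pre_digraph.cas.simps T_simps\<close>)
    then show ?thesis using less False by auto
  qed
qed

theorem structure_tree_is_tree: "bidirected_tree T trev"
  unfolding bidirected_tree_def
proof (intro conjI ballI notI)
  show "bidirected_digraph T trev" by (rule bidirected)
  show "u \<rightarrow>\<^sup>*\<^bsub>T\<^esub> v" if "u \<in> verts T" "v \<in> verts T" for u v
    using that T_connected by (auto simp: T_simps elim!: quotientE)
next
  assume "\<exists>p. pre_digraph.cycle T p \<and> (\<forall>e\<in>set p. trev e \<notin> set p)"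
  then obtain p u where p: "pre_digraph.awalk T u p u" "p \<noteq> []" "\<forall>e\<in>set p. trev e \<notin> set p"
    by (auto simp: pre_digraph.cycle_def)
  then obtain e q where q: "p = e # q" by (cases p) auto
  have arcs: "set p \<subseteq> arcs T" and cas: "pre_digraph.cas T u p u" using p by (auto simp: pre_digraph.awalk_def)
  obtain C where C: "e = (C, V - C)" "C \<in> opts" using arcs q by (auto simp: T_simps)
  have u: "u = opt_class C" and cas': "pre_digraph.cas T (opt_class (V - C)) q (opt_class C)"
    using cas q C by (auto simp: pre_digraph.cas.simps T_simps)
  \<comment> \<open>The first arc is repeated at the end of the cycle, so that growth along the walk
    yields \<open>C \<subset> C\<close>.\<close>
  have "pre_digraph.cas T w (q @ [e]) (opt_class (V - C))" if "pre_digraph.cas T w q (opt_class C)" for w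
    using that C by (induction q arbitrary: w) (auto simp: pre_digraph.cas.simps T_simps)
  from this[OF cas'] have "pre_digraph.cas T (opt_class (V - C)) (q @ [e]) (opt_class (V - C))" .
  then have "C \<subset> fst (last (q @ [e]))"
    using p q C arcs by (intro reduced_walk_increasing) auto
  then show False using C by simp
qed

end

section \<open>Groups acting on graphs\<close>

lemma group_action_restrictI:
  assumes G: "group G"
    and closed: "\<And>g x. g \<in> carrier G \<Longrightarrow> x \<in> S \<Longrightarrow> f g x \<in> S"
    and one: "\<And>x. x \<in> S \<Longrightarrow> f \<one>\<^bsub>G\<^esub> x = x"
    and mult: "\<And>g h x. g \<in> carrier G \<Longrightarrow> h \<in> carrier G \<Longrightarrow> x \<in> S \<Longrightarrow> f (g \<otimes>\<^bsub>G\<^esub> h) x = f g (f h x)"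
  shows "group_action G S (\<lambda>g. restrict (f g) S)"
proof -
  interpret group G by (rule G)
  have bij: "restrict (f g) S \<in> Bij S" if "g \<in> carrier G" for g
  proof -
    have "bij_betw (restrict (f g) S) S S"
    proof (rule bij_betw_byWitness[where f' = "f (inv\<^bsub>G\<^esub> g)"])
      show "\<forall>x\<in>S. f (inv\<^bsub>G\<^esub> g) (restrict (f g) S x) = x"
        using mult[of "inv\<^bsub>G\<^esub> g" g] one that by simp
      show "\<forall>x\<in>S. restrict (f g) S (f (inv\<^bsub>G\<^esub> g) x) = x"
        using mult[of g "inv\<^bsub>G\<^esub> g"] one that closed by simp
    qed (use closed that in auto)
    then show ?thesis by (auto simp: Bij_def)
  qed
  have "(\<lambda>g. restrict (f g) S) \<in> hom G (BijGroup S)"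
  proof (rule homI)
    fix g h assume gh: "g \<in> carrier G" "h \<in> carrier G"
    have "restrict (f (g \<otimes>\<^bsub>G\<^esub> h)) S = compose S (restrict (f g) S) (restrict (f h) S)"
      using mult gh closed by (auto simp: compose_def fun_eq_iff)
    then show "restrict (f (g \<otimes>\<^bsub>G\<^esub> h)) S = restrict (f g) S \<otimes>\<^bsub>BijGroup S\<^esub> restrict (f h) S"
      using bij gh by (simp add: BijGroup_def)
  qed (use bij in \<open>simp add: BijGroup_def\<close>)
  then show ?thesis
    by (intro group_action.intro group_hom.intro G group_BijGroup group_hom_axioms.intro)
qed

text \<open>The map \<open>f\<close> is arbitrary rather than a \<open>group_action\<close> so that
  the lemma also covers the action on edges, where \<open>image (\<phi> g)\<close> is not restricted
  to \<open>E\<close>.\<close>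

lemma orbit_representatives:
  assumes fin: "finite (orbits G S f)" and one: "\<And>x. x \<in> S \<Longrightarrow> f \<one>\<^bsub>G\<^esub> x = x" and G: "group G"
  obtains R where "R \<subseteq> S" "finite R" "\<And>s. s \<in> S \<Longrightarrow> \<exists>r\<in>R. \<exists>g\<in>carrier G. s = f g r"
proof -
  interpret group G by (rule G)
  have "orbits G S f = orbit G f ` S" by (auto simp: orbits_def)
  then obtain R where R: "R \<subseteq> S" "finite R" "orbit G f ` S = orbit G f ` R"
    using fin finite_subset_image[of "orbit G f ` S" "orbit G f" S] by auto
  have "\<exists>r\<in>R. \<exists>g\<in>carrier G. s = f g r" if s: "s \<in> S" for s
  proof -
    have "s \<in> orbit G f s" using one[OF s] by (auto simp: orbit_def intro!: exI[of _ "\<one>\<^bsub>G\<^esub>"])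
    moreover obtain r where "r \<in> R" "orbit G f s = orbit G f r" using R s by blast
    ultimately show ?thesis by (auto simp: orbit_def)
  qed
  with R show thesis by (intro that)
qed

lemma (in group_action) finite_orbitsI:
  assumes "finite R" "R \<subseteq> E" "\<And>s. s \<in> E \<Longrightarrow> \<exists>r\<in>R. \<exists>g\<in>carrier G. s = \<phi> g r"
  shows "finite (orbits G E \<phi>)"
proof (rule finite_subset)
  show "orbits G E \<phi> \<subseteq> orbit G \<phi> ` R"
  proof
    fix O' assume O: "O' \<in> orbits G E \<phi>"
    then obtain s where s: "s \<in> E" "O' = orbit G \<phi> s" by (auto simp: orbits_def)
    then obtain r where r: "r \<in> R" "s \<in> orbit G \<phi> r" using assms(3) by (fastforce simp: orbit_def)
    have "s \<in> O'" using s orbit_refl by simp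
    moreover have "orbit G \<phi> r \<in> orbits G E \<phi>" using r assms by (auto simp: orbits_def)
    ultimately have "O' = orbit G \<phi> r" using disjoint_union[OF O] r by blast
    then show "O' \<in> orbit G \<phi> ` R" using r by simp
  qed
qed (use assms in simp)

locale graph_action =
  fixes V :: "'v set" and E :: "'v set set" and G :: "('g, 'm) monoid_scheme" and \<phi> :: "'g \<Rightarrow> 'v \<Rightarrow> 'v"
  assumes acts: "acts_on_graph G V E \<phi>"
    and finite_vertex_stabilizer: "v \<in> V \<Longrightarrow> finite (stabilizer G \<phi> v)"
begin

sublocale group_action G V \<phi> using acts by (simp add: acts_on_graph_def)

sublocale group G using group_hom group_hom.axioms(1) by auto

abbreviation act :: "'g \<Rightarrow> 'v set \<Rightarrow> 'v set" where "act g \<equiv> image (\<phi> g)"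

lemma act_vertex [simp]: "g \<in> carrier G \<Longrightarrow> v \<in> V \<Longrightarrow> \<phi> g v \<in> V"
  using element_image by blast

lemma act_subset: "g \<in> carrier G \<Longrightarrow> A \<subseteq> V \<Longrightarrow> act g A \<subseteq> V"
  using act_vertex by blast

lemma vertex_one: "v \<in> V \<Longrightarrow> \<phi> \<one>\<^bsub>G\<^esub> v = v"
  using id_eq_one by (metis restrict_apply')

lemma vertex_inv [simp]: "g \<in> carrier G \<Longrightarrow> v \<in> V \<Longrightarrow> \<phi> (inv\<^bsub>G\<^esub> g) (\<phi> g v) = v"
  using orbit_sym_aux by blast

lemma vertex_inv' [simp]: "g \<in> carrier G \<Longrightarrow> v \<in> V \<Longrightarrow> \<phi> g (\<phi> (inv\<^bsub>G\<^esub> g) v) = v"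
  using vertex_inv[of "inv\<^bsub>G\<^esub> g" v] by simp

lemma vertex_eq_iff: "g \<in> carrier G \<Longrightarrow> u \<in> V \<Longrightarrow> v \<in> V \<Longrightarrow> \<phi> g u = \<phi> g v \<longleftrightarrow> u = v"
  using vertex_inv by metis

lemma act_one: "A \<subseteq> V \<Longrightarrow> act \<one>\<^bsub>G\<^esub> A = A"
  using vertex_one by force

lemma act_mult: "g \<in> carrier G \<Longrightarrow> h \<in> carrier G \<Longrightarrow> A \<subseteq> V \<Longrightarrow> act (g \<otimes>\<^bsub>G\<^esub> h) A = act g (act h A)"
  using composition_rule by (force simp: image_image)

lemma act_inv: "g \<in> carrier G \<Longrightarrow> A \<subseteq> V \<Longrightarrow> act (inv\<^bsub>G\<^esub> g) (act g A) = A"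
  using act_mult[of "inv\<^bsub>G\<^esub> g" g A] act_one by simp

lemma act_inv': "g \<in> carrier G \<Longrightarrow> A \<subseteq> V \<Longrightarrow> act g (act (inv\<^bsub>G\<^esub> g) A) = A"
  using act_mult[of g "inv\<^bsub>G\<^esub> g" A] act_one by simp

lemma act_mem_iff: "g \<in> carrier G \<Longrightarrow> v \<in> V \<Longrightarrow> A \<subseteq> V \<Longrightarrow> \<phi> g v \<in> act g A \<longleftrightarrow> v \<in> A"
  using vertex_eq_iff by blast

lemma act_subset_iff: "g \<in> carrier G \<Longrightarrow> A \<subseteq> V \<Longrightarrow> B \<subseteq> V \<Longrightarrow> act g A \<subseteq> act g B \<longleftrightarrow> A \<subseteq> B"
  by (metis act_inv image_mono)

lemma act_eq_iff: "g \<in> carrier G \<Longrightarrow> A \<subseteq> V \<Longrightarrow> B \<subseteq> V \<Longrightarrow> act g A = act g B \<longleftrightarrow> A = B"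
  using inj_on_image_eq_iff[OF inj_prop] by blast

lemma act_compl: "g \<in> carrier G \<Longrightarrow> A \<subseteq> V \<Longrightarrow> act g (V - A) = V - act g A"
  using inj_on_image_set_diff[OF inj_prop, of g V A] surj_prop by simp

lemma act_Int: "g \<in> carrier G \<Longrightarrow> A \<subseteq> V \<Longrightarrow> B \<subseteq> V \<Longrightarrow> act g (A \<inter> B) = act g A \<inter> act g B"
  using inj_on_image_Int[OF inj_prop] by blast

lemma edge_act: "g \<in> carrier G \<Longrightarrow> u \<in> V \<Longrightarrow> v \<in> V \<Longrightarrow> {u, v} \<in> E \<Longrightarrow> {\<phi> g u, \<phi> g v} \<in> E"
  using acts by (simp add: acts_on_graph_def)

section \<open>Invariance of cuts and optimal cuts under the action\<close>

lemma connected_act: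
  assumes g: "g \<in> carrier G" and W: "W \<subseteq> V" "induces_connected E W"
  shows "induces_connected E (act g W)"
  unfolding induces_connected_def
proof (intro ballI)
  fix a b assume "a \<in> act g W" "b \<in> act g W"
  then obtain u v where uv: "u \<in> W" "v \<in> W" "a = \<phi> g u" "b = \<phi> g v" by auto
  have "v \<in> {v. (\<phi> g u, \<phi> g v) \<in> joined E (act g W)}"
    using induces_connectedD[OF W(2) uv(1,2)]
  proof (rule joined_closed, goal_cases)
    case 1
    show ?case using uv by (auto intro: joined_refl)
  next
    case (2 x y)
    have "(\<phi> g x, \<phi> g y) \<in> joined E (act g W)"
      using 2 W g by (intro joined_step edge_act) auto
    with 2 show ?case by (auto intro: joined_trans)
  qed
  then show "(a, b) \<in> joined E (act g W)" using uv by simp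
qed

lemma boundary_act_subset:
  assumes g: "g \<in> carrier G" and C: "C \<subseteq> V" and e: "e \<in> boundary V E C"
  shows "act g e \<in> boundary V E (act g C)"
proof -
  obtain u v where uv: "e = {u, v}" "{u, v} \<in> E" "u \<in> C" "u \<in> V" "v \<in> V" "v \<notin> C"
    using boundary_ends[OF e C] .
  then show ?thesis using edge_act[OF g uv(4,5,2)] act_mem_iff[OF g _ C] g
    by (auto intro!: boundaryI)
qed

lemma boundary_subset_Pow: "C \<subseteq> V \<Longrightarrow> boundary V E C \<subseteq> Pow V"
  by (auto simp: boundary_def)

lemma boundary_act:
  assumes g: "g \<in> carrier G" and C: "C \<subseteq> V"
  shows "boundary V E (act g C) = image (act g) (boundary V E C)"
proof
  show "image (act g) (boundary V E C) \<subseteq> boundary V E (act g C)"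
    using boundary_act_subset[OF g C] by auto
  show "boundary V E (act g C) \<subseteq> image (act g) (boundary V E C)"
  proof
    fix e assume e: "e \<in> boundary V E (act g C)"
    have ig: "inv\<^bsub>G\<^esub> g \<in> carrier G" using g by simp
    have "act (inv\<^bsub>G\<^esub> g) e \<in> boundary V E C"
      using boundary_act_subset[OF ig act_subset[OF g C] e] act_inv[OF g C] by simp
    moreover have "e = act g (act (inv\<^bsub>G\<^esub> g) e)"
      using act_inv'[OF g] boundary_subset_Pow[OF act_subset[OF g C]] e by auto
    ultimately show "e \<in> image (act g) (boundary V E C)" by blast
  qed
qed

lemma card_boundary_act:
  assumes g: "g \<in> carrier G" and C: "C \<subseteq> V"
  shows "card (boundary V E (act g C)) = card (boundary V E C)"
  unfolding boundary_act[OF assms]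
proof (intro card_image inj_onI)
  fix e f assume "e \<in> boundary V E C" "f \<in> boundary V E C" "act g e = act g f"
  moreover from this have "e \<subseteq> V" "f \<subseteq> V" using boundary_subset_Pow[OF C] by auto
  ultimately show "e = f" using act_eq_iff[OF g] by simp
qed

lemma cut_act:
  assumes g: "g \<in> carrier G" and C: "cut V E C" shows "cut V E (act g C)"
proof -
  have CV: "C \<subseteq> V" using C by (simp add: cut_def)
  note compl = act_compl[OF g CV]
  have conn: "induces_connected E (act g C)" "induces_connected E (act g (V - C))"
    using C by (auto simp: cut_def intro!: connected_act[OF g])
  have "finite (boundary V E (act g C))" using C by (simp add: cut_def boundary_act[OF g CV])
  moreover have "act g C \<noteq> {}" "act g (V - C) \<noteq> {}" using C by (auto simp: cut_def)
  ultimately show ?thesis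
    using conn act_subset[OF g CV] unfolding cut_def compl by simp
qed

lemma k_cut_act: "g \<in> carrier G \<Longrightarrow> k_cut V E k C \<Longrightarrow> k_cut V E k (act g C)"
  by (auto simp: k_cut_def cut_act card_boundary_act cut_def[of V E C])

lemma nested_act_iff:
  assumes g: "g \<in> carrier G" and "C \<subseteq> V" "D \<subseteq> V"
  shows "nested V (act g C) (act g D) \<longleftrightarrow> nested V C D"
  unfolding nested_def act_compl[OF g assms(2), symmetric] act_compl[OF g assms(3), symmetric]
  using assms by (simp add: act_subset_iff)

lemma crossing_number_act:
  assumes g: "g \<in> carrier G" and C: "C \<subseteq> V"
  shows "crossing_number V E k (act g C) = crossing_number V E k C"
proof -
  have ig: "inv\<^bsub>G\<^esub> g \<in> carrier G" using g by simp
  have sub: "k_cut V E k D \<Longrightarrow> D \<subseteq> V" for D by (auto simp: k_cut_def cut_def)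
  let ?S = "\<lambda>C. {D. k_cut V E k D \<and> \<not> nested V C D}"
  have "bij_betw (act g) (?S C) (?S (act g C))"
  proof (rule bij_betw_byWitness[where f' = "act (inv\<^bsub>G\<^esub> g)"])
    show "\<forall>D\<in>?S C. act (inv\<^bsub>G\<^esub> g) (act g D) = D" by (simp add: act_inv[OF g sub])
    show "\<forall>D\<in>?S (act g C). act g (act (inv\<^bsub>G\<^esub> g) D) = D" by (simp add: act_inv'[OF g sub])
    show "act g ` ?S C \<subseteq> ?S (act g C)" using k_cut_act[OF g] nested_act_iff[OF g C sub] by auto
    show "act (inv\<^bsub>G\<^esub> g) ` ?S (act g C) \<subseteq> ?S C"
    proof (rule image_subsetI)
      fix D assume D: "D \<in> ?S (act g C)"
      then have kD: "k_cut V E k D" by simp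
      have "\<not> nested V (act g C) (act g (act (inv\<^bsub>G\<^esub> g) D))" using D act_inv'[OF g sub[OF kD]] by simp
      then show "act (inv\<^bsub>G\<^esub> g) D \<in> ?S C"
        using k_cut_act[OF ig kD] nested_act_iff[OF g C act_subset[OF ig sub[OF kD]]] by simp
    qed
  qed
  then show ?thesis unfolding crossing_number_def by (simp add: bij_betw_same_card)
qed

lemma biinfinite_path_act:
  assumes g: "g \<in> carrier G" and \<alpha>: "biinfinite_path V E \<alpha>"
  shows "biinfinite_path V E (\<phi> g \<circ> \<alpha>)"
proof -
  have "\<alpha> i \<in> V" for i using \<alpha> by (auto simp: biinfinite_path_def)
  then show ?thesis
    using \<alpha> g inj_prop[OF g] unfolding biinfinite_path_def
    by (auto intro: edge_act comp_inj_on inj_on_subset)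
qed

lemma path_act_inv:
  assumes "g \<in> carrier G" "biinfinite_path V E \<alpha>"
  shows "\<phi> (inv\<^bsub>G\<^esub> g) \<circ> (\<phi> g \<circ> \<alpha>) = \<alpha>"
proof
  fix i
  have "\<alpha> i \<in> V" using assms(2) by (auto simp: biinfinite_path_def)
  then show "(\<phi> (inv\<^bsub>G\<^esub> g) \<circ> (\<phi> g \<circ> \<alpha>)) i = \<alpha> i" using assms(1) by simp
qed

lemma cuts_of_act:
  assumes g: "g \<in> carrier G" and \<alpha>: "biinfinite_path V E \<alpha>" and C: "C \<in> cuts_of V E \<alpha>"
  shows "act g C \<in> cuts_of V E (\<phi> g \<circ> \<alpha>)"
proof -
  have sub: "C \<subseteq> V" "range \<alpha> \<subseteq> V" using C \<alpha> by (auto simp: cuts_of_def cut_def biinfinite_path_def)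
  have *: "infinite (range (\<phi> g \<circ> \<alpha>) \<inter> act g A)" if "infinite (range \<alpha> \<inter> A)" "A \<subseteq> V" for A
  proof -
    have "range (\<phi> g \<circ> \<alpha>) \<inter> act g A = act g (range \<alpha> \<inter> A)"
      unfolding act_Int[OF g sub(2) that(2)] by (simp add: image_comp)
    moreover have "inj_on (\<phi> g) (range \<alpha> \<inter> A)" using inj_on_subset[OF inj_prop[OF g]] that by blast
    ultimately show ?thesis using that by (simp add: finite_image_iff)
  qed
  show ?thesis
    using C *[of C] *[of "V - C"] sub(1) cut_act[OF g] act_compl[OF g sub(1)] by (simp add: cuts_of_def)
qed

text \<open>A smaller cut for the translated path would pull back, by the inverse of
  \<open>g\<close>, to a smaller one for \<alpha>. The same argument with crossing numbers serves
  for optimal cuts.\<close>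

lemma min_cuts_of_act:
  assumes g: "g \<in> carrier G" and \<alpha>: "biinfinite_path V E \<alpha>" and C: "C \<in> min_cuts_of V E \<alpha>"
  shows "act g C \<in> min_cuts_of V E (\<phi> g \<circ> \<alpha>)"
proof -
  have ig: "inv\<^bsub>G\<^esub> g \<in> carrier G" using g by simp
  have C1: "C \<in> cuts_of V E \<alpha>" and C2: "\<And>D. D \<in> cuts_of V E \<alpha> \<Longrightarrow> card (boundary V E C) \<le> card (boundary V E D)"
    using C by (auto simp: min_cuts_of_def is_arg_min_def not_less)
  have CV: "C \<subseteq> V" using C1 by (auto simp: cuts_of_def cut_def)
  have "card (boundary V E (act g C)) \<le> card (boundary V E D)" if D: "D \<in> cuts_of V E (\<phi> g \<circ> \<alpha>)" for D
  proof -
    have DV: "D \<subseteq> V" using D by (auto simp: cuts_of_def cut_def)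
    have "act (inv\<^bsub>G\<^esub> g) D \<in> cuts_of V E \<alpha>"
      using cuts_of_act[OF ig biinfinite_path_act[OF g \<alpha>] D] path_act_inv[OF g \<alpha>] by simp
    from C2[OF this] show ?thesis using card_boundary_act[OF g CV] card_boundary_act[OF ig DV] by simp
  qed
  with cuts_of_act[OF g \<alpha> C1] show ?thesis by (auto simp: min_cuts_of_def is_arg_min_def not_less)
qed

lemma opt_cuts_act:
  assumes g: "g \<in> carrier G" and C: "C \<in> opt_cuts V E k"
  shows "act g C \<in> opt_cuts V E k"
proof -
  have ig: "inv\<^bsub>G\<^esub> g \<in> carrier G" using g by simp
  have sub: "D \<in> min_cuts_of V E \<beta> \<Longrightarrow> D \<subseteq> V" for D \<beta>
    by (auto simp: min_cuts_of_def is_arg_min_def cuts_of_def cut_def)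
  obtain \<alpha> where \<alpha>: "biinfinite_path V E \<alpha>" and C1: "C \<in> min_cuts_of V E \<alpha>"
    and C2: "\<And>D. D \<in> min_cuts_of V E \<alpha> \<Longrightarrow> crossing_number V E k C \<le> crossing_number V E k D"
    using C by (auto simp: opt_cuts_def opt_cuts_of_def is_arg_min_def not_less)
  have "crossing_number V E k (act g C) \<le> crossing_number V E k D"
    if D: "D \<in> min_cuts_of V E (\<phi> g \<circ> \<alpha>)" for D
  proof -
    have "act (inv\<^bsub>G\<^esub> g) D \<in> min_cuts_of V E \<alpha>"
      using min_cuts_of_act[OF ig biinfinite_path_act[OF g \<alpha>] D] path_act_inv[OF g \<alpha>] by simp
    from C2[OF this] show ?thesis
      using crossing_number_act[OF g sub[OF C1]] crossing_number_act[OF ig sub[OF D]] by simp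
  qed
  with min_cuts_of_act[OF g \<alpha> C1] have "act g C \<in> opt_cuts_of V E k (\<phi> g \<circ> \<alpha>)"
    by (auto simp: opt_cuts_of_def is_arg_min_def not_less)
  then show ?thesis using biinfinite_path_act[OF g \<alpha>] by (auto simp: opt_cuts_def)
qed

text \<open>If nonempty, this set is a left coset of the stabilizer of \<open>v\<close>.\<close>

lemma finite_vertex_transporter:
  assumes "v \<in> V"
  shows "finite {g \<in> carrier G. \<phi> g v = w}"
proof (cases "\<exists>h\<in>carrier G. \<phi> h v = w")
  case True
  then obtain h where h: "h \<in> carrier G" "\<phi> h v = w" by auto
  have "{g \<in> carrier G. \<phi> g v = w} \<subseteq> (\<lambda>s. h \<otimes>\<^bsub>G\<^esub> s) ` stabilizer G \<phi> v"
  proof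
    fix g assume g: "g \<in> {g \<in> carrier G. \<phi> g v = w}"
    then have "inv\<^bsub>G\<^esub> h \<otimes>\<^bsub>G\<^esub> g \<in> stabilizer G \<phi> v"
      using h assms vertex_inv[OF h(1) assms] by (simp add: stabilizer_def composition_rule)
    moreover have "g = h \<otimes>\<^bsub>G\<^esub> (inv\<^bsub>G\<^esub> h \<otimes>\<^bsub>G\<^esub> g)" using g h by (simp add: m_assoc[symmetric])
    ultimately show "g \<in> (\<lambda>s. h \<otimes>\<^bsub>G\<^esub> s) ` stabilizer G \<phi> v" by blast
  qed
  then show ?thesis using finite_vertex_stabilizer[OF assms] by (auto intro: finite_subset)
next
  case False
  then have "{g \<in> carrier G. \<phi> g v = w} = {}" by auto
  then show ?thesis by (simp only: finite.emptyI)
qed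

text \<open>Such a \<open>g\<close> carries one fixed end point of a boundary edge of
  \<open>P\<close> into the finite set of end points of boundary edges of \<open>Q\<close>, so
  vertex transporters suffice.\<close>

lemma finite_set_transporter:
  assumes P: "P \<subseteq> V" "boundary V E P \<noteq> {}" and Q: "finite (boundary V E Q)"
  shows "finite {g \<in> carrier G. act g P = Q}"
proof -
  obtain e where "e \<in> boundary V E P" using P by auto
  then obtain u v where e: "e = {u, v}" "e \<in> boundary V E P" "u \<in> V" using boundary_ends[OF _ P(1)] by metis
  have fin: "finite (\<Union> (boundary V E Q))"
    using Q by (intro finite_Union) (auto simp: boundary_def)
  have "{g \<in> carrier G. act g P = Q} \<subseteq> (\<Union>w\<in>\<Union> (boundary V E Q). {g \<in> carrier G. \<phi> g u = w})"
  proof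
    fix g assume g: "g \<in> {g \<in> carrier G. act g P = Q}"
    then have "act g e \<in> boundary V E Q" using boundary_act_subset[of g P e] e P by auto
    moreover have "\<phi> g u \<in> act g e" using e by simp
    ultimately show "g \<in> (\<Union>w\<in>\<Union> (boundary V E Q). {g \<in> carrier G. \<phi> g u = w})" using g by blast
  qed
  moreover have "finite (\<Union>w\<in>\<Union> (boundary V E Q). {g \<in> carrier G. \<phi> g u = w})"
    using fin finite_vertex_transporter[OF e(3)] by (rule finite_UN_I)
  ultimately show ?thesis by (rule finite_subset)
qed

end

locale accessible_action = accessible_graph V E k + graph_action V E G \<phi>
  for V :: "'v set" and E :: "'v set set" and k :: nat
    and G :: "('g, 'm) monoid_scheme" and \<phi> :: "'g \<Rightarrow> 'v \<Rightarrow> 'v" +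
  assumes simple: "simple_graph V E" and locally_finite: "locally_finite V E"
    and finite_vertex_orbits: "finite (orbits G V \<phi>)"
    and finite_edge_orbits: "finite (orbits G E (\<lambda>g. image (\<phi> g)))"
begin

lemma act_opts: "g \<in> carrier G \<Longrightarrow> C \<in> opts \<Longrightarrow> act g C \<in> opts"
  by (rule opt_cuts_act)

lemma opt_boundary: "C \<in> opts \<Longrightarrow> boundary V E C \<noteq> {}" "C \<in> opts \<Longrightarrow> finite (boundary V E C)"
proof -
  assume C: "C \<in> opts"
  obtain u v where "u \<in> C" "v \<in> V - C" using opt_cut_props(2,3)[OF C] by auto
  then show "boundary V E C \<noteq> {}"
    using connected_boundary_nonempty[OF connected, of u C v] opt_cut_props(1)[OF C] by auto
  show "finite (boundary V E C)" using opt_cut_cut[OF C] by (simp add: cut_def)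
qed

lemma finite_opt_transporter: "C \<in> opts \<Longrightarrow> D \<in> opts \<Longrightarrow> finite {g \<in> carrier G. act g C = D}"
  using finite_set_transporter opt_cut_props(1) opt_boundary by simp

lemma opt_equiv_act:
  assumes g: "g \<in> carrier G" and CD: "(C, D) \<in> opt_equiv V E k"
  shows "(act g C, act g D) \<in> opt_equiv V E k"
proof -
  have ig: "inv\<^bsub>G\<^esub> g \<in> carrier G" using g by simp
  have O: "C \<in> opts" "D \<in> opts" using CD by (auto simp: opt_equiv_iff)
  have CV: "C \<subseteq> V" "D \<subseteq> V" "V - C \<subseteq> V" using O opt_cut_props by auto
  have "covers (V - act g C) (act g D)" if cov: "covers (V - C) D"
    unfolding covers_def
  proof (intro conjI ballI impI)
    have "V - C \<subseteq> D" "\<not> D \<subseteq> V - C" using cov by (auto simp: covers_def)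
    then show "V - act g C \<subset> act g D"
      unfolding act_compl[OF g CV(1), symmetric] psubset_eq
      using act_subset_iff[OF g CV(3,2)] act_subset_iff[OF g CV(2,3)] by auto
    fix F assume F: "F \<in> opts" "V - act g C \<subset> F \<and> F \<subseteq> act g D"
    let ?F = "act (inv\<^bsub>G\<^esub> g) F"
    have FV: "F \<subseteq> V" "?F \<in> opts" "?F \<subseteq> V" using F opt_cut_props act_opts[OF ig] by auto
    have FF: "act g ?F = F" using act_inv'[OF g FV(1)] .
    have "act g (V - C) \<subset> act g ?F \<and> act g ?F \<subseteq> act g D" using F FF act_compl[OF g CV(1)] by simp
    then have "V - C \<subset> ?F \<and> ?F \<subseteq> D"
      using act_subset_iff[OF g] CV FV by (metis psubset_eq)
    then have "D = ?F" using cov FV by (auto simp: covers_def)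
    then show "act g D = F" using FF by simp
  qed
  then show ?thesis using CD act_opts[OF g] by (auto simp: opt_equiv_iff)
qed

lemma act_opt_class:
  assumes g: "g \<in> carrier G" and C: "C \<in> opts"
  shows "image (act g) (opt_class C) = opt_class (act g C)"
proof
  show "image (act g) (opt_class C) \<subseteq> opt_class (act g C)" using opt_equiv_act[OF g] by auto
  have ig: "inv\<^bsub>G\<^esub> g \<in> carrier G" using g by simp
  show "opt_class (act g C) \<subseteq> image (act g) (opt_class C)"
  proof
    fix D assume "D \<in> opt_class (act g C)"
    then have D: "(act g C, D) \<in> opt_equiv V E k" by simp
    then have "D \<subseteq> V" using opt_cut_props by (auto simp: opt_equiv_iff)
    have "act (inv\<^bsub>G\<^esub> g) D \<in> opt_class C"
      using opt_equiv_act[OF ig D] act_inv[OF g opt_cut_props(1)[OF C]] by simp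
    moreover have "D = act g (act (inv\<^bsub>G\<^esub> g) D)" using act_inv'[OF g \<open>D \<subseteq> V\<close>] by simp
    ultimately show "D \<in> image (act g) (opt_class C)" by blast
  qed
qed

section \<open>The induced action on the tree\<close>

abbreviation "\<psi> \<equiv> tree_vertex_action V E k \<phi>"
abbreviation "\<eta> \<equiv> tree_arc_action V E k \<phi>"

lemma vertsE: assumes "x \<in> verts T" obtains C where "C \<in> opts" "x = opt_class C"
  using assms by (auto simp: T_simps elim: quotientE)

lemma verts_cut: "x \<in> verts T \<Longrightarrow> D \<in> x \<Longrightarrow> D \<in> opts"
  by (auto simp: opt_equiv_iff elim: vertsE)

lemma vertex_action: "group_action G (verts T) \<psi>"
  unfolding tree_vertex_action_def
proof (rule group_action_restrictI)
  show "group G" by (rule is_group)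
  fix x assume x: "x \<in> verts T"
  then have sub: "D \<in> x \<Longrightarrow> D \<subseteq> V" for D using verts_cut opt_cut_props(1) by blast
  show "act \<one>\<^bsub>G\<^esub> ` x = x" using act_one sub by force
  show "act g ` x \<in> verts T" if "g \<in> carrier G" for g
    using x by (rule vertsE) (use that act_opt_class act_opts in \<open>auto simp: T_simps quotientI\<close>)
  show "act (g \<otimes>\<^bsub>G\<^esub> h) ` x = act g ` act h ` x" if "g \<in> carrier G" "h \<in> carrier G" for g h
    using act_mult[OF that] sub by (force simp: image_image)
qed

lemma arc_action: "group_action G (arcs T) \<eta>"
  unfolding tree_arc_action_def
proof (rule group_action_restrictI)
  show "group G" by (rule is_group)
  fix e assume "e \<in> arcs T"
  then obtain C where C: "C \<in> opts" "e = (C, V - C)" by (auto simp: T_simps)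
  note CV = opt_cut_props(1)[OF C(1)]
  show "map_prod (act \<one>\<^bsub>G\<^esub>) (act \<one>\<^bsub>G\<^esub>) e = e" using act_one C CV by simp
  show "map_prod (act g) (act g) e \<in> arcs T" if "g \<in> carrier G" for g
    using C act_opts[OF that C(1)] act_compl[OF that CV] by (auto simp: T_simps)
  show "map_prod (act (g \<otimes>\<^bsub>G\<^esub> h)) (act (g \<otimes>\<^bsub>G\<^esub> h)) e = map_prod (act g) (act g) (map_prod (act h) (act h) e)"
    if "g \<in> carrier G" "h \<in> carrier G" for g h
    using C CV act_mult[OF that] by simp
qed

lemma acts_on_tree: "acts_on_bidirected G T trev \<psi> \<eta>"
  unfolding acts_on_bidirected_def
proof (intro conjI ballI)
  show "group_action G (verts T) \<psi>" "group_action G (arcs T) \<eta>" by (fact vertex_action arc_action)+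
  fix g e assume g: "g \<in> carrier G" and e: "e \<in> arcs T"
  then obtain C where C: "C \<in> opts" "e = (C, V - C)" by (auto simp: T_simps)
  note C' = opt_cuts_compl[OF C(1)]
  have \<eta>e: "\<eta> g e = (act g C, act g (V - C))" using e C by (simp add: tree_arc_action_def)
  have \<eta>a: "\<eta> g e \<in> arcs T" by (rule group_action.element_image[OF arc_action g e refl])
  have v: "opt_class C \<in> verts T" "opt_class (V - C) \<in> verts T" using C C' by (auto simp: T_simps quotientI)
  show "tail T (\<eta> g e) = \<psi> g (tail T e)" "head T (\<eta> g e) = \<psi> g (head T e)"
    using v C act_opt_class[OF g C(1)] act_opt_class[OF g C'] unfolding \<eta>e
    by (auto simp: T_simps(3,4) tree_vertex_action_def)
  show "\<eta> g (trev e) = trev (\<eta> g e)"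
    using trev_simp[OF e] trev_simp[OF \<eta>a] arc_rev[OF e] C \<eta>e by (simp add: tree_arc_action_def)
qed

text \<open>Some boundary edge of the cut can be moved to one of the finitely many edge
  representatives. Arc orbits, vertex orbits and later the orbits of blocks are all counted by this
  list.\<close>

lemma opt_cut_representatives:
  obtains R where "R \<subseteq> opts" "finite R" "\<And>C. C \<in> opts \<Longrightarrow> \<exists>D\<in>R. \<exists>g\<in>carrier G. C = act g D"
proof -
  have EV: "e \<in> E \<Longrightarrow> e \<subseteq> V" for e using simple by (auto simp: simple_graph_def)
  obtain R where R: "R \<subseteq> E" "finite R" "\<And>e. e \<in> E \<Longrightarrow> \<exists>r\<in>R. \<exists>g\<in>carrier G. e = act g r"
    using orbit_representatives[OF finite_edge_orbits _ is_group] act_one EV by metis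
  let ?R = "{C \<in> opts. \<exists>e\<in>R. e \<in> boundary V E C}"
  have "?R \<subseteq> (\<Union>e\<in>R. {C. k_cut V E k C \<and> e \<in> boundary V E C})" using opt_cut_k_cut by blast
  then have "finite ?R" by (rule finite_subset[OF _ finite_UN_I[OF R(2) finite_k_cuts_through]])
  moreover have "\<exists>D\<in>?R. \<exists>g\<in>carrier G. C = act g D" if C: "C \<in> opts" for C
  proof -
    note CV = opt_cut_props(1)[OF C]
    obtain e where e: "e \<in> boundary V E C" using opt_boundary[OF C] by auto
    then obtain r g where r: "r \<in> R" "g \<in> carrier G" "e = act g r" using R(3)[of e] boundary_subset by blast
    have ig: "inv\<^bsub>G\<^esub> g \<in> carrier G" using r by simp
    have "act (inv\<^bsub>G\<^esub> g) e \<in> boundary V E (act (inv\<^bsub>G\<^esub> g) C)"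
      by (rule boundary_act_subset[OF ig CV e])
    moreover have "act (inv\<^bsub>G\<^esub> g) e = r" using r(3) act_inv[OF r(2) EV] R(1) r(1) by auto
    ultimately have "act (inv\<^bsub>G\<^esub> g) C \<in> ?R" using act_opts[OF ig C] r(1) by auto
    moreover have "C = act g (act (inv\<^bsub>G\<^esub> g) C)" using act_inv'[OF r(2) CV] by simp
    ultimately show ?thesis using r(2) by (intro bexI)
  qed
  ultimately show thesis by (intro that[of ?R]) auto
qed

lemma finite_orbits_arcs: "finite (orbits G (arcs T) \<eta>)"
proof -
  obtain R where R: "R \<subseteq> opts" "finite R" "\<And>C. C \<in> opts \<Longrightarrow> \<exists>D\<in>R. \<exists>g\<in>carrier G. C = act g D"
    using opt_cut_representatives by metis
  show ?thesis
  proof (rule group_action.finite_orbitsI[OF arc_action])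
    show "finite ((\<lambda>C. (C, V - C)) ` R)" using R by simp
    show "(\<lambda>C. (C, V - C)) ` R \<subseteq> arcs T" using R by (auto simp: T_simps)
    fix e assume "e \<in> arcs T"
    then obtain C where C: "C \<in> opts" "e = (C, V - C)" by (auto simp: T_simps)
    then obtain D g where D: "D \<in> R" "g \<in> carrier G" "C = act g D" using R(3) by blast
    have DO: "D \<in> opts" using D R by auto
    have "(D, V - D) \<in> arcs T" using DO by (auto simp: T_simps)
    then have "e = \<eta> g (D, V - D)"
      using C D act_compl[OF D(2) opt_cut_props(1)[OF DO]] by (simp add: tree_arc_action_def)
    then show "\<exists>r\<in>(\<lambda>C. (C, V - C)) ` R. \<exists>g\<in>carrier G. e = \<eta> g r" using D by blast
  qed
qed

lemma finite_orbits_verts: "finite (orbits G (verts T) \<psi>)"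
proof -
  obtain R where R: "R \<subseteq> opts" "finite R" "\<And>C. C \<in> opts \<Longrightarrow> \<exists>D\<in>R. \<exists>g\<in>carrier G. C = act g D"
    using opt_cut_representatives by metis
  show ?thesis
  proof (rule group_action.finite_orbitsI[OF vertex_action])
    show "finite (opt_class ` R)" using R by simp
    show sub: "opt_class ` R \<subseteq> verts T" using R by (auto simp: T_simps quotientI)
    fix x assume "x \<in> verts T"
    then obtain C where C: "C \<in> opts" "x = opt_class C" by (rule vertsE)
    then obtain D g where D: "D \<in> R" "g \<in> carrier G" "C = act g D" using R(3) by blast
    have "D \<in> opts" using D R by auto
    moreover have "opt_class D \<in> verts T" using sub D(1) by blast
    ultimately have "x = \<psi> g (opt_class D)"
      using C D act_opt_class[OF D(2)] by (simp add: tree_vertex_action_def)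
    then show "\<exists>r\<in>opt_class ` R. \<exists>g\<in>carrier G. x = \<psi> g r" using D by blast
  qed
qed

text \<open>An unoriented edge is also fixed by elements that interchange its two arcs; these carry
  \<open>C\<close> to \<open>V - C\<close>, which adds one more finite transporter.\<close>

lemma finite_arc_stabilizers:
  assumes e: "e \<in> arcs T"
  shows "finite (stabilizer G \<eta> e)" "finite (stabilizer G (\<lambda>g. image (\<eta> g)) {e, trev e})"
proof -
  obtain C where C: "C \<in> opts" "e = (C, V - C)" using e by (auto simp: T_simps)
  have \<eta>: "\<eta> g (C, V - C) = (act g C, act g (V - C))" for g
    using e C by (simp add: tree_arc_action_def)
  have r: "trev (C, V - C) = (V - C, C)" using trev_simp[OF e] C by simp
  have sub: "stabilizer G (\<lambda>g. image (\<eta> g)) {e, trev e}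
      \<subseteq> {g \<in> carrier G. act g C = C} \<union> {g \<in> carrier G. act g C = V - C}"
  proof
    fix g assume "g \<in> stabilizer G (\<lambda>g. image (\<eta> g)) {e, trev e}"
    then have g: "g \<in> carrier G" and "\<eta> g e \<in> {e, trev e}" by (auto simp: stabilizer_def)
    then have "(act g C, act g (V - C)) \<in> {(C, V - C), (V - C, C)}" unfolding C(2) r \<eta> by simp
    then show "g \<in> {g \<in> carrier G. act g C = C} \<union> {g \<in> carrier G. act g C = V - C}"
      using g by (simp only: insert_iff prod.inject empty_iff mem_Collect_eq Un_iff) blast
  qed
  show "finite (stabilizer G \<eta> e)"
    by (rule finite_subset[OF _ finite_opt_transporter[OF C(1) C(1)]]) (simp add: stabilizer_def C(2) \<eta> subset_iff)
  show "finite (stabilizer G (\<lambda>g. image (\<eta> g)) {e, trev e})"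
    using finite_subset[OF sub] finite_opt_transporter C(1) opt_cuts_compl[OF C(1)] by simp
qed

end

section \<open>Ends of groups acting on contracted graphs\<close>

lemma (in group) finite_right_translate:
  assumes "finite Y" "t \<in> carrier G"
  shows "finite {h \<in> carrier G. h \<otimes> t \<in> Y}"
proof (rule finite_subset)
  show "{h \<in> carrier G. h \<otimes> t \<in> Y} \<subseteq> (\<lambda>y. y \<otimes> inv t) ` Y"
  proof
    fix h assume "h \<in> {h \<in> carrier G. h \<otimes> t \<in> Y}"
    then have "h = (h \<otimes> t) \<otimes> inv t" "h \<otimes> t \<in> Y" using assms(2) by (auto simp: m_assoc)
    then show "h \<in> (\<lambda>y. y \<otimes> inv t) ` Y" by blast
  qed
qed (use assms in simp)

text \<open>\<open>A\<close> is an infinite component left in a Cayley graph by a finite set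
  \<open>N\<close>. Right multiplication by a generator or its inverse follows an edge or fixes the
  point, so it can leave \<open>A\<close> only by landing in \<open>N\<close>; products are
  composed.\<close>

lemma (in group) almost_invariant_set:
  assumes H: "subgroup H G" and ends: "group_more_than_one_end (G\<lparr>carrier := H\<rparr>)"
  obtains A where "A \<subseteq> H" "infinite A" "infinite (H - A)"
    "\<And>t. t \<in> H \<Longrightarrow> finite {h \<in> A. h \<otimes> t \<notin> A}"
proof -
  interpret H: subgroup H G by (rule H)
  let ?K = "G\<lparr>carrier := H\<rparr>"
  obtain S where S: "finite S" "generating_set ?K S" "more_than_one_end (carrier ?K) (cayley_edges ?K S)"
    using ends by (auto simp: group_more_than_one_end_def)
  let ?E = "cayley_edges ?K S"
  have SH: "S \<subseteq> H" and gen: "generate G S = H"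
    using S(2) generate_consistent[OF _ H, of S] by (auto simp: generating_set_def)
  obtain N A B where N: "N \<subseteq> H" "finite N" and AB: "A \<in> components ?E (H - N)" "B \<in> components ?E (H - N)"
    "A \<noteq> B" "infinite A" "infinite B"
    using S(3) by (auto simp: more_than_one_end_def)
  have AH: "A \<subseteq> H - N" "B \<subseteq> H - N"
    using AB Union_quotient[OF equiv_joined, of "H - N" ?E] by (auto simp: components_def)
  have "A \<inter> B = {}" using quotient_disj[OF equiv_joined, of A "H - N" ?E B] AB by (auto simp: components_def)
  then have "B \<subseteq> H - A" using AH by auto
  then have infc: "infinite (H - A)" using AB(5) infinite_super by auto
  obtain a where a: "A = joined ?E (H - N) `` {a}" using AB by (auto simp: components_def elim: quotientE)
  have edge: "y \<in> A" if "x \<in> A" "y \<in> H" "y \<notin> N" "{x, y} \<in> ?E" for x y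
    using component_closed[of x ?E "H - N" a y] that unfolding a by auto
  have fin: "finite {h \<in> A. h \<otimes> t \<notin> A}" if "t \<in> generate G S" for t
    using that
  proof (induction t rule: generate.induct)
    case one
    then show ?case using AH by (auto intro!: finite_subset[of _ "{}"])
  next
    case (incl s)
    have "{h \<in> A. h \<otimes> s \<notin> A} \<subseteq> {h \<in> carrier G. h \<otimes> s \<in> N}"
    proof
      fix h assume h: "h \<in> {h \<in> A. h \<otimes> s \<notin> A}"
      then have hH: "h \<in> H" "h \<otimes> s \<in> H" using AH SH incl by auto
      have "{h, h \<otimes> s} \<in> ?E" unfolding cayley_edges_def
        by (intro CollectI exI[of _ h] exI[of _ s]) (use h hH incl in auto)
      then show "h \<in> {h \<in> carrier G. h \<otimes> s \<in> N}" using edge[of h "h \<otimes> s"] h hH by auto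
    qed
    then show ?case by (rule finite_subset) (rule finite_right_translate, use N incl SH in auto)
  next
    case (inv s)
    have sG: "s \<in> carrier G" "s \<in> H" using SH inv by auto
    have "{h \<in> A. h \<otimes> inv s \<notin> A} \<subseteq> {h \<in> carrier G. h \<otimes> inv s \<in> N}"
    proof
      fix h assume h: "h \<in> {h \<in> A. h \<otimes> inv s \<notin> A}"
      then have hH: "h \<in> H" "h \<otimes> inv s \<in> H" using AH sG by auto
      have hs: "(h \<otimes> inv s) \<otimes> s = h" using hH sG by (auto simp: m_assoc)
      have "{h \<otimes> inv s, (h \<otimes> inv s) \<otimes> s} \<in> ?E"
        unfolding cayley_edges_def
        by (intro CollectI exI[of _ "h \<otimes> inv s"] exI[of _ s]) (use h hH inv hs in auto)
      then have "{h, h \<otimes> inv s} \<in> ?E" unfolding hs by (simp add: insert_commute)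
      then show "h \<in> {h \<in> carrier G. h \<otimes> inv s \<in> N}" using edge[of h "h \<otimes> inv s"] h hH by auto
    qed
    then show ?case by (rule finite_subset) (rule finite_right_translate, use N sG in auto)
  next
    case (eng t1 t2)
    have tH: "t1 \<in> H" "t2 \<in> H" using eng(1,2) gen by auto
    have "{h \<in> A. h \<otimes> (t1 \<otimes> t2) \<notin> A} \<subseteq> {h \<in> A. h \<otimes> t1 \<notin> A}
        \<union> {h \<in> carrier G. h \<otimes> t1 \<in> {h \<in> A. h \<otimes> t2 \<notin> A}}"
      using AH tH by (auto simp: m_assoc[symmetric])
    then show ?case
      using eng finite_right_translate[OF eng(4), of t1] tH by (auto intro: finite_subset)
  qed
  show thesis
    by (rule that[of A]) (use AH AB infc fin gen in auto)
qed

text \<open>The assumptions on \<open>Q\<close> say that \<open>H\<close> acts properly and cocompactly on the locally finite graph obtained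
  by contracting each block to a point; \<open>F\<close> is a finite set of orbit representatives.\<close>

locale block_system = graph_action V E G \<phi>
  for V :: "'v set" and E :: "'v set set" and G :: "('g, 'm) monoid_scheme" and \<phi> :: "'g \<Rightarrow> 'v \<Rightarrow> 'v" +
  fixes H :: "'g set" and Q F :: "'v set set"
  assumes connected: "induces_connected E V" and locally_finite: "locally_finite V E" and nonempty: "V \<noteq> {}"
    and H: "subgroup H G"
    and Union_Q: "\<Union> Q = V" and Q_disjoint: "P \<in> Q \<Longrightarrow> P' \<in> Q \<Longrightarrow> P \<inter> P' \<noteq> {} \<Longrightarrow> P = P'"
    and Q_nonempty: "P \<in> Q \<Longrightarrow> P \<noteq> {}"
    and Q_connected: "P \<in> Q \<Longrightarrow> induces_connected E P"
    and Q_boundary: "P \<in> Q \<Longrightarrow> finite (boundary V E P)"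
    and Q_act: "h \<in> H \<Longrightarrow> P \<in> Q \<Longrightarrow> act h P \<in> Q"
    and Q_transporter: "P \<in> Q \<Longrightarrow> P' \<in> Q \<Longrightarrow> finite {h \<in> H. act h P = P'}"
    and F: "finite F" "F \<subseteq> Q" "P \<in> Q \<Longrightarrow> \<exists>P'\<in>F. \<exists>h\<in>H. P = act h P'"
begin

interpretation H: subgroup H G by (rule H)

section \<open>The contracted graph and a finite generating set\<close>

lemma Q_sub: "P \<in> Q \<Longrightarrow> P \<subseteq> V"
  using Union_Q by auto

lemma H_inv_mult: "g \<in> H \<Longrightarrow> h \<in> H \<Longrightarrow> g \<otimes>\<^bsub>G\<^esub> (inv\<^bsub>G\<^esub> g \<otimes>\<^bsub>G\<^esub> h) = h"
  by (simp add: m_assoc[symmetric])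

text \<open>Adjacency or equality of the points to which two blocks contract. Equality is included
  so that \<open>steps\<close> also contains block stabilizers of representatives and elements
  relating representatives of one orbit.\<close>

definition near :: "'v set \<Rightarrow> 'v set \<Rightarrow> bool" where
  "near P P' \<longleftrightarrow> P = P' \<or> (\<exists>u\<in>P. \<exists>v\<in>P'. {u, v} \<in> E)"

lemma near_act:
  assumes g: "g \<in> carrier G" and P: "P \<subseteq> V" "P' \<subseteq> V" "near P P'"
  shows "near (act g P) (act g P')"
  using P edge_act[OF g] unfolding near_def by blast

lemma finite_block_at: "finite {P \<in> Q. v \<in> P}"
proof (cases "\<exists>P\<in>Q. v \<in> P")
  case True
  then obtain P where "P \<in> Q" "v \<in> P" by auto
  then have "{P \<in> Q. v \<in> P} \<subseteq> {P}" using Q_disjoint by blast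
  then show ?thesis by (rule finite_subset) simp
next
  case False
  then have "{P \<in> Q. v \<in> P} = {}" by auto
  then show ?thesis by (simp only: finite.emptyI)
qed

lemma finite_boundary_ends: "P \<in> Q \<Longrightarrow> finite (\<Union> (boundary V E P))"
  using Q_boundary by (intro finite_Union) (auto simp: boundary_def)

text \<open>Local finiteness of the contracted graph: an edge to another block is a boundary edge,
  and a vertex lies in only one block.\<close>

lemma finite_near:
  assumes P: "P \<in> Q" shows "finite {P' \<in> Q. near P P'}"
proof (rule finite_subset)
  show "{P' \<in> Q. near P P'} \<subseteq> {P} \<union> (\<Union>v\<in>\<Union> (boundary V E P). {P' \<in> Q. v \<in> P'})"
  proof
    fix P' assume P': "P' \<in> {P' \<in> Q. near P P'}"
    show "P' \<in> {P} \<union> (\<Union>v\<in>\<Union> (boundary V E P). {P' \<in> Q. v \<in> P'})"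
    proof (cases "P' = P")
      case False
      then obtain u v where uv: "u \<in> P" "v \<in> P'" "{u, v} \<in> E" using P' by (auto simp: near_def)
      have "v \<notin> P" "v \<in> V" using Q_disjoint[OF P, of P'] False P' uv(2) Q_sub by auto
      then have "{u, v} \<in> boundary V E P" using uv by (auto intro: boundaryI)
      then show ?thesis using P' uv(2) by blast
    qed simp
  qed
  show "finite ({P} \<union> (\<Union>v\<in>\<Union> (boundary V E P). {P' \<in> Q. v \<in> P'}))"
    using finite_UN_I[OF finite_boundary_ends[OF P] finite_block_at] by simp
qed

text \<open>The generating set of the Milnor-Schwarz argument. It is finite because few blocks are
  near a representative and transporters between blocks are finite.\<close>

definition steps :: "'g set" where
  "steps = {h \<in> H. \<exists>P\<in>F. \<exists>P'\<in>F. near P (act h P')}"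

lemma finite_steps: "finite steps"
proof (rule finite_subset)
  show "steps \<subseteq> (\<Union>P\<in>F. \<Union>P'\<in>F. \<Union>P''\<in>{P''\<in>Q. near P P''}. {h \<in> H. act h P' = P''})"
  proof
    fix h assume "h \<in> steps"
    then obtain P P' where "h \<in> H" "P \<in> F" "P' \<in> F" "near P (act h P')" by (auto simp: steps_def)
    moreover from this have "act h P' \<in> Q" using Q_act F by auto
    ultimately show "h \<in> (\<Union>P\<in>F. \<Union>P'\<in>F. \<Union>P''\<in>{P''\<in>Q. near P P''}. {h \<in> H. act h P' = P''})" by blast
  qed
  show "finite (\<Union>P\<in>F. \<Union>P'\<in>F. \<Union>P''\<in>{P''\<in>Q. near P P''}. {h \<in> H. act h P' = P''})"
    using F by (intro finite_UN_I finite_near Q_transporter) auto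
qed

lemma near_steps:
  assumes "h \<in> H" "h' \<in> H" "P \<in> F" "P' \<in> F" "near (act h P) (act h' P')"
  shows "inv\<^bsub>G\<^esub> h \<otimes>\<^bsub>G\<^esub> h' \<in> steps"
proof -
  have PV: "P \<subseteq> V" "P' \<subseteq> V" using F Q_sub assms by auto
  have "near (act (inv\<^bsub>G\<^esub> h) (act h P)) (act (inv\<^bsub>G\<^esub> h) (act h' P'))"
    using assms PV act_subset by (intro near_act) auto
  then have "near P (act (inv\<^bsub>G\<^esub> h \<otimes>\<^bsub>G\<^esub> h') P')"
    using assms PV by (simp add: act_inv act_mult)
  then show ?thesis using assms by (auto simp: steps_def)
qed

lemma F_nonempty: obtains P where "P \<in> F"
  using nonempty Union_Q F(3) by blast

text \<open>The vertices covered by translates of representatives under the generated subgroup are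
  closed under adjacency, hence all of \<open>V\<close>. For \<open>h\<close> in \<open>H\<close>
  some such translate equals \<open>act h P0\<close>, so \<open>h\<close> differs from a generated
  element by one step.\<close>

lemma generate_steps: "generate G steps = H"
proof
  have sub: "steps \<subseteq> H" by (auto simp: steps_def)
  then show GH: "generate G steps \<subseteq> H" using generate_subgroup_incl[OF _ H] by simp
  show "H \<subseteq> generate G steps"
  proof
    fix h assume h: "h \<in> H"
    obtain P0 where P0: "P0 \<in> F" by (rule F_nonempty)
    define M where "M = {v. \<exists>h\<in>generate G steps. \<exists>P\<in>F. v \<in> act h P}"
    obtain u where u: "u \<in> P0" using Q_nonempty F P0 by blast
    have uV: "u \<in> V" using u P0 F Q_sub by auto
    have "\<phi> h u \<in> V" using h uV by simp
    from induces_connectedD[OF connected uV this]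
    have "\<phi> h u \<in> M"
    proof (rule joined_closed, goal_cases)
      case 1
      have "u \<in> act \<one>\<^bsub>G\<^esub> P0" using u act_one[of P0] Q_sub F P0 by auto
      then show ?case unfolding M_def using generate.one[of G steps] P0 by blast
    next
      case (2 y z)
      then obtain h1 P1 where h1: "h1 \<in> generate G steps" "P1 \<in> F" "y \<in> act h1 P1" by (auto simp: M_def)
      obtain P where P: "P \<in> Q" "z \<in> P" using 2 Union_Q by auto
      then obtain h2 P2 where h2: "h2 \<in> H" "P2 \<in> F" "P = act h2 P2" using F(3) by blast
      have "near (act h1 P1) (act h2 P2)" unfolding near_def using h1 2 P h2 by auto
      moreover have h1H: "h1 \<in> H" using h1 GH by auto
      ultimately have "inv\<^bsub>G\<^esub> h1 \<otimes>\<^bsub>G\<^esub> h2 \<in> steps" using near_steps h1 h2 by auto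
      then have "h1 \<otimes>\<^bsub>G\<^esub> (inv\<^bsub>G\<^esub> h1 \<otimes>\<^bsub>G\<^esub> h2) \<in> generate G steps"
        by (rule generate.eng[OF h1(1) generate.incl])
      then have "h2 \<in> generate G steps" using H_inv_mult[OF h1H h2(1)] by simp
      then show ?case unfolding M_def using h2 P by blast
    qed
    then obtain h1 P1 where h1: "h1 \<in> generate G steps" "P1 \<in> F" "\<phi> h u \<in> act h1 P1" by (auto simp: M_def)
    have h1H: "h1 \<in> H" using h1 GH by auto
    have "act h1 P1 = act h P0"
      using h1 h1H h P0 u F Q_act by (intro Q_disjoint) auto
    then have "near (act h1 P1) (act h P0)" by (simp add: near_def)
    then have "inv\<^bsub>G\<^esub> h1 \<otimes>\<^bsub>G\<^esub> h \<in> steps" by (rule near_steps[OF h1H h h1(2) P0])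
    then have "h1 \<otimes>\<^bsub>G\<^esub> (inv\<^bsub>G\<^esub> h1 \<otimes>\<^bsub>G\<^esub> h) \<in> generate G steps"
      by (rule generate.eng[OF h1(1) generate.incl])
    then show "h \<in> generate G steps" using H_inv_mult[OF h1H h] by simp
  qed
qed

lemma H_finitely_generated: "finitely_generated (G\<lparr>carrier := H\<rparr>)"
  unfolding finitely_generated_def generating_set_def
  using finite_steps generate_steps generate_consistent[OF _ H, of steps]
  by (intro exI[of _ steps]) (auto simp: steps_def)

text \<open>Take in every block a finite connected hull of the end points of its boundary edges.\<close>

lemma thin_subgraph:
  obtains U where "U \<subseteq> V" "induces_connected E U" "\<And>P. P \<in> Q \<Longrightarrow> finite (U \<inter> P)" "\<And>P. P \<in> Q \<Longrightarrow> U \<inter> P \<noteq> {}"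
proof -
  have "\<exists>K. finite K \<and> K \<noteq> {} \<and> P \<inter> \<Union> (boundary V E P) \<subseteq> K \<and> K \<subseteq> P \<and> induces_connected E K"
    if P: "P \<in> Q" for P
  proof -
    obtain p where "p \<in> P" using Q_nonempty[OF P] by auto
    then show ?thesis
      using finite_connected_hull[OF Q_connected[OF P], of "insert p (P \<inter> \<Union> (boundary V E P))"]
        finite_boundary_ends[OF P] by auto
  qed
  then obtain K where K: "\<And>P. P \<in> Q \<Longrightarrow> finite (K P) \<and> K P \<noteq> {} \<and> P \<inter> \<Union> (boundary V E P) \<subseteq> K P
      \<and> K P \<subseteq> P \<and> induces_connected E (K P)" by metis
  define U where "U = (\<Union>P\<in>Q. K P)"
  have UP: "U \<inter> P = K P" if P: "P \<in> Q" for P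
  proof
    show "K P \<subseteq> U \<inter> P" using K[OF P] P by (auto simp: U_def)
    show "U \<inter> P \<subseteq> K P"
    proof
      fix v assume v: "v \<in> U \<inter> P"
      then obtain P' where P': "P' \<in> Q" "v \<in> K P'" by (auto simp: U_def)
      then have "v \<in> P'" using K by auto
      then have "P' = P" using Q_disjoint[OF P'(1) P] v by auto
      then show "v \<in> K P" using P' by simp
    qed
  qed
  have UV: "U \<subseteq> V" using K Q_sub by (fastforce simp: U_def)
  have KU: "(a, b) \<in> joined E U" if "P \<in> Q" "a \<in> K P" "b \<in> K P" for P a b
  proof -
    have "(a, b) \<in> joined E (K P)" using K[OF that(1)] that by (auto intro: induces_connectedD)
    then show ?thesis by (rule joined_mono) (use that UP in auto)
  qed
  have "induces_connected E U"
    unfolding induces_connected_def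
  proof (intro ballI)
    fix a b assume ab: "a \<in> U" "b \<in> U"
    have "(a, b) \<in> joined E V" using ab UV by (intro induces_connectedD[OF connected]) auto
    \<comment> \<open>The invariant concerns the hull of the block containing \<open>v\<close>
      rather than \<open>v\<close>, since the path runs in \<open>V\<close> and may pass through
      vertices outside \<open>U\<close>.\<close>
    then have "b \<in> {v. \<forall>P\<in>Q. v \<in> P \<longrightarrow> (\<forall>w\<in>K P. (a, w) \<in> joined E U)}"
    proof (rule joined_closed, goal_cases)
      case 1
      have "(a, w) \<in> joined E U" if "P \<in> Q" "a \<in> P" "w \<in> K P" for P w
      proof -
        have "a \<in> K P" using that ab UP by blast
        then show ?thesis using KU that by blast
      qed
      then show ?case by blast
    next
      case (2 y z)
      have "(a, w) \<in> joined E U" if P: "P \<in> Q" "z \<in> P" "w \<in> K P" for P w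
      proof -
        obtain P' where P': "P' \<in> Q" "y \<in> P'" using 2 Union_Q by auto
        have IH: "(a, w) \<in> joined E U" if "w \<in> K P'" for w using 2(1) P' that by blast
        show ?thesis
        proof (cases "P' = P")
          case True then show ?thesis using IH P by simp
        next
          case False
          \<comment> \<open>An edge between different blocks is a boundary edge of both, so its ends
            lie in the two hulls and the edge survives in \<open>U\<close>.\<close>
          then have "z \<notin> P'" "y \<notin> P" using Q_disjoint[OF P'(1) P(1)] P P' by auto
          moreover have "{z, y} \<in> E" using 2 by (simp add: insert_commute)
          ultimately have "{y, z} \<in> boundary V E P'" "{z, y} \<in> boundary V E P"
            using 2 P P' by (auto intro: boundaryI)
          then have "y \<in> P' \<inter> \<Union> (boundary V E P')" "z \<in> P \<inter> \<Union> (boundary V E P)" using P P' by auto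
          then have yz: "y \<in> K P'" "z \<in> K P" using K P P' by blast+
          then have "(y, z) \<in> joined E U" using 2 P P' UP by (intro joined_step) auto
          then show ?thesis using IH[OF yz(1)] KU[OF P(1) yz(2) P(3)] by (meson joined_trans)
        qed
      qed
      then show ?case by blast
    qed
    moreover obtain P where "P \<in> Q" "b \<in> K P" using ab by (auto simp: U_def)
    ultimately show "(a, b) \<in> joined E U" using K by blast
  qed
  then show thesis using UV UP K by (intro that[of U]) auto
qed

text \<open>The almost invariant set becomes a vertex set \<open>W\<close> with finite boundary and
  infinitely many blocks on either side. The path is drawn in the thin subgraph, which keeps it
  finite in every block, while the separating cut is taken in the whole graph.\<close>

lemma separated_path:
  assumes ends: "group_more_than_one_end (G\<lparr>carrier := H\<rparr>)"
  obtains \<alpha> where "biinfinite_path V E \<alpha>" "cuts_of V E \<alpha> \<noteq> {}" "\<And>P. P \<in> Q \<Longrightarrow> finite (range \<alpha> \<inter> P)"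
proof -
  obtain A where A: "A \<subseteq> H" "infinite A" "infinite (H - A)"
    "\<And>t. t \<in> H \<Longrightarrow> finite {h \<in> A. h \<otimes>\<^bsub>G\<^esub> t \<notin> A}"
    using almost_invariant_set[OF H ends] by blast
  have stepsH: "steps \<subseteq> H" by (auto simp: steps_def)
  have finZ: "finite {h \<in> A. h \<otimes>\<^bsub>G\<^esub> s \<notin> A}" if "s \<in> steps" for s using A(4) that stepsH by auto
  define W where "W = (\<Union>h\<in>A. \<Union>P\<in>F. act h P)"
  have AFQ: "act h P \<in> Q" if "h \<in> A" "P \<in> F" for h P using Q_act[of h P] A(1) F(2) that by auto
  have W_iff: "v \<in> W \<longleftrightarrow> (\<exists>h\<in>A. \<exists>P\<in>F. v \<in> act h P)" for v by (simp add: W_def)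
  have WV: "W \<subseteq> V" using AFQ Q_sub W_iff by blast
  \<comment> \<open>An edge leaving \<open>W\<close> passes from a block of some \<open>h\<close> in
    \<open>A\<close> to one of some \<open>h'\<close> outside \<open>A\<close>. The two differ by a
    right factor in \<open>steps\<close>, so almost invariance leaves finitely many choices for
    \<open>h\<close>.\<close>
  have "boundary V E W \<subseteq> (\<Union>s\<in>steps. \<Union>h\<in>{h \<in> A. h \<otimes>\<^bsub>G\<^esub> s \<notin> A}. \<Union>P\<in>F. boundary V E (act h P))"
  proof
    fix e assume "e \<in> boundary V E W"
    then obtain u v where uv: "e = {u, v}" "{u, v} \<in> E" "u \<in> W" "u \<in> V" "v \<in> V" "v \<notin> W"
      using WV by (rule boundary_ends)
    then obtain h P where h: "h \<in> A" "P \<in> F" "u \<in> act h P" unfolding W_iff by blast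
    obtain P'' where "P'' \<in> Q" "v \<in> P''" using uv Union_Q by auto
    then obtain h' P' where h': "h' \<in> H" "P' \<in> F" "v \<in> act h' P'" using F(3) by blast
    have hH: "h \<in> H" using h A by auto
    have "h' \<notin> A" using uv(6) h' unfolding W_iff by blast
    have "near (act h P) (act h' P')" unfolding near_def using h h' uv by auto
    then have "inv\<^bsub>G\<^esub> h \<otimes>\<^bsub>G\<^esub> h' \<in> steps" using near_steps hH h h' by auto
    moreover have "h \<otimes>\<^bsub>G\<^esub> (inv\<^bsub>G\<^esub> h \<otimes>\<^bsub>G\<^esub> h') \<notin> A" using H_inv_mult[OF hH h'(1)] \<open>h' \<notin> A\<close> by simp
    moreover have "e \<in> boundary V E (act h P)"
      using uv h unfolding uv(1) W_iff by (intro boundaryI) blast+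
    ultimately show "e \<in> (\<Union>s\<in>steps. \<Union>h\<in>{h \<in> A. h \<otimes>\<^bsub>G\<^esub> s \<notin> A}. \<Union>P\<in>F. boundary V E (act h P))"
      using h by blast
  qed
  moreover have "finite (\<Union>s\<in>steps. \<Union>h\<in>{h \<in> A. h \<otimes>\<^bsub>G\<^esub> s \<notin> A}. \<Union>P\<in>F. boundary V E (act h P))"
    using finite_steps finZ F(1) AFQ by (intro finite_UN_I Q_boundary) auto
  ultimately have finW: "finite (boundary V E W)" by (rule finite_subset)
  obtain P0 where P0: "P0 \<in> F" by (rule F_nonempty)
  have P0Q: "P0 \<in> Q" using P0 F by auto
  \<comment> \<open>Block transporters are finite, so infinitely many group elements produce
    infinitely many blocks.\<close>
  have many: "infinite ((\<lambda>h. act h P0) ` B)" if B: "B \<subseteq> H" "infinite B" for B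
  proof
    assume fin: "finite ((\<lambda>h. act h P0) ` B)"
    have "B \<subseteq> (\<Union>P\<in>(\<lambda>h. act h P0) ` B. {h \<in> H. act h P0 = P})" using B by auto
    moreover have "finite (\<Union>P\<in>(\<lambda>h. act h P0) ` B. {h \<in> H. act h P0 = P})"
      using fin B P0Q Q_act by (intro finite_UN_I Q_transporter) auto
    ultimately show False using B finite_subset by blast
  qed
  obtain U where U: "U \<subseteq> V" "induces_connected E U" "\<And>P. P \<in> Q \<Longrightarrow> finite (U \<inter> P)" "\<And>P. P \<in> Q \<Longrightarrow> U \<inter> P \<noteq> {}"
    using thin_subgraph by blast
  have infU: "infinite (U \<inter> Y)" if B: "B \<subseteq> H" "infinite B" "\<And>h. h \<in> B \<Longrightarrow> act h P0 \<subseteq> Y" for B Y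
  proof
    assume fin: "finite (U \<inter> Y)"
    have "(\<lambda>h. act h P0) ` B \<subseteq> (\<Union>v\<in>U \<inter> Y. {P \<in> Q. v \<in> P})"
    proof (rule image_subsetI)
      fix h assume h: "h \<in> B"
      then have "act h P0 \<in> Q" using B P0Q Q_act by auto
      moreover from this obtain v where "v \<in> U" "v \<in> act h P0" using U(4) by blast
      ultimately show "act h P0 \<in> (\<Union>v\<in>U \<inter> Y. {P \<in> Q. v \<in> P})" using B(3)[OF h] by blast
    qed
    then have "finite ((\<lambda>h. act h P0) ` B)" by (rule finite_subset) (intro finite_UN_I fin finite_block_at)
    with many[OF B(1,2)] show False by simp
  qed
  have inW: "infinite (U \<inter> W)" by (rule infU[OF A(1,2)]) (use P0 W_iff in blast)
  have outW: "infinite (U \<inter> (V - W))"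
  proof (rule infU)
    \<comment> \<open>For \<open>h\<close> outside \<open>A\<close> the block
      \<open>act h P0\<close> may still lie in \<open>W\<close>, being equal to a block of some
      \<open>h'\<close> in \<open>A\<close>. Such an \<open>h\<close> arises from \<open>h'\<close>
      by one step out of \<open>A\<close>, so these finitely many exceptions are discarded.\<close>
    let ?N = "\<Union>s\<in>steps. (\<lambda>h. h \<otimes>\<^bsub>G\<^esub> s) ` {h \<in> A. h \<otimes>\<^bsub>G\<^esub> s \<notin> A}"
    show "(H - A) - ?N \<subseteq> H" by auto
    have "finite ?N" using finite_steps finZ by auto
    then show "infinite ((H - A) - ?N)" using A(3) by simp
    fix h assume h: "h \<in> (H - A) - ?N"
    have hQ: "act h P0 \<in> Q" using h P0Q Q_act by auto
    have "act h P0 \<inter> W = {}"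
    proof (rule ccontr)
      assume "act h P0 \<inter> W \<noteq> {}"
      then obtain h' P' where h': "h' \<in> A" "P' \<in> F" "act h' P' \<inter> act h P0 \<noteq> {}"
        unfolding W_def by blast
      then have h'H: "h' \<in> H" using A by auto
      then have "act h' P' = act h P0" using hQ AFQ h' by (intro Q_disjoint)
      then have "near (act h' P') (act h P0)" by (simp add: near_def)
      then have "inv\<^bsub>G\<^esub> h' \<otimes>\<^bsub>G\<^esub> h \<in> steps" using near_steps[OF h'H _ h'(2) P0] h by simp
      moreover have "h = h' \<otimes>\<^bsub>G\<^esub> (inv\<^bsub>G\<^esub> h' \<otimes>\<^bsub>G\<^esub> h)" using H_inv_mult[OF h'H] h by simp
      ultimately have "h \<in> ?N" using h h' by fastforce
      then show False using h by auto
    qed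
    then show "act h P0 \<subseteq> V - W" using Q_sub[OF hQ] by auto
  qed
  have "boundary U E (U \<inter> W) \<subseteq> boundary V E W"
    unfolding boundary_def using U(1) by blast
  then have finUW: "finite (boundary U E (U \<inter> W))" using finW finite_subset by auto
  have lfU: "locally_finite U E" using locally_finite U(1) by (auto simp: locally_finite_def)
  have "U - U \<inter> W = U \<inter> (V - W)" using U(1) by auto
  then obtain \<alpha> where \<alpha>: "biinfinite_path U E \<alpha>" "infinite (range \<alpha> \<inter> (U \<inter> W))" "infinite (range \<alpha> \<inter> (U \<inter> (V - W)))"
    using biinfinite_path_across[OF U(2) lfU _ finUW inW] outW by (metis Int_lower1)
  have ran: "range \<alpha> \<subseteq> U" using \<alpha>(1) by (simp add: biinfinite_path_def)
  have path: "biinfinite_path V E \<alpha>" using \<alpha>(1) U(1) by (auto simp: biinfinite_path_def)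
  have i1: "infinite (range \<alpha> \<inter> W)" by (rule infinite_super[OF _ \<alpha>(2)]) auto
  have i2: "infinite (range \<alpha> \<inter> (V - W))" by (rule infinite_super[OF _ \<alpha>(3)]) auto
  obtain C where "cut V E C" "infinite (range \<alpha> \<inter> C)" "infinite (range \<alpha> \<inter> (V - C))"
    using separating_cut[OF connected WV finW i1 i2] by metis
  then have "C \<in> cuts_of V E \<alpha>" by (auto simp: cuts_of_def)
  moreover have "finite (range \<alpha> \<inter> P)" if "P \<in> Q" for P
    by (rule finite_subset[OF _ U(3)[OF that]]) (use ran in auto)
  ultimately show thesis using path that by blast
qed

end

section \<open>Vertex stabilizers of the structure tree\<close>

context accessible_action
begin

text \<open>Compare \<open>C\<close> with one member of \<open>x\<close>. If the complement of that
  member lies strictly inside \<open>C\<close> or \<open>V - C\<close>, an optimal cut covering it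
  there is also a member of \<open>x\<close>, and the complement of this new member contains the
  other side of \<open>C\<close>.\<close>

lemma opt_cut_side:
  assumes x: "x \<in> verts T" and C: "C \<in> opts"
  obtains D where "D \<in> x" "C \<subseteq> V - D \<or> V - C \<subseteq> V - D"
proof -
  obtain D where D: "D \<in> opts" "x = opt_class D" using x by (rule vertsE)
  have Dx: "D \<in> x" using D by (simp add: opt_equiv_iff)
  have pos: "\<exists>D'\<in>x. V - F \<subseteq> V - D'" if F: "F \<in> opts" "V - D \<subset> F" for F
  proof -
    obtain D' where "D' \<in> opts" "covers (V - D) D'" "D' \<subseteq> F"
      using covering_above[OF opt_cuts_compl[OF D(1)] F] by metis
    then show ?thesis using D by (intro bexI[of _ D']) (auto simp: opt_equiv_iff)
  qed
  have CV: "V - (V - C) = C" "C \<subseteq> V" using opt_cut_props[OF C] by auto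
  consider "C \<subseteq> V - D" | "V - C \<subseteq> V - D" | "V - D \<subset> C" | "V - D \<subset> V - C"
    using opt_cuts_nested[OF C D(1)] opt_cut_props(1)[OF D(1)] CV(2) unfolding nested_def by blast
  then show thesis
  proof cases
    case 1 then show ?thesis using that[OF Dx] by blast
  next
    case 2 then show ?thesis using that[OF Dx] by blast
  next
    case 3 then show ?thesis using pos[OF C] that by blast
  next
    case 4
    then obtain D' where "D' \<in> x" "V - (V - C) \<subseteq> V - D'" using pos[OF opt_cuts_compl[OF C]] by blast
    then show ?thesis using that[of D'] CV by auto
  qed
qed

text \<open>Read as disjointness of \<open>V - C\<close> and \<open>V - D\<close>, this is what
  allows the complements to be contracted separately.\<close>

lemma class_members_cover:
  assumes "x \<in> verts T" "C \<in> x" "D \<in> x" "C \<noteq> D"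
  shows "V - C \<subset> D"
proof -
  obtain B where B: "x = opt_class B" using assms(1) by (rule vertsE)
  then have "(C, D) \<in> opt_equiv V E k"
    using equiv_opt_equiv assms by (meson Image_singleton_iff equiv_def symE transE)
  then show ?thesis using assms(4) by (auto simp: opt_equiv_iff covers_def)
qed

lemma class_memberI:
  assumes "x \<in> verts T" "C \<in> x" "(C, D) \<in> opt_equiv V E k" shows "D \<in> x"
proof -
  obtain B where B: "x = opt_class B" using assms(1) by (rule vertsE)
  then show ?thesis using equiv_opt_equiv assms by (meson Image_singleton_iff equiv_def transE)
qed

lemma verts_disjoint: "x \<in> verts T \<Longrightarrow> y \<in> verts T \<Longrightarrow> C \<in> x \<Longrightarrow> C \<in> y \<Longrightarrow> x = y"
  using quotient_disj[OF equiv_opt_equiv] by (auto simp: T_simps)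

text \<open>An edge on the path between two distinct tree vertices puts the cores of the two vertices on
  different sides of a cut.\<close>

lemma core_unique:
  assumes x: "x \<in> verts T" and y: "y \<in> verts T" and u: "u \<in> V" "\<And>D. D \<in> x \<Longrightarrow> u \<in> D" "\<And>D. D \<in> y \<Longrightarrow> u \<in> D"
  shows "x = y"
proof (rule ccontr)
  assume ne: "x \<noteq> y"
  have main: False
    if z: "z \<in> verts T" "w \<in> verts T" "\<And>D. D \<in> z \<Longrightarrow> u \<in> D" "\<And>D. D \<in> w \<Longrightarrow> u \<in> D"
      and CF: "C \<in> z" "F \<in> w" "C \<subset> F" for z w C F
  proof -
    have O: "C \<in> opts" "F \<in> opts" using verts_cut CF z by blast+
    \<comment> \<open>A cut just below \<open>F\<close> supplies the separating edge: its complement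
      is a member of \<open>w\<close> but misses \<open>C\<close>, which contains
      \<open>u\<close>.\<close>
    obtain D where D: "D \<in> opts" "covers D F" "C \<subseteq> D" using covering_below[OF O CF(3)] .
    have "covers (V - F) (V - D)" using covers_compl[OF D(1) O(2) D(2)] .
    then have "(F, V - D) \<in> opt_equiv V E k" using O opt_cuts_compl[OF D(1)] by (simp add: opt_equiv_iff)
    then have "V - D \<in> w" using class_memberI[OF z(2) CF(2)] by simp
    then show False using z(3)[OF CF(1)] z(4) D(3) by auto
  qed
  obtain C where C: "C \<in> opts" "x = opt_class C" using x by (rule vertsE)
  obtain F where F: "F \<in> opts" "y = opt_class F" using y by (rule vertsE)
  have Cx: "C \<in> x" "F \<in> y" using C F by (simp_all add: opt_equiv_iff)
  have uC: "u \<in> C" "u \<in> F" using u Cx by auto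
  have CF: "C \<noteq> F" using verts_disjoint[OF x y] Cx ne by auto
  consider "C \<subset> F" | "F \<subset> C" | "V - C \<subset> F" | "V - C = F"
    using opt_cuts_nested[OF C(1) F(1)] opt_cut_props(1)[OF C(1)] opt_cut_props(1)[OF F(1)] uC CF
    unfolding nested_def by blast
  then show False
  proof cases
    case 1 then show ?thesis using main[OF x y u(2,3) Cx] by simp
  next
    case 2 then show ?thesis using main[OF y x u(3,2) Cx(2,1)] by simp
  next
    \<comment> \<open>A member of \<open>x\<close> covering \<open>V - C\<close> below
      \<open>F\<close> replaces \<open>C\<close>, which reduces to strict inclusion.\<close>
    case 3
    then obtain D where D: "D \<in> opts" "covers (V - C) D" "D \<subseteq> F"
      using covering_above[OF opt_cuts_compl[OF C(1)] F(1)] by metis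
    then have Dx: "D \<in> x" using C by (simp add: opt_equiv_iff)
    then have "D \<noteq> F" using verts_disjoint[OF x y] Cx ne by auto
    then show ?thesis using main[OF x y u(2,3) Dx Cx(2)] D(3) by auto
  next
    case 4 then show ?thesis using uC by auto
  qed
qed

text \<open>Each representative whose orbit meets \<open>S\<close> is replaced by a point of
  \<open>S\<close> in that orbit. The group elements obtained carry points of \<open>S\<close> to
  points of \<open>S\<close>; for suitable \<open>S\<close> this forces them into a
  stabilizer.\<close>

lemma restricted_representatives:
  assumes R: "finite R" and S: "\<And>s. s \<in> S \<Longrightarrow> \<exists>r\<in>R. \<exists>g\<in>carrier G. s = f g r"
    and diff: "\<And>g h r. g \<in> carrier G \<Longrightarrow> h \<in> carrier G \<Longrightarrow> r \<in> R \<Longrightarrow>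
      f (g \<otimes>\<^bsub>G\<^esub> inv\<^bsub>G\<^esub> h) (f h r) = f g r"
  obtains F where "finite F" "F \<subseteq> S" "\<And>s. s \<in> S \<Longrightarrow> \<exists>s'\<in>F. \<exists>g\<in>carrier G. s = f g s'"
proof -
  define R' where "R' = {r \<in> R. \<exists>h\<in>carrier G. f h r \<in> S}"
  have "\<forall>r\<in>R'. \<exists>h. h \<in> carrier G \<and> f h r \<in> S" by (auto simp: R'_def)
  then obtain h where h: "\<And>r. r \<in> R' \<Longrightarrow> h r \<in> carrier G \<and> f (h r) r \<in> S" by metis
  show thesis
  proof (rule that[of "(\<lambda>r. f (h r) r) ` R'"])
    show "finite ((\<lambda>r. f (h r) r) ` R')" using R by (simp add: R'_def)
    show "(\<lambda>r. f (h r) r) ` R' \<subseteq> S" using h by auto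
    fix s assume s: "s \<in> S"
    then obtain r g where r: "r \<in> R" "g \<in> carrier G" "s = f g r" using S by blast
    then have rR: "r \<in> R'" using s by (auto simp: R'_def)
    then have "s = f (g \<otimes>\<^bsub>G\<^esub> inv\<^bsub>G\<^esub> h r) (f (h r) r)" using diff[of g "h r" r] h r by simp
    moreover have "g \<otimes>\<^bsub>G\<^esub> inv\<^bsub>G\<^esub> h r \<in> carrier G" using h[OF rR] r by simp
    ultimately show "\<exists>s'\<in>(\<lambda>r. f (h r) r) ` R'. \<exists>g\<in>carrier G. s = f g s'" using rR by blast
  qed
qed

section \<open>Contraction at a tree vertex\<close>

lemma vertex_stabilizer_iff:
  assumes "x \<in> verts T"
  shows "g \<in> stabilizer G \<psi> x \<longleftrightarrow> g \<in> carrier G \<and> act g ` x = x"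
  using assms by (simp add: stabilizer_def tree_vertex_action_def)

lemma act_verts: "g \<in> carrier G \<Longrightarrow> x \<in> verts T \<Longrightarrow> act g ` x \<in> verts T"
  using group_action.element_image[OF vertex_action, of g x] by (simp add: tree_vertex_action_def)

text \<open>The vertices of the core, which belong to every member of \<open>x\<close>, remain as
  singletons, so that the blocks partition \<open>V\<close>.\<close>

definition blocks :: "'v set set \<Rightarrow> 'v set set" where
  "blocks x = {V - D | D. D \<in> x} \<union> {{u} | u. u \<in> V \<and> (\<forall>D\<in>x. u \<in> D)}"

text \<open>An element carrying a member of \<open>x\<close> to a member of \<open>x\<close>
  stabilizes \<open>x\<close>, because distinct tree vertices are disjoint classes; one carrying a
  core vertex to a core vertex does so by \<open>core_unique\<close>. Finiteness of orbits thus
  passes from \<open>G\<close> to the stabilizer.\<close>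

lemma block_representatives:
  assumes x: "x \<in> verts T"
  obtains F where "finite F" "F \<subseteq> blocks x"
    "\<And>P. P \<in> blocks x \<Longrightarrow> \<exists>P'\<in>F. \<exists>h\<in>stabilizer G \<psi> x. P = act h P'"
proof -
  obtain R where R: "R \<subseteq> opts" "finite R" "\<And>C. C \<in> opts \<Longrightarrow> \<exists>D\<in>R. \<exists>g\<in>carrier G. C = act g D"
    using opt_cut_representatives by metis
  obtain F1 where F1: "finite F1" "F1 \<subseteq> x" "\<And>D. D \<in> x \<Longrightarrow> \<exists>D'\<in>F1. \<exists>g\<in>carrier G. D = act g D'"
  proof (rule restricted_representatives[OF R(2), of x "\<lambda>g. act g"])
    show "\<exists>r\<in>R. \<exists>g\<in>carrier G. D = act g r" if "D \<in> x" for D using R(3) verts_cut[OF x that] by blast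
    show "act (g \<otimes>\<^bsub>G\<^esub> inv\<^bsub>G\<^esub> h) (act h r) = act g r" if "g \<in> carrier G" "h \<in> carrier G" "r \<in> R" for g h r
    proof -
      have "r \<subseteq> V" using R(1) that(3) opt_cut_props(1) by auto
      then show ?thesis using that act_mult[of g "inv\<^bsub>G\<^esub> h" "act h r"] act_inv act_subset by simp
    qed
  qed blast
  obtain Rv where Rv: "Rv \<subseteq> V" "finite Rv" "\<And>v. v \<in> V \<Longrightarrow> \<exists>r\<in>Rv. \<exists>g\<in>carrier G. v = \<phi> g r"
    using orbit_representatives[OF finite_vertex_orbits vertex_one is_group] by metis
  let ?core = "{u \<in> V. \<forall>D\<in>x. u \<in> D}"
  obtain F2 where F2: "finite F2" "F2 \<subseteq> ?core" "\<And>v. v \<in> ?core \<Longrightarrow> \<exists>v'\<in>F2. \<exists>g\<in>carrier G. v = \<phi> g v'"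
  proof (rule restricted_representatives[OF Rv(2), of ?core \<phi>])
    show "\<exists>r\<in>Rv. \<exists>g\<in>carrier G. v = \<phi> g r" if "v \<in> ?core" for v using Rv(3) that by blast
    show "\<phi> (g \<otimes>\<^bsub>G\<^esub> inv\<^bsub>G\<^esub> h) (\<phi> h r) = \<phi> g r" if "g \<in> carrier G" "h \<in> carrier G" "r \<in> Rv" for g h r
      using that Rv(1) composition_rule[of "\<phi> h r" g "inv\<^bsub>G\<^esub> h"] by auto
  qed blast
  have xV: "D \<in> x \<Longrightarrow> D \<subseteq> V" for D using verts_cut[OF x] opt_cut_props(1) by blast
  show thesis
  proof (rule that[of "(\<lambda>D. V - D) ` F1 \<union> (\<lambda>u. {u}) ` F2"])
    show "finite ((\<lambda>D. V - D) ` F1 \<union> (\<lambda>u. {u}) ` F2)" using F1 F2 by simp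
    have "V - D \<in> blocks x" if "D \<in> F1" for D using that F1(2) by (auto simp: blocks_def)
    moreover have "{u} \<in> blocks x" if "u \<in> F2" for u using subsetD[OF F2(2) that] by (simp add: blocks_def)
    ultimately show "(\<lambda>D. V - D) ` F1 \<union> (\<lambda>u. {u}) ` F2 \<subseteq> blocks x" by blast
    fix P assume "P \<in> blocks x"
    then consider D where "D \<in> x" "P = V - D" | u where "u \<in> ?core" "P = {u}" by (auto simp: blocks_def)
    then show "\<exists>P'\<in>(\<lambda>D. V - D) ` F1 \<union> (\<lambda>u. {u}) ` F2. \<exists>h\<in>stabilizer G \<psi> x. P = act h P'"
    proof cases
      case 1
      then obtain D' g where D': "D' \<in> F1" "g \<in> carrier G" "D = act g D'" using F1(3) by blast
      have D'x: "D' \<in> x" using D' F1 by auto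
      have "act g ` x = x"
        using verts_disjoint[OF act_verts[OF D'(2) x] x, of D] 1 D' D'x by auto
      then have "g \<in> stabilizer G \<psi> x" using vertex_stabilizer_iff[OF x] D' by simp
      moreover have "P = act g (V - D')" using 1 D' act_compl[OF D'(2) xV[OF D'x]] by simp
      ultimately show ?thesis using D'(1) by blast
    next
      case 2
      then obtain u' g where u': "u' \<in> F2" "g \<in> carrier G" "u = \<phi> g u'" using F2(3) by blast
      have "act g ` x = x"
        by (rule core_unique[OF act_verts[OF u'(2) x] x, of u]) (use 2 u' F2 in auto)
      then have "g \<in> stabilizer G \<psi> x" using vertex_stabilizer_iff[OF x] u' by simp
      moreover have "P = act g {u'}" using 2 u' by simp
      ultimately show ?thesis using u'(1) by blast
    qed
  qed
qed

lemma vertex_boundary_finite: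
  assumes "u \<in> V" shows "finite (boundary V E {u})"
proof (rule finite_subset)
  show "boundary V E {u} \<subseteq> (\<lambda>v. {u, v}) ` {v. {v, u} \<in> E}" by (auto simp: boundary_def insert_commute)
  show "finite ((\<lambda>v. {u, v}) ` {v. {v, u} \<in> E})" using locally_finite assms by (simp add: locally_finite_def)
qed

lemma block_system_of_vertex:
  assumes x: "x \<in> verts T"
  obtains F where "block_system V E G \<phi> (stabilizer G \<psi> x) (blocks x) F"
proof -
  obtain F where F: "finite F" "F \<subseteq> blocks x"
    "\<And>P. P \<in> blocks x \<Longrightarrow> \<exists>P'\<in>F. \<exists>h\<in>stabilizer G \<psi> x. P = act h P'"
    using block_representatives[OF x] by metis
  obtain C where C: "C \<in> opts" using x by (rule vertsE)
  have xO: "D \<in> x \<Longrightarrow> D \<in> opts" for D using verts_cut[OF x] .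
  note xV = opt_cut_props(1)[OF xO]
  have stab: "g \<in> stabilizer G \<psi> x \<Longrightarrow> g \<in> carrier G \<and> act g ` x = x" for g
    using vertex_stabilizer_iff[OF x] by simp
  have block_bdry: "finite (boundary V E P)" if "P \<in> blocks x" for P
  proof -
    have "finite (boundary V E (V - D))" if "D \<in> x" for D
      using that opt_boundary(2)[OF xO] boundary_compl[OF xV] by metis
    then show ?thesis using that vertex_boundary_finite by (auto simp: blocks_def)
  qed
  have "block_system V E G \<phi> (stabilizer G \<psi> x) (blocks x) F"
  proof (intro block_system.intro graph_action_axioms block_system_axioms.intro)
    show "induces_connected E V" "locally_finite V E" by (fact connected locally_finite)+
    show "V \<noteq> {}" using opt_cut_props(1,2)[OF C] by auto
    show "subgroup (stabilizer G \<psi> x) G" by (rule group_action.stabilizer_subgroup[OF vertex_action x])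
    show "\<Union> (blocks x) = V"
    proof
      show "\<Union> (blocks x) \<subseteq> V" by (auto simp: blocks_def)
      show "V \<subseteq> \<Union> (blocks x)"
      proof
        fix u assume u: "u \<in> V"
        show "u \<in> \<Union> (blocks x)"
        proof (cases "\<forall>D\<in>x. u \<in> D")
          case True
          then have "{u} \<in> blocks x" using u by (auto simp: blocks_def)
          then show ?thesis by blast
        next
          case False
          then obtain D where "D \<in> x" "u \<in> V - D" using u by blast
          moreover from this have "V - D \<in> blocks x" by (auto simp: blocks_def)
          ultimately show ?thesis by blast
        qed
      qed
    qed
    show "finite F" "F \<subseteq> blocks x" by (fact F)+
  next
    fix P P' assume P: "P \<in> blocks x" "P' \<in> blocks x" "P \<inter> P' \<noteq> {}"
    have "V - D = V - D'" if "D \<in> x" "D' \<in> x" "(V - D) \<inter> (V - D') \<noteq> {}" for D D'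
      using class_members_cover[OF x that(1,2)] that(3) by blast
    with P show "P = P'" by (auto simp: blocks_def)
  next
    fix P assume P: "P \<in> blocks x"
    show "P \<noteq> {}" using P opt_cut_props(3)[OF xO] by (auto simp: blocks_def)
    have "induces_connected E (V - D)" if "D \<in> x" for D using opt_cut_cut[OF xO[OF that]] by (simp add: cut_def)
    then show "induces_connected E P" using P by (auto simp: blocks_def induces_connected_def joined_refl)
    show "finite (boundary V E P)" by (rule block_bdry[OF P])
    show "\<exists>P'\<in>F. \<exists>h\<in>stabilizer G \<psi> x. P = act h P'" by (rule F(3)[OF P])
  next
    fix h P assume h: "h \<in> stabilizer G \<psi> x" and P: "P \<in> blocks x"
    note h' = stab[OF h]
    show "act h P \<in> blocks x"
      using P
      unfolding blocks_def
    proof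
      assume "P \<in> {V - D | D. D \<in> x}"
      then obtain D where D: "D \<in> x" "P = V - D" by blast
      then have "act h P = V - act h D" "act h D \<in> x" using act_compl[of h D] h' xV by auto
      then show "act h P \<in> {V - D |D. D \<in> x} \<union> {{u} |u. u \<in> V \<and> (\<forall>D\<in>x. u \<in> D)}" by blast
    next
      assume "P \<in> {{u} | u. u \<in> V \<and> (\<forall>D\<in>x. u \<in> D)}"
      then obtain u where u: "u \<in> V" "\<forall>D\<in>x. u \<in> D" "P = {u}" by blast
      have "\<phi> h u \<in> D" if D: "D \<in> x" for D
      proof -
        have "D \<in> act h ` x" using D h' by simp
        then show ?thesis using u by auto
      qed
      moreover have "\<phi> h u \<in> V" using h' u by simp
      ultimately show "act h P \<in> {V - D |D. D \<in> x} \<union> {{u} |u. u \<in> V \<and> (\<forall>D\<in>x. u \<in> D)}" using u by auto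
    qed
  next
    fix P P' assume P: "P \<in> blocks x" "P' \<in> blocks x"
    have "finite {g \<in> carrier G. act g P = P'}"
      using P(1) unfolding blocks_def
    proof
      assume "P \<in> {V - D | D. D \<in> x}"
      then obtain D where D: "D \<in> x" "P = V - D" by blast
      have "boundary V E P \<noteq> {}" using D opt_boundary(1)[OF xO] boundary_compl[OF xV] by metis
      then show ?thesis using finite_set_transporter[OF _ _ block_bdry[OF P(2)]] D by auto
    next
      assume "P \<in> {{u} | u. u \<in> V \<and> (\<forall>D\<in>x. u \<in> D)}"
      then obtain u where u: "u \<in> V" "P = {u}" by blast
      \<comment> \<open>If some \<open>g\<close> maps \<open>{u}\<close> onto \<open>P'\<close>,
        then \<open>P'\<close> is a singleton and \<open>the_elem P'\<close> is the image of
        \<open>u\<close>; otherwise the left set is empty.\<close>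
      have "{g \<in> carrier G. act g P = P'} \<subseteq> {g \<in> carrier G. \<phi> g u = the_elem P'}" using u by auto
      then show ?thesis using finite_vertex_transporter[OF u(1)] by (rule finite_subset)
    qed
    then show "finite {h \<in> stabilizer G \<psi> x. act h P = P'}"
      by (rule rev_finite_subset) (use stab in auto)
  qed
  then show thesis by (rule that)
qed

text \<open>Finite generation belongs to the claim: \<open>group_more_than_one_end\<close> asks for
  a finite generating set, so its negation alone would hold trivially for a group without
  one.\<close>

theorem vertex_stabilizer_ends:
  assumes x: "x \<in> verts T"
  shows "finitely_generated (G\<lparr>carrier := stabilizer G \<psi> x\<rparr>)"
    and "\<not> group_more_than_one_end (G\<lparr>carrier := stabilizer G \<psi> x\<rparr>)"
proof -
  obtain F where "block_system V E G \<phi> (stabilizer G \<psi> x) (blocks x) F"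
    using block_system_of_vertex[OF x] .
  then interpret B: block_system V E G \<phi> "stabilizer G \<psi> x" "blocks x" F .
  show "finitely_generated (G\<lparr>carrier := stabilizer G \<psi> x\<rparr>)" by (rule B.H_finitely_generated)
  show "\<not> group_more_than_one_end (G\<lparr>carrier := stabilizer G \<psi> x\<rparr>)"
  proof
    assume "group_more_than_one_end (G\<lparr>carrier := stabilizer G \<psi> x\<rparr>)"
    then obtain \<alpha> where \<alpha>: "biinfinite_path V E \<alpha>" "cuts_of V E \<alpha> \<noteq> {}"
      "\<And>P. P \<in> blocks x \<Longrightarrow> finite (range \<alpha> \<inter> P)" using B.separated_path by blast
    then obtain C where C: "C \<in> opt_cuts_of V E k \<alpha>" using opt_cut_exists by blast
    then have CO: "C \<in> opts" using \<alpha>(1) by (auto simp: opt_cuts_def)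
    have inf: "infinite (range \<alpha> \<inter> C)" "infinite (range \<alpha> \<inter> (V - C))"
      using C by (auto simp: opt_cuts_of_iff min_cuts_of_iff cuts_of_def)
    obtain D where D: "D \<in> x" "C \<subseteq> V - D \<or> V - C \<subseteq> V - D" using opt_cut_side[OF x CO] .
    have fin: "finite (range \<alpha> \<inter> (V - D))" using \<alpha>(3)[of "V - D"] D(1) by (auto simp: blocks_def)
    from D(2) show False
    proof
      assume "C \<subseteq> V - D"
      then have "range \<alpha> \<inter> C \<subseteq> range \<alpha> \<inter> (V - D)" by auto
      then show False using inf(1) fin finite_subset by metis
    next
      assume "V - C \<subseteq> V - D"
      then have "range \<alpha> \<inter> (V - C) \<subseteq> range \<alpha> \<inter> (V - D)" by auto
      then show False using inf(2) fin finite_subset by metis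
    qed
  qed
qed

end

text \<open>Finiteness of a quotient graph is expressed by finitely many vertex orbits and finitely
  many edge orbits. Edge stabilizers are bounded in both readings, for arcs and for unoriented edges
  that may be inverted.\<close>

theorem theorem7p4:
  fixes G :: "('g, 'm) monoid_scheme"
    and V :: "'v set" and E :: "'v set set"
    and \<phi> :: "'g \<Rightarrow> 'v \<Rightarrow> 'v"
    and k :: nat
  defines "T \<equiv> structure_tree V E k"
    and "arev \<equiv> structure_tree_rev V E k"
    and "\<psi> \<equiv> tree_vertex_action V E k \<phi>"
    and "\<eta> \<equiv> tree_arc_action V E k \<phi>"
  assumes "simple_graph V E" and "locally_finite V E" and "induces_connected E V"
    and "accessible_with V E k"
    and "group G" and "finitely_generated G"
    and "acts_on_graph G V E \<phi>"
    and "finite (orbits G V \<phi>)" and "finite (orbits G E (\<lambda>g. image (\<phi> g)))"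
    and "\<forall>v \<in> V. finite (stabilizer G \<phi> v)"
  shows "bidirected_tree T arev
    \<and> acts_on_bidirected G T arev \<psi> \<eta>
    \<and> finite (orbits G (verts T) \<psi>) \<and> finite (orbits G (arcs T) \<eta>)
    \<and> (\<forall>e \<in> arcs T. finite (stabilizer G \<eta> e)
          \<and> finite (stabilizer G (\<lambda>g. image (\<eta> g)) {e, arev e}))
    \<and> (\<forall>x \<in> verts T. finitely_generated (G\<lparr>carrier := stabilizer G \<psi> x\<rparr>)
          \<and> \<not> group_more_than_one_end (G\<lparr>carrier := stabilizer G \<psi> x\<rparr>))"
proof -
  interpret accessible_action V E k G \<phi>
    by unfold_locales (use assms in auto)
  show ?thesis
    unfolding T_def arev_def \<psi>_def \<eta>_def
    using structure_tree_is_tree acts_on_tree finite_orbits_verts finite_orbits_arcs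
      finite_arc_stabilizers vertex_stabilizer_ends by blast
qed

end
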